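(* Let $T>0$, $d\ge1$ and $N_0,N_1\in\mathbb{N}_0$. The positive function $\omega:(0,1]\to(0,1]$ with $\omega(\varepsilon)\to0$ as $\varepsilon\to0$ can be chosen so that the following holds. Let $q,u_0$ be distributions on $\mathbb{R}^d$ with $q$ non-negative (meaning that all regularisations of $q$ considered are non-negative functions). Assume that the regularisations $(q_\varepsilon)_\varepsilon,(\tilde q_\varepsilon)_\varepsilon$ of $q$ and $(u_{0,\varepsilon})_\varepsilon,(\tilde u_{0,\varepsilon})_\varepsilon$ of $u_0$ satisfy, with some constants $C_0,C_1>0$, for all $\varepsilon\in(0,1]$, $$\Vert q_\varepsilon\Vert_{L^\infty},\ \Vert\tilde q_\varepsilon\Vert_{L^\infty}\le C_0\,\omega(\varepsilon)^{-N_0},\qquad \Vert u_{0,\varepsilon}\Vert_{L^2},\ \Vert\tilde u_{0,\varepsilon}\Vert_{L^2}\le C_1\,\omega(\varepsilon)^{-N_1}.$$ Then the very weak solution to the Cauchy problem $$\partial_t u-\Delta u-q(x)u=0\ \text{ on }(0,T)\times\mathbb{R}^d,\qquad u(0,x)=u_0(x),$$ is unique, in the sense that whenever $$\Vert q_\varepsilon-\tilde q_\varepsilon\Vert_{L^\infty}\le C_k\varepsilon^k\ \text{ for all }k>0\quad\text{and}\quad\Vert u_{0,\varepsilon}-\tilde u_{0,\varepsilon}\Vert_{L^2}\le C_l\varepsilon^l\ \text{ for all }l>0,$$ then for every $N>0$ there is $C_N>0$ with $$\Vert u_\varepsilon(t,\cdot)-\tilde u_\varepsilon(t,\cdot)\Vert_{L^2}\le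 C_N\varepsilon^N\qquad\text{for all }t\in[0,T],\ \varepsilon\in(0,1],$$ where $u_\varepsilon$ and $\tilde u_\varepsilon$ solve, respectively, $\partial_t u_\varepsilon-\Delta u_\varepsilon-q_\varepsilon u_\varepsilon=0$, $u_\varepsilon(0,\cdot)=u_{0,\varepsilon}$, and $\partial_t\tilde u_\varepsilon-\Delta\tilde u_\varepsilon-\tilde q_\varepsilon\tilde u_\varepsilon=0$, $\tilde u_\varepsilon(0,\cdot)=\tilde u_{0,\varepsilon}$, on $(0,T)\times\mathbb{R}^d$.
   Context: A Friedrichs mollifier is a function $\psi\in C_0^\infty(\mathbb{R}^d)$ with $\psi\ge0$, $\int\psi=1$. Regularisations are obtained by convolution: for Friedrichs mollifiers $\psi,\tilde\psi$, put $\psi_\varepsilon(x)=\omega(\varepsilon)^{-d}\psi(x/\omega(\varepsilon))$, $\tilde\psi_\varepsilon(x)=\omega(\varepsilon)^{-d}\tilde\psi(x/\omega(\varepsilon))$, $\varepsilon\in(0,1]$, and $q_\varepsilon=q\ast\psi_\varepsilon$, $u_{0,\varepsilon}=u_0\ast\psi_\varepsilon$, $\tilde q_\varepsilon=q\ast\tilde\psi_\varepsilon$, $\tilde u_{0,\varepsilon}=u_0\ast\tilde\psi_\varepsilon$. Solutions of the regularised problems are the unique solutions in $C([0,T];L^2(\mathbb{R}^d))$. *)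

theory Defs
  imports "HOL-Analysis.Analysis" "HOL-Probability.Essential_Supremum"
begin

definition dir_deriv ::
    "'a::real_normed_vector \<Rightarrow> ('a \<Rightarrow> 'b::real_normed_vector) \<Rightarrow> 'a \<Rightarrow> 'b" where
  "dir_deriv v f x = frechet_derivative f (at x) v"

primrec iter_pderiv ::
    "'a list \<Rightarrow> ('a::real_normed_vector \<Rightarrow> 'b::real_normed_vector) \<Rightarrow> 'a \<Rightarrow> 'b" where
  "iter_pderiv [] f = f"
| "iter_pderiv (b # bs) f = dir_deriv b (iter_pderiv bs f)"

text \<open>Differentiability of all iterated partial derivatives makes them all continuous, so this is
  the class of infinitely often continuously differentiable functions.\<close>

definition smooth :: "('a::euclidean_space \<Rightarrow> 'b::real_normed_vector) \<Rightarrow> bool" where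
  "smooth f \<longleftrightarrow> (\<forall>bs. set bs \<subseteq> Basis \<longrightarrow> (\<forall>x. iter_pderiv bs f differentiable (at x)))"

definition supp :: "('a::topological_space \<Rightarrow> 'b::zero) \<Rightarrow> 'a set" where
  "supp f = closure {x. f x \<noteq> 0}"

definition test_function ::
    "'a::euclidean_space set \<Rightarrow> ('a \<Rightarrow> 'b::real_normed_vector) \<Rightarrow> bool" where
  "test_function U \<phi> \<longleftrightarrow> smooth \<phi> \<and> compact (supp \<phi>) \<and> supp \<phi> \<subseteq> U"

text \<open>Distributions on the whole space: linear functionals on complex test functions, with the
  usual continuity estimate on each compact set. Summing over lists of basis vectors counts mixed
  derivatives repeatedly, which only affects the constant.\<close>

definition is_distribution :: "(('a::euclidean_space \<Rightarrow> complex) \<Rightarrow> complex) \<Rightarrow> bool" where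
  "is_distribution D \<longleftrightarrow>
     (\<forall>\<phi> \<eta>. test_function UNIV \<phi> \<longrightarrow> test_function UNIV \<eta> \<longrightarrow>
        D (\<lambda>x. \<phi> x + \<eta> x) = D \<phi> + D \<eta>) \<and>
     (\<forall>c \<phi>. test_function UNIV \<phi> \<longrightarrow> D (\<lambda>x. c * \<phi> x) = c * D \<phi>) \<and>
     (\<forall>K. compact K \<longrightarrow> (\<exists>C m. \<forall>\<phi>. test_function UNIV \<phi> \<longrightarrow> supp \<phi> \<subseteq> K \<longrightarrow>
        norm (D \<phi>) \<le> C * (\<Sum>bs | set bs \<subseteq> Basis \<and> length bs \<le> m.
                              SUP x. norm (iter_pderiv bs \<phi> x))))"

definition friedrichs_mollifier :: "('a::euclidean_space \<Rightarrow> real) \<Rightarrow> bool" where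
  "friedrichs_mollifier \<psi> \<longleftrightarrow>
     test_function UNIV \<psi> \<and> (\<forall>x. \<psi> x \<ge> 0) \<and> (\<integral>x. \<psi> x \<partial>lborel) = 1"

definition rescale :: "real \<Rightarrow> ('a::euclidean_space \<Rightarrow> real) \<Rightarrow> 'a \<Rightarrow> real" where
  "rescale r \<psi> x = inverse (r ^ DIM('a)) * \<psi> (x /\<^sub>R r)"

definition convolve ::
    "(('a::euclidean_space \<Rightarrow> complex) \<Rightarrow> complex) \<Rightarrow> ('a \<Rightarrow> real) \<Rightarrow> 'a \<Rightarrow> complex" where
  "convolve D \<psi> x = D (\<lambda>y. complex_of_real (\<psi> (x - y)))"

definition regularise ::
    "(real \<Rightarrow> real) \<Rightarrow> ('a::euclidean_space \<Rightarrow> real) \<Rightarrow> (('a \<Rightarrow> complex) \<Rightarrow> complex) \<Rightarrow>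
     real \<Rightarrow> 'a \<Rightarrow> complex" where
  "regularise \<omega> \<psi> D \<epsilon> = convolve D (rescale (\<omega> \<epsilon>) \<psi>)"

definition Linf_norm :: "('a::euclidean_space \<Rightarrow> complex) \<Rightarrow> ereal" where
  "Linf_norm f = esssup lborel (\<lambda>x. ereal (norm (f x)))"

definition L2 :: "('a::euclidean_space \<Rightarrow> complex) set" where
  "L2 = {f. f \<in> borel_measurable lborel \<and> integrable lborel (\<lambda>x. (norm (f x))\<^sup>2)}"

text \<open>Only meaningful on \<open>L2\<close>: the Bochner integral of a non-integrable function is 0.\<close>

definition L2_norm :: "('a::euclidean_space \<Rightarrow> complex) \<Rightarrow> real" where
  "L2_norm f = sqrt (\<integral>x. (norm (f x))\<^sup>2 \<partial>lborel)"

definition cont_L2 :: "real \<Rightarrow> (real \<Rightarrow> 'a::euclidean_space \<Rightarrow> complex) \<Rightarrow> bool" where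
  "cont_L2 T u \<longleftrightarrow>
     (\<forall>t\<in>{0..T}. u t \<in> L2) \<and>
     (\<forall>t\<in>{0..T}. ((\<lambda>s. L2_norm (\<lambda>x. u s x - u t x)) \<longlongrightarrow> 0) (at t within {0..T}))"

definition time_deriv :: "(real \<times> 'a::euclidean_space \<Rightarrow> complex) \<Rightarrow> real \<times> 'a \<Rightarrow> complex" where
  "time_deriv \<phi> = dir_deriv (1, 0) \<phi>"

definition space_laplacian ::
    "(real \<times> 'a::euclidean_space \<Rightarrow> complex) \<Rightarrow> real \<times> 'a \<Rightarrow> complex" where
  "space_laplacian \<phi> z = (\<Sum>b\<in>Basis. dir_deriv (0, b) (dir_deriv (0, b) \<phi>) z)"

text \<open>Solutions in \<open>C([0,T]; L2)\<close> of \<open>\<partial>\<^sub>t u - \<Delta> u - p u = 0\<close>, \<open>u(0) = v\<close>, where the equation holds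
  in the sense of distributions on \<open>(0,T) \<times> R^d\<close>. The iterated integral is used because the
  representatives \<open>u t\<close> of the \<open>L2\<close> classes need not be jointly measurable in \<open>(t, x)\<close>, whereas
  the inner integral is a continuous function of \<open>t\<close> for locally bounded \<open>p\<close>.\<close>

definition heat_solution ::
    "real \<Rightarrow> ('a::euclidean_space \<Rightarrow> complex) \<Rightarrow> ('a \<Rightarrow> complex) \<Rightarrow>
     (real \<Rightarrow> 'a \<Rightarrow> complex) \<Rightarrow> bool" where
  "heat_solution T p v u \<longleftrightarrow>
     cont_L2 T u \<and> (AE x in lborel. u 0 x = v x) \<and>
     (\<forall>\<phi>. test_function ({0<..<T} \<times> UNIV) \<phi> \<longrightarrow>
        (LINT t:{0<..<T}|lborel. (\<integral>x. u t x *
            (- time_deriv \<phi> (t, x) - space_laplacian \<phi> (t, x) - p x * \<phi> (t, x)) \<partial>lborel)) = 0)"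

end

theory Submission
  imports Defs
begin

text \<open>
  Take \<open>\<omega>(\<epsilon>) = (1 + ln (1/\<epsilon>)) powr (-1/(N0+N1+1))\<close>, so that \<open>\<omega>(\<epsilon>)\<close> to the power \<open>-N0\<close> or \<open>-N1\<close> is
  at most \<open>1 + ln (1/\<epsilon>)\<close>; a factor \<open>exp (C T \<omega>(\<epsilon>) powr (-N0))\<close> then only costs a fixed power of
  \<open>1/\<epsilon>\<close>, which the negligible differences of the data absorb. The difference \<open>w = u - u'\<close> solves
  \<open>\<partial>\<^sub>t w - \<Delta> w = q w + (q - q') u'\<close>, so everything follows from the energy estimate
  \<open>|w(t)|\<^sup>2 \<le> |w(0)|\<^sup>2 + 2 \<integral>\<^sub>0\<^sup>t |F| |w|\<close> for distributional solutions of \<open>\<partial>\<^sub>t w - \<Delta> w = F\<close> in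
  \<open>C([0,T]; L2)\<close> and Gronwall's lemma.

  For the energy estimate, testing with \<open>\<theta>(t) \<rho>(x - y)\<close> and letting \<open>\<theta>\<close> tend to the indicator of an
  interval shows that, for each fixed \<open>x\<close>, the mollified solution \<open>w * \<rho>\<close> is continuously
  differentiable in time. Its energy identity is integrated over \<open>x\<close>; the Laplacian contributes a
  non-positive term because it is a limit of second difference quotients, which are dissipative by
  translation invariance and Cauchy-Schwarz. The mollification is removed by duality.
\<close>

section \<open>The space of square integrable functions\<close>

text \<open>The sections \<open>u t\<close> are mere representatives of L2 classes, without joint
  measurability in time and space, and no derivative of \<open>u\<close> is known to be a function.
  So the equation cannot be tested with the solution itself. Convolution in space gives a value at
  each point that is independent of the representative, and the result is jointly continuous, which
  is what Fubini needs. The potential term is treated as a given right-hand side \<open>F\<close> in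
  C([0,T]; L2), so that no commutator of multiplication and mollification arises. To remove the
  mollification, lower semicontinuity of the norm is enough; convergence of the mollified solutions
  in L2 is never established.

  \<open>\<omega>\<close> has to be fixed before C0, whereas the exponential costs the power -C0 T
  of \<epsilon>, whose exponent depends on C0. Negligibility of every order is what lets one
  \<open>\<omega>\<close> serve all constants. The difference of the potentials pays this cost
  twice: once for the size of the second solution and once for Gronwall's lemma applied to the
  difference of the solutions.\<close>

lemma L2_D [measurable_dest]: "f \<in> L2 \<Longrightarrow> f \<in> borel_measurable lborel"
  by (simp add: L2_def)

lemma L2_integrable: "f \<in> L2 \<Longrightarrow> integrable lborel (\<lambda>x. (norm (f x))\<^sup>2)"
  by (simp add: L2_def)

lemma L2_norm_nonneg [simp]: "L2_norm f \<ge> 0"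
  by (simp add: L2_norm_def)

lemma L2_norm_sq: "(L2_norm f)\<^sup>2 = (\<integral>x. (norm (f x))\<^sup>2 \<partial>lborel)"
  by (simp add: L2_norm_def)

lemma L2_I_bound:
  assumes "f \<in> L2" "g \<in> borel_measurable lborel" "AE x in lborel. norm (g x) \<le> C * norm (f x)"
  shows "g \<in> L2"
proof -
  have "integrable lborel (\<lambda>x. (norm (g x))\<^sup>2)"
  proof (rule Bochner_Integration.integrable_bound)
    show "integrable lborel (\<lambda>x. C\<^sup>2 * (norm (f x))\<^sup>2)"
      using L2_integrable[OF assms(1)] by simp
    show "AE x in lborel. norm ((norm (g x))\<^sup>2) \<le> norm (C\<^sup>2 * (norm (f x))\<^sup>2)"
      using assms(3)
    proof eventually_elim
      case (elim x)
      then have "(norm (g x))\<^sup>2 \<le> (C * norm (f x))\<^sup>2" by (intro power_mono) auto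
      then show ?case by (simp add: power_mult_distrib)
    qed
  qed (use assms in measurable)
  with assms show ?thesis by (simp add: L2_def)
qed

lemma L2_norm_bound:
  assumes "f \<in> L2" "g \<in> borel_measurable lborel" "AE x in lborel. norm (g x) \<le> C * norm (f x)"
      "C \<ge> 0"
  shows "L2_norm g \<le> C * L2_norm f"
proof -
  have "(\<integral>x. (norm (g x))\<^sup>2 \<partial>lborel) \<le> (\<integral>x. C\<^sup>2 * (norm (f x))\<^sup>2 \<partial>lborel)"
  proof (rule integral_mono_AE)
    show "AE x in lborel. (norm (g x))\<^sup>2 \<le> C\<^sup>2 * (norm (f x))\<^sup>2"
      using assms(3)
    proof eventually_elim
      case (elim x)
      then have "(norm (g x))\<^sup>2 \<le> (C * norm (f x))\<^sup>2" by (intro power_mono) auto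
      then show ?case by (simp add: power_mult_distrib)
    qed
  qed (use assms L2_I_bound[OF assms(1-3)] in \<open>auto simp: L2_integrable\<close>)
  also have "\<dots> = (C * L2_norm f)\<^sup>2" by (simp add: power_mult_distrib L2_norm_sq)
  finally have "(L2_norm g)\<^sup>2 \<le> (C * L2_norm f)\<^sup>2" by (simp add: L2_norm_sq)
  then show ?thesis using assms(4) by (rule power2_le_imp_le[OF _ mult_nonneg_nonneg]) simp
qed

lemma L2_norm_cong_AE:
  assumes "f \<in> borel_measurable lborel" "g \<in> borel_measurable lborel" "AE x in lborel. f x = g x"
  shows "L2_norm f = L2_norm g"
proof -
  have "(\<integral>x. (norm (f x))\<^sup>2 \<partial>lborel) = (\<integral>x. (norm (g x))\<^sup>2 \<partial>lborel)"
    by (rule integral_cong_AE) (use assms in auto)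
  then show ?thesis by (simp add: L2_norm_def)
qed

lemma L2_add:
  assumes "f \<in> L2" "g \<in> L2" shows "(\<lambda>x. f x + g x) \<in> L2"
proof -
  note [measurable] = L2_D[OF assms(1)] L2_D[OF assms(2)]
  have "integrable lborel (\<lambda>x. (norm (f x + g x))\<^sup>2)"
  proof (rule Bochner_Integration.integrable_bound)
    show "integrable lborel (\<lambda>x. 2 * (norm (f x))\<^sup>2 + 2 * (norm (g x))\<^sup>2)"
      using assms by (auto simp: L2_integrable)
    have "(norm (f x + g x))\<^sup>2 \<le> 2 * (norm (f x))\<^sup>2 + 2 * (norm (g x))\<^sup>2" for x
    proof -
      have "(norm (f x + g x))\<^sup>2 \<le> (norm (f x) + norm (g x))\<^sup>2"
        by (intro power_mono norm_triangle_ineq) auto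
      also have "\<dots> \<le> 2 * (norm (f x))\<^sup>2 + 2 * (norm (g x))\<^sup>2"
        using sum_squares_ge_zero[of "norm (f x) - norm (g x)" 0]
            by (simp add: power2_eq_square algebra_simps)
      finally show ?thesis .
    qed
    then show "AE x in lborel. norm ((norm (f x + g x))\<^sup>2) \<le> norm (2 * (norm (f x))\<^sup>2
        + 2 * (norm (g x))\<^sup>2)"
      by auto
  qed measurable
  then show ?thesis by (simp add: L2_def)
qed

lemma L2_cmult: "f \<in> L2 \<Longrightarrow> (\<lambda>x. c * f x) \<in> L2"
  by (rule L2_I_bound[where C="norm c" and f=f]) (auto simp: norm_mult dest: L2_D)

lemma L2_diff: "f \<in> L2 \<Longrightarrow> g \<in> L2 \<Longrightarrow> (\<lambda>x. f x - g x) \<in> L2"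
  using L2_add[of f "\<lambda>x. - 1 * g x"] L2_cmult[of g "-1"] by simp

lemma L2_cnj: "f \<in> L2 \<Longrightarrow> (\<lambda>x. cnj (f x)) \<in> L2"
  by (rule L2_I_bound[where C=1 and f=f]) (use borel_measurable_continuous_onI[OF
      continuous_on_cnj[OF continuous_on_id]] in \<open>auto dest!: L2_D intro: measurable_compose\<close>)

lemma L2_norm_cnj [simp]: "L2_norm (\<lambda>x. cnj (f x)) = L2_norm f"
  by (simp add: L2_norm_def)

lemma indicator_cball_integrable:
  "integrable lborel (indicator (cball (0::'a::euclidean_space) R) :: 'a \<Rightarrow> real)"
  using emeasure_bounded_finite[OF bounded_cball[of "0::'a" R]] by simp

text \<open>Paired with an L2 function through \<open>L2_mult_integrable\<close>, this gives
  integrability on balls. It supplies the dominating functions wherever the other factor is bounded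
  and has bounded support.\<close>

lemma indicator_cball_L2:
  "(\<lambda>x::'a::euclidean_space. complex_of_real (indicator (cball 0 R) x)) \<in> L2"
proof -
  have "(\<lambda>x::'a. (cmod (complex_of_real (indicator (cball 0 R) x)))\<^sup>2) = indicator (cball 0 R)"
    by (auto simp: indicator_def)
  moreover have "(indicator (cball (0::'a) R) :: 'a \<Rightarrow> real) \<in> borel_measurable borel"
    by (rule borel_measurable_indicator) simp
  ultimately show ?thesis using indicator_cball_integrable[of R] by (simp add: L2_def)
qed

lemma L2_mult_integrable:
  assumes "f \<in> L2" "g \<in> L2" shows "integrable lborel (\<lambda>x. f x * g x)"
proof (rule Bochner_Integration.integrable_bound)
  show "integrable lborel (\<lambda>x. (norm (f x))\<^sup>2 + (norm (g x))\<^sup>2)"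
    using assms by (auto simp: L2_integrable)
  have "norm (f x * g x) \<le> (norm (f x))\<^sup>2 + (norm (g x))\<^sup>2" for x
  proof -
    have "2 * (norm (f x) * norm (g x)) \<le> (norm (f x))\<^sup>2 + (norm (g x))\<^sup>2"
      using sum_squares_bound[of "norm (f x)" "norm (g x)"] by (simp add: mult.assoc)
    moreover have "0 \<le> norm (f x) * norm (g x)" by simp
    ultimately show ?thesis unfolding norm_mult by linarith
  qed
  then show "AE x in lborel. norm (f x * g x) \<le> norm ((norm (f x))\<^sup>2 + (norm (g x))\<^sup>2)"
    by auto
qed (use assms in \<open>auto dest!: L2_D\<close>)

text \<open>The modulus stands under the integral because both the triangle inequality and the
  integrability bound in the energy identity need this stronger form.\<close>

lemma L2_cauchy_schwarz_norm:
  assumes "f \<in> L2" "g \<in> L2"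
  shows "(\<integral>x. norm (f x * g x) \<partial>lborel) \<le> L2_norm f * L2_norm g"
proof -
  note [measurable] = L2_D[OF assms(1)] L2_D[OF assms(2)]
  have i: "integrable lborel (\<lambda>x. norm (f x * g x))" using L2_mult_integrable[OF assms] by simp
  have "(\<integral>\<^sup>+x. ennreal (norm (f x)) * ennreal (norm (g x)) \<partial>lborel)\<^sup>2 \<le>
      (\<integral>\<^sup>+x. (ennreal (norm (f x)))\<^sup>2 \<partial>lborel) * (\<integral>\<^sup>+x. (ennreal (norm (g x)))\<^sup>2 \<partial>lborel)"
    by (rule Cauchy_Schwarz_nn_integral) measurable
  also have "(\<integral>\<^sup>+x. ennreal (norm (f x)) * ennreal (norm (g x)) \<partial>lborel)
      = ennreal (\<integral>x. norm (f x * g x) \<partial>lborel)"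
    by (subst nn_integral_eq_integral[OF i, symmetric]) (auto simp: norm_mult ennreal_mult)
  also have "(\<integral>\<^sup>+x. (ennreal (norm (f x)))\<^sup>2 \<partial>lborel) = ennreal ((L2_norm f)\<^sup>2)"
    by (subst L2_norm_sq, subst nn_integral_eq_integral[OF L2_integrable[OF assms(1)], symmetric])
        (auto simp: ennreal_power)
  also have "(\<integral>\<^sup>+x. (ennreal (norm (g x)))\<^sup>2 \<partial>lborel) = ennreal ((L2_norm g)\<^sup>2)"
    by (subst L2_norm_sq, subst nn_integral_eq_integral[OF L2_integrable[OF assms(2)], symmetric])
        (auto simp: ennreal_power)
  finally have "(\<integral>x. norm (f x * g x) \<partial>lborel)\<^sup>2 \<le> (L2_norm f * L2_norm g)\<^sup>2"
    by (simp add: ennreal_power power_mult_distrib flip: ennreal_mult)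
  then show ?thesis by (rule power2_le_imp_le) simp
qed

lemma L2_cauchy_schwarz:
  assumes "f \<in> L2" "g \<in> L2"
  shows "norm (\<integral>x. f x * g x \<partial>lborel) \<le> L2_norm f * L2_norm g"
  using integral_norm_bound[of lborel "\<lambda>x. f x * g x"] L2_cauchy_schwarz_norm[OF assms] by linarith

lemma L2_norm_add:
  assumes "f \<in> L2" "g \<in> L2"
  shows "L2_norm (\<lambda>x. f x + g x) \<le> L2_norm f + L2_norm g"
proof -
  have "(L2_norm (\<lambda>x. f x + g x))\<^sup>2 \<le> (\<integral>x. (norm (f x))\<^sup>2 + (norm (g x))\<^sup>2
      + 2 * norm (f x * g x) \<partial>lborel)"
    unfolding L2_norm_sq
  proof (rule integral_mono)
    fix x
    have "(norm (f x + g x))\<^sup>2 \<le> (norm (f x) + norm (g x))\<^sup>2"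
      by (intro power_mono norm_triangle_ineq) auto
    then show "(norm (f x + g x))\<^sup>2 \<le> (norm (f x))\<^sup>2 + (norm (g x))\<^sup>2 + 2 * norm (f x * g x)"
      by (simp add: power2_sum norm_mult algebra_simps)
  qed (use L2_add[OF assms] L2_mult_integrable[OF assms] assms in \<open>auto simp: L2_integrable\<close>)
  also have "\<dots> = (L2_norm f)\<^sup>2 + (L2_norm g)\<^sup>2 + 2 * (\<integral>x. norm (f x * g x) \<partial>lborel)"
    using L2_mult_integrable[OF assms] assms by (simp add: L2_integrable L2_norm_sq)
  also have "\<dots> \<le> (L2_norm f + L2_norm g)\<^sup>2"
    using L2_cauchy_schwarz_norm[OF assms] by (simp add: power2_sum)
  finally show ?thesis by (rule power2_le_imp_le) simp
qed

lemma L2_norm_cmult: "L2_norm (\<lambda>x. c * f x) = norm c * L2_norm f"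
  by (simp add: L2_norm_def norm_mult power_mult_distrib real_sqrt_mult)

lemma L2_norm_diff_commute: "L2_norm (\<lambda>x. f x - g x) = L2_norm (\<lambda>x. g x - f x)"
  by (simp add: L2_norm_def norm_minus_commute)

lemma L2_norm_diff:
  assumes "f \<in> L2" "g \<in> L2"
  shows "L2_norm (\<lambda>x. f x - g x) \<le> L2_norm f + L2_norm g"
  using L2_norm_add[OF assms(1) L2_cmult[OF assms(2), of "-1"]] L2_norm_cmult[of "-1" g] by simp

lemma L2_norm_triangle3:
  assumes "f \<in> L2" "g \<in> L2"
  shows "\<bar>L2_norm f - L2_norm g\<bar> \<le> L2_norm (\<lambda>x. f x - g x)"
  using L2_norm_add[OF L2_diff[OF assms] assms(2)] L2_norm_add[OF L2_diff[OF assms(2,1)] assms(1)]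
    L2_norm_diff_commute[of f g] by simp

section \<open>Continuous functions of time with values in L2\<close>

lemma cont_L2_L2: "cont_L2 T u \<Longrightarrow> t \<in> {0..T} \<Longrightarrow> u t \<in> L2"
  by (simp add: cont_L2_def)

lemma cont_L2_lim:
  "cont_L2 T u \<Longrightarrow> t \<in> {0..T} \<Longrightarrow> ((\<lambda>s. L2_norm (\<lambda>x. u s x - u t x)) \<longlongrightarrow> 0) (at t within {0..T})"
  by (simp add: cont_L2_def)

lemma cont_L2_norm:
  assumes "cont_L2 T u" shows "continuous_on {0..T} (\<lambda>t. L2_norm (u t))"
proof (unfold continuous_on_def, intro ballI)
  fix t assume t: "t \<in> {0..T}"
  have "((\<lambda>s. L2_norm (u s) - L2_norm (u t)) \<longlongrightarrow> 0) (at t within {0..T})"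
  proof (rule Lim_null_comparison[OF _ cont_L2_lim[OF assms t]])
    show "\<forall>\<^sub>F s in at t within {0..T}. norm (L2_norm (u s) - L2_norm (u t)) \<le> L2_norm (\<lambda>x. u s x
        - u t x)"
      unfolding eventually_at_filter
      by (rule always_eventually) (auto intro!: L2_norm_triangle3 cont_L2_L2[OF assms] t)
  qed
  then show "((\<lambda>s. L2_norm (u s)) \<longlongrightarrow> L2_norm (u t)) (at t within {0..T})"
    by (simp add: LIM_zero_iff)
qed

text \<open>Weak continuity: pairing with a fixed function reduces the equation to scalar continuous
  functions of time, the setting of \<open>du_bois_reymond\<close>.\<close>

lemma cont_L2_pairing:
  assumes "cont_L2 T u" "g \<in> L2"
  shows "continuous_on {0..T} (\<lambda>t. \<integral>x. u t x * g x \<partial>lborel)"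
proof (unfold continuous_on_def, intro ballI)
  fix t assume t: "t \<in> {0..T}"
  have "((\<lambda>s. (\<integral>x. u s x * g x \<partial>lborel) - (\<integral>x. u t x * g x \<partial>lborel)) \<longlongrightarrow> 0) (at t within {0..T})"
  proof (rule Lim_null_comparison[OF _ tendsto_mult_left_zero[OF cont_L2_lim[OF assms(1) t]]])
    show "\<forall>\<^sub>F s in at t within {0..T}. norm ((\<integral>x. u s x * g x \<partial>lborel) - (\<integral>x. u t x * g x \<partial>lborel))
        \<le> L2_norm (\<lambda>x. u s x - u t x) * L2_norm g"
      unfolding eventually_at_filter
    proof (rule always_eventually, intro allI impI)
      fix s assume "s \<in> {0..T}"
      then have us: "u s \<in> L2" and ut: "u t \<in> L2" using assms t by (auto intro: cont_L2_L2)
      have "(\<integral>x. u s x * g x \<partial>lborel) - (\<integral>x. u t x * g x \<partial>lborel) = (\<integral>x. (u s x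
          - u t x) * g x \<partial>lborel)"
        using L2_mult_integrable[OF us assms(2)] L2_mult_integrable[OF ut assms(2)]
        by (simp add: left_diff_distrib)
      then show "norm ((\<integral>x. u s x * g x \<partial>lborel) - (\<integral>x. u t x * g x \<partial>lborel))
        \<le> L2_norm (\<lambda>x. u s x - u t x) * L2_norm g"
        using L2_cauchy_schwarz[OF L2_diff[OF us ut] assms(2)] by simp
    qed
  qed
  then show "((\<lambda>s. \<integral>x. u s x * g x \<partial>lborel) \<longlongrightarrow> (\<integral>x. u t x * g x \<partial>lborel)) (at t within {0..T})"
    by (simp add: LIM_zero_iff)
qed

lemma cont_L2_diff:
  assumes "cont_L2 T u" "cont_L2 T v"
  shows "cont_L2 T (\<lambda>t x. u t x - v t x)"
  unfolding cont_L2_def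
proof (intro conjI ballI)
  fix t assume t: "t \<in> {0..T}"
  then show "(\<lambda>x. u t x - v t x) \<in> L2" using assms by (intro L2_diff cont_L2_L2)
  show "((\<lambda>s. L2_norm (\<lambda>x. u s x - v s x - (u t x - v t x))) \<longlongrightarrow> 0) (at t within {0..T})"
  proof (rule Lim_null_comparison[OF _ tendsto_add_zero[OF cont_L2_lim[OF assms(1) t] cont_L2_lim[OF
      assms(2) t]]])
    show "\<forall>\<^sub>F s in at t within {0..T}. norm (L2_norm (\<lambda>x. u s x - v s x - (u t x - v t x)))
      \<le> L2_norm (\<lambda>x. u s x - u t x) + L2_norm (\<lambda>x. v s x - v t x)"
      unfolding eventually_at_filter
    proof (rule always_eventually, intro allI impI)
      fix s assume "s \<in> {0..T}"
      then have "(\<lambda>x. u s x - u t x) \<in> L2" "(\<lambda>x. v s x - v t x) \<in> L2" using assms t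
          by (auto intro!: L2_diff intro: cont_L2_L2)
      then show "norm (L2_norm (\<lambda>x. u s x - v s x - (u t x - v t x)))
          \<le> L2_norm (\<lambda>x. u s x - u t x) + L2_norm (\<lambda>x. v s x - v t x)"
        using L2_norm_diff[of "\<lambda>x. u s x - u t x" "\<lambda>x. v s x - v t x"] by (simp add: algebra_simps)
    qed
  qed
qed

lemma bounded_mult_L2:
  assumes "f \<in> L2" "p \<in> borel_measurable lborel" "AE x in lborel. norm (p x) \<le> M"
  shows "(\<lambda>x. p x * f x) \<in> L2"
proof (rule L2_I_bound[OF assms(1), where C=M])
  show "AE x in lborel. norm (p x * f x) \<le> M * norm (f x)"
    using assms(3) by eventually_elim (auto simp: norm_mult mult_right_mono)
qed (use assms in \<open>auto dest!: L2_D\<close>)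

lemma bounded_mult_L2_norm:
  assumes "f \<in> L2" "p \<in> borel_measurable lborel" "AE x in lborel. norm (p x) \<le> M" "M \<ge> 0"
  shows "L2_norm (\<lambda>x. p x * f x) \<le> M * L2_norm f"
proof (rule L2_norm_bound[OF assms(1) _ _ assms(4)])
  show "AE x in lborel. norm (p x * f x) \<le> M * norm (f x)"
    using assms(3) by eventually_elim (auto simp: norm_mult mult_right_mono)
qed (use assms in \<open>auto dest!: L2_D\<close>)

text \<open>Makes the potential term admissible as a right-hand side: for a bounded potential it is
  again continuous in time with values in L2.\<close>

lemma cont_L2_bounded_mult:
  assumes u: "cont_L2 T u" and p: "p \<in> borel_measurable lborel" "AE x in lborel. norm (p x) \<le> M"
      "M \<ge> 0"
  shows "cont_L2 T (\<lambda>t x. p x * u t x)"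
  unfolding cont_L2_def
proof (intro conjI ballI)
  fix t assume t: "t \<in> {0..T}"
  have ut: "u t \<in> L2" using t u by (intro cont_L2_L2)
  show "(\<lambda>x. p x * u t x) \<in> L2" by (rule bounded_mult_L2[OF ut p(1,2)])
  show "((\<lambda>s. L2_norm (\<lambda>x. p x * u s x - p x * u t x)) \<longlongrightarrow> 0) (at t within {0..T})"
  proof (rule Lim_null_comparison[OF _ tendsto_mult_right_zero[OF cont_L2_lim[OF u t]]])
    show "\<forall>\<^sub>F s in at t within {0..T}. norm (L2_norm (\<lambda>x. p x * u s x - p x * u t x))
      \<le> M * L2_norm (\<lambda>x. u s x - u t x)"
      unfolding eventually_at_filter
    proof (rule always_eventually, intro allI impI)
      fix s assume "s \<in> {0..T}"
      then have "(\<lambda>x. u s x - u t x) \<in> L2" using u t by (auto intro!: L2_diff intro: cont_L2_L2)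
      from bounded_mult_L2_norm[OF this p]
      show "norm (L2_norm (\<lambda>x. p x * u s x - p x * u t x)) \<le> M * L2_norm (\<lambda>x. u s x - u t x)"
        by (simp add: right_diff_distrib)
    qed
  qed
qed

section \<open>Smooth functions and test functions\<close>

lemma dir_deriv_eqI: "(f has_derivative f') (at x) \<Longrightarrow> dir_deriv v f x = f' v"
  unfolding dir_deriv_def by (simp add: frechet_derivative_at[symmetric])

lemma has_derivative_dir_deriv:
  "f differentiable (at x) \<Longrightarrow> (f has_derivative (\<lambda>v. dir_deriv v f x)) (at x)"
  unfolding dir_deriv_def by (simp add: frechet_derivative_works eta_contract_eq)

lemma iter_pderiv_append: "iter_pderiv (bs @ cs) f = iter_pderiv bs (iter_pderiv cs f)"
  by (induction bs) auto

lemma smooth_differentiable: "smooth f \<Longrightarrow> f differentiable (at x)"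
  unfolding smooth_def by (metis empty_set empty_subsetI iter_pderiv.simps(1))

lemma smooth_dir_deriv:
  assumes "smooth f" "b \<in> Basis" shows "smooth (dir_deriv b f)"
  unfolding smooth_def
proof (intro allI impI)
  fix bs :: "'a list" and x assume "set bs \<subseteq> Basis"
  then have "set (bs @ [b]) \<subseteq> Basis" using assms by simp
  then have "iter_pderiv (bs @ [b]) f differentiable (at x)" using assms unfolding smooth_def
      by blast
  then show "iter_pderiv bs (dir_deriv b f) differentiable (at x)"
    by (simp only: iter_pderiv_append iter_pderiv.simps)
qed

text \<open>Smooth functions form the largest class of differentiable functions closed under partial
  derivatives. In the applications \<open>P\<close> describes the shape of a formula that
  differentiation preserves.\<close>

lemma smooth_coinduct:
  fixes f :: "'a::euclidean_space \<Rightarrow> 'b::real_normed_vector"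
  assumes "P f" "\<And>f x. P f \<Longrightarrow> f differentiable (at x)"
    "\<And>f b. P f \<Longrightarrow> b \<in> Basis \<Longrightarrow> P (dir_deriv b f)"
  shows "smooth f"
proof -
  have "P (iter_pderiv bs f)" if "set bs \<subseteq> Basis" for bs :: "'a list"
    using that by (induction bs) (auto simp: assms(1,3))
  then show ?thesis unfolding smooth_def using assms(2) by blast
qed

lemma smooth_continuous: "smooth f \<Longrightarrow> continuous_on S f"
  by (meson continuous_at_imp_continuous_on differentiable_imp_continuous_within
      smooth_differentiable)

lemma dir_deriv_affine:
  assumes "f differentiable (at (a + r *\<^sub>R y))"
  shows "((\<lambda>y. c *\<^sub>R f (a + r *\<^sub>R y)) has_derivative (\<lambda>v. (c * r) *\<^sub>R dir_deriv v f (a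
      + r *\<^sub>R y))) (at y)"
proof -
  note d = has_derivative_dir_deriv[OF assms]
  have "((\<lambda>y. a + r *\<^sub>R y) has_derivative (\<lambda>v. r *\<^sub>R v)) (at y)"
    by (auto intro!: derivative_eq_intros)
  from has_derivative_compose[OF this d]
  have "((\<lambda>y. f (a + r *\<^sub>R y)) has_derivative (\<lambda>v. dir_deriv (r *\<^sub>R v) f (a + r *\<^sub>R y))) (at y)"
      by simp
  from has_derivative_scaleR_right[OF this, of c]
  show ?thesis using linear_cmul[OF has_derivative_linear[OF d]] by simp
qed

text \<open>The factor \<open>c\<close> is needed for the coinduction: each derivative multiplies it
  by \<open>r\<close> and otherwise keeps the shape. With \<open>r\<close> equal to -1 the lemma
  covers reflected kernels.\<close>

lemma smooth_affine:
  assumes "smooth f" shows "smooth (\<lambda>y. c *\<^sub>R f (a + r *\<^sub>R y))"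
proof (rule smooth_coinduct[where P="\<lambda>g. \<exists>f c. smooth f \<and> g = (\<lambda>y. c *\<^sub>R f (a + r *\<^sub>R y))"])
  show "\<exists>f' c'. smooth f' \<and> (\<lambda>y. c *\<^sub>R f (a + r *\<^sub>R y)) = (\<lambda>y. c' *\<^sub>R f' (a + r *\<^sub>R y))"
    using assms by blast
next
  fix g x assume "\<exists>f c. smooth f \<and> g = (\<lambda>y. c *\<^sub>R f (a + r *\<^sub>R y))"
  then show "g differentiable (at x)"
    using dir_deriv_affine smooth_differentiable unfolding differentiable_def by blast
next
  fix g and b :: 'a assume "\<exists>f c. smooth f \<and> g = (\<lambda>y. c *\<^sub>R f (a + r *\<^sub>R y))" and b: "b \<in> Basis"
  then obtain f c where f: "smooth f" "g = (\<lambda>y. c *\<^sub>R f (a + r *\<^sub>R y))" by auto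
  have "dir_deriv b g = (\<lambda>y. (c * r) *\<^sub>R dir_deriv b f (a + r *\<^sub>R y))"
    using dir_deriv_eqI[OF dir_deriv_affine[OF smooth_differentiable[OF f(1)]]] f(2) by fast
  then show "\<exists>f c. smooth f \<and> dir_deriv b g = (\<lambda>y. c *\<^sub>R f (a + r *\<^sub>R y))"
    using smooth_dir_deriv[OF f(1) b] by blast
qed

lemma dir_deriv_affine_eq:
  "smooth f \<Longrightarrow> dir_deriv b (\<lambda>y. c *\<^sub>R f (a + r *\<^sub>R y)) = (\<lambda>y. (c * r) *\<^sub>R dir_deriv b f (a
      + r *\<^sub>R y))"
  using dir_deriv_eqI[OF dir_deriv_affine[OF smooth_differentiable]] by fast

lemma smooth_diff:
  fixes f g :: "'a::euclidean_space \<Rightarrow> 'b::real_normed_vector"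
  assumes "smooth f" "smooth g" shows "smooth (\<lambda>x. f x - g x)"
proof (rule smooth_coinduct[where P="\<lambda>h. \<exists>f g. smooth f \<and> smooth g \<and> h = (\<lambda>x. f x - g x)"])
  show "\<exists>f' g'. smooth f' \<and> smooth g' \<and> (\<lambda>x. f x - g x) = (\<lambda>x. f' x - g' x)"
    using assms by blast
next
  fix h :: "'a \<Rightarrow> 'b" and x assume "\<exists>f g. smooth f \<and> smooth g \<and> h = (\<lambda>x. f x - g x)"
  then obtain f g where "smooth f" "smooth g" "h = (\<lambda>x. f x - g x)" by blast
  then show "h differentiable (at x)" using differentiable_diff smooth_differentiable by blast
next
  fix h :: "'a \<Rightarrow> 'b" and b :: 'a assume "\<exists>f g. smooth f \<and> smooth g \<and> h = (\<lambda>x. f x - g x)" and b: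
      "b \<in> Basis"
  then obtain f g where f: "smooth f" "smooth g" "h = (\<lambda>x. f x - g x)" by auto
  have "dir_deriv b h x = dir_deriv b f x - dir_deriv b g x" for x
    unfolding f(3) by (rule dir_deriv_eqI, intro has_derivative_diff has_derivative_dir_deriv
        smooth_differentiable f)
  then show "\<exists>f g. smooth f \<and> smooth g \<and> dir_deriv b h = (\<lambda>x. f x - g x)"
    using smooth_dir_deriv[OF f(1) b] smooth_dir_deriv[OF f(2) b] by blast
qed

text \<open>Differentiating the restriction to a line in direction \<open>b\<close> restricts
  \<open>dir_deriv b f\<close> to the same line, so the restrictions of smooth functions form a
  class closed under derivatives.\<close>

lemma smooth_line:
  fixes f :: "'a::euclidean_space \<Rightarrow> real"
  assumes "smooth f" "b \<in> Basis" shows "smooth (\<lambda>t::real. f (x0 + t *\<^sub>R b))"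
proof (rule smooth_coinduct[where P="\<lambda>g. \<exists>f. smooth f \<and> g = (\<lambda>t::real. f (x0 + t *\<^sub>R b))"])
  show "\<exists>f'. smooth f' \<and> (\<lambda>t::real. f (x0 + t *\<^sub>R b)) = (\<lambda>t. f' (x0 + t *\<^sub>R b))"
    using assms by blast
next
  have D: "((\<lambda>t. f (x0 + t *\<^sub>R b)) has_derivative (\<lambda>s. dir_deriv (s *\<^sub>R b) f (x0
      + t *\<^sub>R b))) (at t)"
    if "smooth f" for f :: "'a \<Rightarrow> real" and t
  proof -
    have "((\<lambda>t. x0 + t *\<^sub>R b) has_derivative (\<lambda>s. s *\<^sub>R b)) (at t)"
      by (auto intro!: derivative_eq_intros)
    from has_derivative_compose[OF this has_derivative_dir_deriv[OF smooth_differentiable[OF that]]]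
    show ?thesis by simp
  qed
  {
    fix g :: "real \<Rightarrow> real" and x assume "\<exists>f. smooth f \<and> g = (\<lambda>t::real. f (x0 + t *\<^sub>R b))"
    then obtain f :: "'a \<Rightarrow> real" where "smooth f" "g = (\<lambda>t. f (x0 + t *\<^sub>R b))" by blast
    then show "g differentiable (at x)" using D[of f x] unfolding differentiable_def by blast
  next
    fix g :: "real \<Rightarrow> real" and b' :: real assume "\<exists>f. smooth f \<and> g = (\<lambda>t::real. f (x0 + t *\<^sub>R b))"
        and b': "b' \<in> Basis"
    then obtain f where f: "smooth f" "g = (\<lambda>t::real. f (x0 + t *\<^sub>R b))" by auto
    have "dir_deriv b' g = (\<lambda>t. dir_deriv b f (x0 + t *\<^sub>R b))"
      using dir_deriv_eqI[OF D[OF f(1)], of b'] b' f(2) by auto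
    then show "\<exists>f. smooth f \<and> dir_deriv b' g = (\<lambda>t::real. f (x0 + t *\<^sub>R b))"
      using smooth_dir_deriv[OF f(1) assms(2)] by blast
  }
qed

section \<open>Products of a function of time and a function of space\<close>

lemma tensor_has_derivative:
  fixes \<theta> :: "real \<Rightarrow> real" and \<eta> :: "'a::euclidean_space \<Rightarrow> real"
  assumes "smooth \<theta>" "smooth \<eta>"
  shows "((\<lambda>z. complex_of_real (\<theta> (fst z) * \<eta> (snd z))) has_derivative
    (\<lambda>v. complex_of_real (\<theta> (fst z) * dir_deriv (snd v) \<eta> (snd z) + dir_deriv (fst v) \<theta> (fst z) * \<eta>
        (snd z)))) (at z)"
proof -
  have 1: "((\<lambda>z. \<theta> (fst z)) has_derivative (\<lambda>v. dir_deriv (fst v) \<theta> (fst z))) (at z)" 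
    by (rule has_derivative_compose[where f=fst, OF has_derivative_fst[OF has_derivative_ident]
        has_derivative_dir_deriv[OF smooth_differentiable[OF assms(1)]]])
  have 2: "((\<lambda>z. \<eta> (snd z)) has_derivative (\<lambda>v. dir_deriv (snd v) \<eta> (snd z))) (at z)" 
    by (rule has_derivative_compose[where f=snd, OF has_derivative_snd[OF has_derivative_ident]
        has_derivative_dir_deriv[OF smooth_differentiable[OF assms(2)]]])
  show ?thesis
    by (rule has_derivative_of_real[OF has_derivative_mult[OF 1 2]])
qed

lemma dir_deriv_0 [simp]: "f differentiable (at x) \<Longrightarrow> dir_deriv 0 f x = 0"
  using linear_0[OF has_derivative_linear[OF has_derivative_dir_deriv]] by blast

lemma dir_deriv_tensor_time:
  fixes \<theta> :: "real \<Rightarrow> real" and \<eta> :: "'a::euclidean_space \<Rightarrow> real"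
  assumes "smooth \<theta>" "smooth \<eta>"
  shows "dir_deriv (s, 0) (\<lambda>z. complex_of_real (\<theta> (fst z) * \<eta> (snd z))) =
    (\<lambda>z. complex_of_real (dir_deriv s \<theta> (fst z) * \<eta> (snd z)))"
  using dir_deriv_eqI[OF tensor_has_derivative[OF assms]] smooth_differentiable[OF assms(2)] by auto

lemma dir_deriv_tensor_space:
  fixes \<theta> :: "real \<Rightarrow> real" and \<eta> :: "'a::euclidean_space \<Rightarrow> real"
  assumes "smooth \<theta>" "smooth \<eta>"
  shows "dir_deriv (0, b) (\<lambda>z. complex_of_real (\<theta> (fst z) * \<eta> (snd z))) =
    (\<lambda>z. complex_of_real (\<theta> (fst z) * dir_deriv b \<eta> (snd z)))"
  using dir_deriv_eqI[OF tensor_has_derivative[OF assms]] smooth_differentiable[OF assms(1)] by auto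

text \<open>A basis vector of the product space points either in time or in space, so each
  derivative falls on exactly one factor and leaves a product of the same kind.\<close>

lemma smooth_tensor:
  fixes \<theta> :: "real \<Rightarrow> real" and \<eta> :: "'a::euclidean_space \<Rightarrow> real"
  assumes "smooth \<theta>" "smooth \<eta>"
  shows "smooth (\<lambda>z. complex_of_real (\<theta> (fst z) * \<eta> (snd z)))"
proof (rule smooth_coinduct[where P="\<lambda>h. \<exists>(\<theta>::real\<Rightarrow>real) (\<eta>::'a\<Rightarrow>real). smooth \<theta> \<and> smooth \<eta> \<and> h
    = (\<lambda>z. complex_of_real (\<theta> (fst z) * \<eta> (snd z)))"])
  show "\<exists>(\<theta>'::real\<Rightarrow>real) (\<eta>'::'a\<Rightarrow>real). smooth \<theta>' \<and> smooth \<eta>' \<and>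
     (\<lambda>z. complex_of_real (\<theta> (fst z) * \<eta> (snd z))) = (\<lambda>z. complex_of_real (\<theta>' (fst z) * \<eta>' (snd
         z)))"
    using assms by blast
next
  fix h and x :: "real \<times> 'a" assume "\<exists>(\<theta>::real\<Rightarrow>real) (\<eta>::'a\<Rightarrow>real). smooth \<theta> \<and> smooth \<eta> \<and> h
      = (\<lambda>z. complex_of_real (\<theta> (fst z) * \<eta> (snd z)))"
  then show "h differentiable (at x)" using tensor_has_derivative unfolding differentiable_def
      by blast
next
  fix h and b :: "real \<times> 'a"
  assume "\<exists>(\<theta>::real\<Rightarrow>real) (\<eta>::'a\<Rightarrow>real). smooth \<theta> \<and> smooth \<eta> \<and> h
      = (\<lambda>z. complex_of_real (\<theta> (fst z) * \<eta> (snd z)))" and b: "b \<in> Basis"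
  then obtain \<theta> :: "real \<Rightarrow> real" and \<eta> :: "'a \<Rightarrow> real" where f: "smooth \<theta>" "smooth \<eta>"
      "h = (\<lambda>z. complex_of_real (\<theta> (fst z) * \<eta> (snd z)))" by auto
  from b consider "b = (1, 0)" | c where "b = (0, c)" "c \<in> Basis" by (auto simp: Basis_prod_def)
  then show "\<exists>(\<theta>::real\<Rightarrow>real) (\<eta>::'a\<Rightarrow>real). smooth \<theta> \<and> smooth \<eta> \<and> dir_deriv b h
      = (\<lambda>z. complex_of_real (\<theta> (fst z) * \<eta> (snd z)))"
  proof cases
    case 1
    then show ?thesis using dir_deriv_tensor_time[OF f(1,2), of 1] smooth_dir_deriv[OF f(1), of 1] f
        by auto
  next
    case 2
    then show ?thesis using dir_deriv_tensor_space[OF f(1,2), of c] smooth_dir_deriv[OF f(2), of c]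
        f by blast
  qed
qed

definition laplacian :: "('a::euclidean_space \<Rightarrow> real) \<Rightarrow> 'a \<Rightarrow> real" where
  "laplacian \<eta> x = (\<Sum>b\<in>Basis. dir_deriv b (dir_deriv b \<eta>) x)"

lemma time_deriv_tensor:
  assumes "smooth \<theta>" "smooth \<eta>"
  shows "time_deriv (\<lambda>z. complex_of_real (\<theta> (fst z) * \<eta> (snd z))) (t, x)
      = complex_of_real (dir_deriv 1 \<theta> t * \<eta> x)"
  using dir_deriv_tensor_time[OF assms] by (simp add: time_deriv_def)

lemma space_laplacian_tensor:
  assumes "smooth \<theta>" "smooth \<eta>"
  shows "space_laplacian (\<lambda>z. complex_of_real (\<theta> (fst z) * \<eta> (snd z))) (t, x)
      = complex_of_real (\<theta> t * laplacian \<eta> x)"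
proof -
  have "dir_deriv (0, b) (dir_deriv (0, b) (\<lambda>z. complex_of_real (\<theta> (fst z) * \<eta> (snd z)))) (t, x)
    = complex_of_real (\<theta> t * dir_deriv b (dir_deriv b \<eta>) x)" if "b \<in> Basis" for b
    using dir_deriv_tensor_space[OF assms, of b] dir_deriv_tensor_space[OF assms(1)
        smooth_dir_deriv[OF assms(2) that], of b] by simp
  then show ?thesis by (simp add: space_laplacian_def laplacian_def sum_distrib_left)
qed

section \<open>Supports of test functions\<close>

lemma test_functionI:
  assumes "smooth f" "\<And>x. f x \<noteq> 0 \<Longrightarrow> x \<in> K" "compact K" "K \<subseteq> U"
  shows "test_function U f"
proof -
  have "supp f \<subseteq> K" unfolding supp_def using assms
      by (intro closure_minimal) (auto simp: compact_imp_closed)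
  moreover have "closed (supp f)" by (simp add: supp_def)
  ultimately show ?thesis using assms unfolding test_function_def
    by (metis closed_Int_compact inf.absorb_iff1 subset_trans)
qed

lemma test_function_smooth: "test_function U f \<Longrightarrow> smooth f"
  by (simp add: test_function_def)

lemma supp_outside: "x \<notin> supp f \<Longrightarrow> f x = 0"
  unfolding supp_def using closure_subset[of "{x. f x \<noteq> 0}"] by auto

text \<open>The complement of \<open>supp f\<close> is open and \<open>f\<close> vanishes on it,
  hence so does every derivative of \<open>f\<close>.\<close>

lemma test_function_dir_deriv:
  assumes "test_function U f" "b \<in> Basis" shows "test_function U (dir_deriv b f)"
proof (rule test_functionI[where K="supp f"])
  show "smooth (dir_deriv b f)" using assms smooth_dir_deriv test_function_def by blast
  show "x \<in> supp f" if "dir_deriv b f x \<noteq> 0" for x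
  proof (rule ccontr)
    assume x: "x \<notin> supp f"
    have "open (- supp f)" by (simp add: supp_def open_Compl)
    have "(f has_derivative (\<lambda>_. 0)) (at x)"
    proof (rule has_derivative_transform_within_open[OF has_derivative_const[of 0] \<open>open (- supp
        f)\<close>])
      show "x \<in> - supp f" using x by simp
      show "0 = f y" if "y \<in> - supp f" for y using that supp_outside[of y f] by simp
    qed
    from dir_deriv_eqI[OF this] that show False by simp
  qed
qed (use assms in \<open>auto simp: test_function_def\<close>)

lemma test_function_bounded_support:
  fixes f :: "'a::euclidean_space \<Rightarrow> 'b::real_normed_vector"
  assumes "test_function U f"
  obtains L where "L > 0" "\<And>x. norm x > L \<Longrightarrow> f x = 0"
proof -
  have "bounded (supp f)" using assms by (simp add: test_function_def compact_imp_bounded)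
  then obtain L where L: "L > 0" "\<And>x. x \<in> supp f \<Longrightarrow> norm x \<le> L" by (meson bounded_pos)
  show ?thesis by (rule that[OF L(1)]) (use L(2) supp_outside[of _ f] in force)
qed

lemma tensor_test_function:
  fixes \<theta> :: "real \<Rightarrow> real" and \<eta> :: "'a::euclidean_space \<Rightarrow> real"
  assumes "test_function {0<..<T} \<theta>" "test_function UNIV \<eta>"
  shows "test_function ({0<..<T} \<times> UNIV) (\<lambda>z. complex_of_real (\<theta> (fst z) * \<eta> (snd z)))"
proof (rule test_functionI[where K="supp \<theta> \<times> supp \<eta>"])
  show "smooth (\<lambda>z. complex_of_real (\<theta> (fst z) * \<eta> (snd z)))"
    using assms by (intro smooth_tensor) (auto simp: test_function_def)
  show "compact (supp \<theta> \<times> supp \<eta>)" using assms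
      by (intro compact_Times) (auto simp: test_function_def)
  fix z assume "complex_of_real (\<theta> (fst z) * \<eta> (snd z)) \<noteq> 0"
  then show "z \<in> supp \<theta> \<times> supp \<eta>" using supp_outside[of "fst z" \<theta>] supp_outside[of "snd z" \<eta>]
      by (cases z) auto
qed (use assms in \<open>auto simp: test_function_def\<close>)

lemma test_function_affine:
  fixes f :: "'a::euclidean_space \<Rightarrow> 'b::real_normed_vector"
  assumes "test_function UNIV f" "r \<noteq> 0"
  shows "test_function UNIV (\<lambda>y. c *\<^sub>R f (a + r *\<^sub>R y))"
proof -
  obtain L where L: "L > 0" "\<And>x. norm x > L \<Longrightarrow> f x = 0"
      using test_function_bounded_support[OF assms(1)] by metis
  show ?thesis
  proof (rule test_functionI[where K="cball 0 ((L + norm a) / \<bar>r\<bar>)"])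
    show "smooth (\<lambda>y. c *\<^sub>R f (a + r *\<^sub>R y))" using assms
        by (intro smooth_affine) (simp add: test_function_def)
    fix y assume "c *\<^sub>R f (a + r *\<^sub>R y) \<noteq> 0"
    then have "norm (a + r *\<^sub>R y) \<le> L" using L(2) by force
    then have "norm (r *\<^sub>R y) \<le> L + norm a" using norm_triangle_ineq4[of "a + r *\<^sub>R y" a] by simp
    then show "y \<in> cball 0 ((L + norm a) / \<bar>r\<bar>)" using assms(2) by (simp add: field_simps)
  qed auto
qed

section \<open>Weak derivatives in time\<close>

lemma test_function_integrable:
  fixes f :: "'a::euclidean_space \<Rightarrow> 'b::{banach,second_countable_topology}"
  assumes "test_function U f" shows "integrable lborel f"
proof -
  have "integrable lborel (\<lambda>x. indicator (supp f) x *\<^sub>R f x)"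
    using assms by (intro borel_integrable_compact smooth_continuous) (auto simp: test_function_def)
  also have "(\<lambda>x. indicator (supp f) x *\<^sub>R f x) = f" 
    using supp_outside[of _ f] by (force simp: indicator_def)
  finally show ?thesis .
qed

lemma smooth_borel_measurable [measurable_dest]:
  fixes f :: "'a::euclidean_space \<Rightarrow> 'b::real_normed_vector"
  shows "smooth f \<Longrightarrow> f \<in> borel_measurable borel"
  by (rule borel_measurable_continuous_onI[OF smooth_continuous])

text \<open>Restricting \<open>\<psi>\<close> to a line avoids constructing a bump function.\<close>

lemma mollifier_real_exists:
  assumes "friedrichs_mollifier (\<psi> :: 'a::euclidean_space \<Rightarrow> real)"
  obtains r :: "real \<Rightarrow> real" where "friedrichs_mollifier r"
proof -
  have tf: "test_function UNIV \<psi>" and nn: "\<And>x. \<psi> x \<ge> 0" and i1: "(\<integral>x. \<psi> x \<partial>lborel) = 1"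
    using assms by (auto simp: friedrichs_mollifier_def)
  obtain x0 where x0: "\<psi> x0 \<noteq> 0" using i1 by fastforce
  obtain b :: 'a where b: "b \<in> Basis" using nonempty_Basis by blast
  define f where "f = (\<lambda>t::real. \<psi> (x0 + t *\<^sub>R b))"
  have sf: "smooth f" unfolding f_def using tf b
      by (intro smooth_line) (auto simp: test_function_def)
  obtain L where L: "L > 0" "\<And>x. norm x > L \<Longrightarrow> \<psi> x = 0" using test_function_bounded_support[OF tf]
      by metis
  have f0: "f t \<noteq> 0 \<Longrightarrow> t \<in> cball 0 (L + norm x0)" for t
  proof -
    assume "f t \<noteq> 0"
    then have "norm (x0 + t *\<^sub>R b) \<le> L" using L(2) unfolding f_def by force
    then show ?thesis using norm_triangle_ineq4[of "x0 + t *\<^sub>R b" x0] b by simp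
  qed
  have tff: "test_function UNIV f" by (rule test_functionI[OF sf f0]) auto
  have int: "integrable lborel f" by (rule test_function_integrable[OF tff])
  have fnn: "f t \<ge> 0" for t using nn by (simp add: f_def)
  define c where "c = (\<integral>t. f t \<partial>lborel)"
  \<comment> \<open>If the integral were zero, the non-negative \<open>f\<close> would vanish almost
    everywhere. But the set where \<open>f\<close> is nonzero is open and contains 0, so it is not
    negligible.\<close>
  have "c \<noteq> 0"
  proof
    assume "c = 0"
    then have "AE t in lborel. f t = 0"
      using integral_nonneg_eq_0_iff_AE[OF int] fnn by (auto simp: c_def)
    have [measurable]: "f \<in> borel_measurable borel" by (rule smooth_borel_measurable[OF sf])
    have "{t. f t \<noteq> 0} \<in> sets lborel" by measurable
    then have "{t. f t \<noteq> 0} \<in> null_sets lborel"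
      using \<open>AE t in lborel. f t = 0\<close> by (simp add: AE_iff_null_sets)
    then have "negligible {t. f t \<noteq> 0}"
      by (simp add: negligible_iff_null_sets null_sets_completionI)
    moreover have "open {t. f t \<noteq> 0}"
      using open_Collect_neq[OF smooth_continuous[OF sf] continuous_on_const] by simp
    moreover have "0 \<in> {t. f t \<noteq> 0}" using x0 by (simp add: f_def)
    ultimately show False using open_not_negligible by blast
  qed
  moreover have "c \<ge> 0" unfolding c_def using fnn by simp
  ultimately have c: "c > 0" by simp
  have "friedrichs_mollifier (\<lambda>t. (1 / c) *\<^sub>R f (0 + 1 *\<^sub>R t))"
    unfolding friedrichs_mollifier_def using c fnn test_function_affine[OF tff, of 1 "1/c" 0] int
    by (auto simp: c_def[symmetric])
  then show ?thesis by (rule that)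
qed

text \<open>In the coinduction \<open>R\<close> itself is the only new member of the class, since a
  single derivative leads to the smooth function \<open>r\<close>.\<close>

lemma smooth_antideriv:
  fixes R r :: "real \<Rightarrow> real"
  assumes "\<And>x. (R has_real_derivative r x) (at x)" "smooth r"
  shows "smooth R"
proof (rule smooth_coinduct[where P="\<lambda>f. f = R \<or> smooth f"])
  have d: "(R has_derivative (\<lambda>v. v * r x)) (at x)" for x
    using assms(1)[of x] by (simp add: has_field_derivative_def mult_commute_abs)
  show "f differentiable (at x)" if "f = R \<or> smooth f" for f x
    using that d smooth_differentiable differentiable_def by blast
  show "dir_deriv b f = R \<or> smooth (dir_deriv b f)" if "f = R \<or> smooth f" "b \<in> Basis"
      for f and b :: real
  proof -
    have "dir_deriv 1 R = r" using dir_deriv_eqI[OF d, of 1] by auto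
    then show ?thesis using that smooth_dir_deriv[of f b] assms(2) by auto
  qed
qed simp

lemma dir_deriv_real:
  "(f has_real_derivative d) (at x) \<Longrightarrow> dir_deriv 1 f x = d"
  using dir_deriv_eqI[of f "(*) d" x 1] by (simp add: has_field_derivative_def)

text \<open>An approximate identity at \<open>a\<close>. The substitution
  \<open>t = a + s / real (Suc n)\<close> moves \<open>n\<close> from the weight into the argument
  of \<open>G\<close>. Dominated convergence with the bound \<open>r s * B\<close> then needs
  continuity at the single point \<open>a\<close>, so \<open>G\<close> may jump elsewhere.\<close>

lemma mollify_limit:
  fixes r :: "real \<Rightarrow> real" and G :: "real \<Rightarrow> complex"
  assumes r: "friedrichs_mollifier r" and [measurable]: "G \<in> borel_measurable borel"
    and B: "\<And>t. norm (G t) \<le> B" and cont: "isCont G a"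
  shows "(\<lambda>n. \<integral>t. (real (Suc n) * r (real (Suc n) * (t - a))) *\<^sub>R G t \<partial>lborel) \<longlonglongrightarrow> G a"
proof -
  have tf: "test_function UNIV r" and nn: "\<And>x. r x \<ge> 0" and i1: "(\<integral>x. r x \<partial>lborel) = 1"
    using r by (auto simp: friedrichs_mollifier_def)
  note int = test_function_integrable[OF tf]
  have [measurable]: "r \<in> borel_measurable borel" using tf
      by (auto simp: test_function_def intro: smooth_borel_measurable)
  have "(\<integral>t. (real (Suc n) * r (real (Suc n) * (t - a))) *\<^sub>R G t \<partial>lborel) = (\<integral>s. r s *\<^sub>R G (a
      + s / real (Suc n)) \<partial>lborel)" for n
    by (subst lborel_integral_real_affine[of "1 / real (Suc n)" _ a])
      (auto simp del: of_nat_Suc simp flip: integral_scaleR_right)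
  moreover have "(\<lambda>n. \<integral>s. r s *\<^sub>R G (a + s / real (Suc n)) \<partial>lborel) \<longlonglongrightarrow> (\<integral>s. r s *\<^sub>R G a \<partial>lborel)"
  proof (rule integral_dominated_convergence[where w="\<lambda>s. r s * B"])
    show "AE s in lborel. (\<lambda>n. r s *\<^sub>R G (a + s / real (Suc n))) \<longlonglongrightarrow> r s *\<^sub>R G a"
    proof (rule AE_I2, intro tendsto_intros)
      fix s
      have "(\<lambda>n. a + s * (1 / real (Suc n))) \<longlonglongrightarrow> a + s * 0"
        by (intro tendsto_intros lim_1_over_real_power[of 1, simplified] LIMSEQ_Suc[OF
            lim_1_over_n])
      then have "(\<lambda>n. a + s / real (Suc n)) \<longlonglongrightarrow> a" by simp
      then show "(\<lambda>n. G (a + s / real (Suc n))) \<longlonglongrightarrow> G a"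
        using isCont_tendsto_compose[OF cont] by blast
    qed
    show "AE s in lborel. norm (r s *\<^sub>R G (a + s / real (Suc n))) \<le> r s * B" for n
      using nn B by (auto intro!: mult_left_mono)
  qed (use int in auto)
  moreover have "(\<integral>s. r s *\<^sub>R G a \<partial>lborel) = G a" using int i1 by simp
  ultimately show ?thesis by simp
qed

text \<open>The weak equation is tested with smooth approximations of the indicator of [a,b]. Their
  derivatives are approximate identities at \<open>a\<close> and, with opposite sign, at
  \<open>b\<close>, so the limit is the integrated equation.\<close>

lemma du_bois_reymond_interior:
  fixes r :: "real \<Rightarrow> real" and g h :: "real \<Rightarrow> complex"
  assumes r: "friedrichs_mollifier r"
    and g: "continuous_on {0..T} g" and h: "continuous_on {0..T} h"
    and weak: "\<And>\<theta>::real\<Rightarrow>real. test_function {0<..<T} \<theta> \<Longrightarrow>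
      (LINT t:{0<..<T}|lborel. complex_of_real (dir_deriv 1 \<theta> t) * g t + complex_of_real (\<theta> t) * h
          t) = 0"
    and ab: "0 < a" "a < b" "b < T"
  shows "g b - g a = integral {a..b} h"
proof -
  have tf: "test_function UNIV r" and nn: "\<And>x. r x \<ge> 0" and i1: "(\<integral>x. r x \<partial>lborel) = 1"
    using r by (auto simp: friedrichs_mollifier_def)
  note int = test_function_integrable[OF tf]
  have sr: "smooth r" using tf by (simp add: test_function_def)
  then have rc: "continuous_on S r" for S by (rule smooth_continuous)
  obtain L where L: "L > 0" "\<And>x. norm x > L \<Longrightarrow> r x = 0" using test_function_bounded_support[OF tf]
      by metis
  \<comment> \<open>Starting one unit to the left of the support makes every \<open>s\<close> with
    \<open>s \<ge> -L\<close> an interior point of the interval on which the fundamental theorem is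
    applied.\<close>
  define R where "R = (\<lambda>s. integral {-L-1..s} r)"
  have R0: "R s = 0" if "s < -L" for s
    unfolding R_def using that by (subst integral_cong[where g="\<lambda>_. 0"]) (auto intro!: L(2))
  have R1: "R s = 1" if "s > L" for s
  proof -
    have "set_integrable lborel {-L-1..s} r" using int
        by (simp add: set_integrable_def integrable_real_mult_indicator mult.commute)
    then have "R s = (LINT x:{-L-1..s}|lborel. r x)" unfolding R_def
        by (simp add: set_borel_integral_eq_integral)
    also have "\<dots> = (\<integral>x. r x \<partial>lborel)" unfolding set_lebesgue_integral_def
    proof (rule Bochner_Integration.integral_cong[OF refl])
      fix x show "indicator {-L-1..s} x *\<^sub>R r x = r x"
        using L(2)[of x] that L(1) by (cases "\<bar>x\<bar> > L") (auto simp: indicator_def)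
    qed
    finally show ?thesis using i1 by simp
  qed
  \<comment> \<open>Far to the left the interval of integration is empty, so for
    \<open>s < -L\<close> the derivative comes from local vanishing of \<open>R\<close> instead of
    the fundamental theorem.\<close>
  have RD: "(R has_real_derivative r s) (at s)" for s
  proof (cases "s < -L")
    case True
    have "(R has_derivative (\<lambda>_. 0)) (at s)"
      by (rule has_derivative_transform_within_open[OF has_derivative_const[of 0], where
          s="{..<-L}"])
        (use True R0 in auto)
    moreover have "r s = 0" using True L by auto
    moreover have "(*) (0::real) = (\<lambda>_. 0)" by auto
    ultimately show ?thesis by (simp add: has_field_derivative_def)
  next
    case False
    have "(R has_real_derivative r s) (at s within {-L-1..s+1})"
      unfolding R_def by (rule integral_has_real_derivative[OF rc]) (use False in auto)
    then show ?thesis using False at_within_interior[of s "{-L-1..s+1}"]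
        by (simp add: interior_atLeastAtMost_real)
  qed
  have Rmono: "R s \<le> R t" if "s \<le> t" for s t
    by (rule DERIV_nonneg_imp_nondecreasing[OF that]) (use RD nn in blast)
  have Rb: "0 \<le> R s" "R s \<le> 1" for s
  proof -
    have "R (min s (-L-1)) \<le> R s" "R s \<le> R (max s (L+1))" by (auto intro!: Rmono)
    then show "0 \<le> R s" "R s \<le> 1" using R0[of "min s (-L-1)"] R1[of "max s (L+1)"] by auto
  qed
  have sR: "smooth R" by (rule smooth_antideriv[OF RD sr])
  have [measurable]: "R \<in> borel_measurable borel" "r \<in> borel_measurable borel"
    using sR sr by (auto intro: smooth_borel_measurable)
  \<comment> \<open>A smoothed indicator: it rises from 0 to 1 near \<open>a\<close> and falls back
    near \<open>b\<close>, in windows whose width is of order 1/n.\<close>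
  define \<theta> where "\<theta> n t = R (real (Suc n) * (t - a)) - R (real (Suc n) * (t - b))" for n t
  have [measurable]: "\<theta> n \<in> borel_measurable borel" for n unfolding \<theta>_def by measurable
  have \<theta>b: "\<bar>\<theta> n t\<bar> \<le> 1" for n t
    using Rb[of "real (Suc n) * (t - a)"] Rb[of "real (Suc n) * (t - b)"] unfolding \<theta>_def
        by linarith
  have \<theta>D: "dir_deriv 1 (\<theta> n) t = real (Suc n) * r (real (Suc n) * (t - a))
      - real (Suc n) * r (real (Suc n) * (t - b))" for n t
  proof (rule dir_deriv_real)
    show "(\<theta> n has_real_derivative real (Suc n) * r (real (Suc n) * (t - a))
        - real (Suc n) * r (real (Suc n) * (t - b))) (at t)"
      unfolding \<theta>_def
      by (auto intro!: derivative_eq_intros DERIV_chain2[OF RD] simp del: of_nat_Suc)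
  qed
  have s\<theta>: "smooth (\<theta> n)" for n
  proof -
    have "smooth (\<lambda>t. 1 *\<^sub>R R (- real (Suc n) * a + real (Suc n) *\<^sub>R t)
        - 1 *\<^sub>R R (- real (Suc n) * b + real (Suc n) *\<^sub>R t))"
      by (intro smooth_diff smooth_affine sR)
    moreover have "(\<lambda>t. 1 *\<^sub>R R (- real (Suc n) * a + real (Suc n) *\<^sub>R t)
        - 1 *\<^sub>R R (- real (Suc n) * b + real (Suc n) *\<^sub>R t)) = \<theta> n"
      by (auto simp: \<theta>_def algebra_simps)
    ultimately show ?thesis by simp
  qed
  \<comment> \<open>The distance from [a,b] to the end points of the time interval. Once
    \<open>real (Suc n) * m > L\<close>, both windows fit into the open interval (0,T).\<close>
  define m where "m = min a (T - b)"
  have m: "m > 0" using ab by (simp add: m_def)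
  have test: "test_function {0<..<T} (\<theta> n)" if n: "real (Suc n) * m > L" for n
  proof (rule test_functionI[OF s\<theta>, where K="{a - L / real (Suc n)..b + L / real (Suc n)}"])
    have "L / real (Suc n) < m" using n by (simp add: field_simps)
    then show "{a - L / real (Suc n)..b + L / real (Suc n)} \<subseteq> {0<..<T}" by (auto simp: m_def)
    fix t assume t: "\<theta> n t \<noteq> 0"
    have "t \<ge> a - L / real (Suc n)"
    proof (rule ccontr)
      assume "\<not> ?thesis"
      then have "real (Suc n) * (t - a) < -L" by (simp add: field_simps)
      moreover have "real (Suc n) * (t - b) \<le> real (Suc n) * (t - a)" using ab
          by (intro mult_left_mono) auto
      ultimately show False using t R0[of "real (Suc n) * (t - a)"] R0[of "real (Suc n) * (t - b)"]
          unfolding \<theta>_def by linarith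
    qed
    moreover have "t \<le> b + L / real (Suc n)"
    proof (rule ccontr)
      assume "\<not> ?thesis"
      then have "real (Suc n) * (t - b) > L" by (simp add: field_simps)
      moreover have "real (Suc n) * (t - b) \<le> real (Suc n) * (t - a)" using ab
          by (intro mult_left_mono) auto
      ultimately show False using t R1[of "real (Suc n) * (t - a)"] R1[of "real (Suc n) * (t - b)"]
          unfolding \<theta>_def by linarith
    qed
    ultimately show "t \<in> {a - L / real (Suc n)..b + L / real (Suc n)}" by simp
  qed auto
  \<comment> \<open>Extension by zero gives bounded functions on the whole line, as
    \<open>mollify_limit\<close> requires; the possible jumps at 0 and \<open>T\<close> stay away
    from \<open>a\<close> and \<open>b\<close>.\<close>
  define G where "G t = indicator {0<..<T} t *\<^sub>R g t" for t
  define H where "H t = indicator {0<..<T} t *\<^sub>R h t" for t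
  have meas: "(\<lambda>t. indicator {0<..<T} t *\<^sub>R f t) \<in> borel_measurable borel"
      if "continuous_on {0..T} f" for f :: "real \<Rightarrow> complex"
    by (rule borel_measurable_continuous_on_indicator[OF _ continuous_on_subset[OF that]]) auto
  have bd: "\<exists>B. \<forall>t. norm (indicator {0<..<T} t *\<^sub>R f t) \<le> B" if "continuous_on {0..T} f"
      for f :: "real \<Rightarrow> complex"
  proof -
    have "bounded (f ` {0..T})" by (intro compact_imp_bounded compact_continuous_image that) simp
    then obtain B where "B > 0" "\<And>t. t \<in> {0..T} \<Longrightarrow> norm (f t) \<le> B" by (auto simp: bounded_pos)
    then show ?thesis by (intro exI[of _ B]) (auto simp: indicator_def)
  qed
  have [measurable]: "G \<in> borel_measurable borel" "H \<in> borel_measurable borel"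
    using meas[OF g] meas[OF h] by (auto simp: G_def[abs_def] H_def[abs_def])
  obtain BG where BG: "\<And>t. norm (G t) \<le> BG" using bd[OF g] by (auto simp: G_def)
  have Gc: "isCont G t" if "t \<in> {0<..<T}" for t
  proof -
    have "isCont g t" using g that by (simp add: continuous_on_interior interior_atLeastAtMost_real)
    moreover have "\<forall>\<^sub>F s in nhds t. G s = g s"
      using eventually_nhds_in_open[of "{0<..<T}" t] that
          by (auto elim!: eventually_mono simp: G_def)
    ultimately show ?thesis by (simp add: isCont_cong)
  qed
  have Hint: "integrable lborel H"
    unfolding H_def using set_integrable_subset[OF borel_integrable_atLeastAtMost'[OF h], of
        "{0<..<T}"]
    by (auto simp: set_integrable_def greaterThanLessThan_subseteq_atLeastAtMost_iff)
  have Gint: "integrable lborel G"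
    unfolding G_def using set_integrable_subset[OF borel_integrable_atLeastAtMost'[OF g], of
        "{0<..<T}"]
    by (auto simp: set_integrable_def greaterThanLessThan_subseteq_atLeastAtMost_iff)
  define A where "A c n = (\<integral>t. (real (Suc n) * r (real (Suc n) * (t - c))) *\<^sub>R G t \<partial>lborel)" for c n
  define D where "D n = (\<integral>t. \<theta> n t *\<^sub>R H t \<partial>lborel)" for n
  have lA: "A c \<longlonglongrightarrow> g c" if "c \<in> {0<..<T}" for c
    using mollify_limit[OF r _ BG Gc[OF that]] that unfolding A_def by (simp add: G_def)
  have lD: "D \<longlonglongrightarrow> (\<integral>t. indicator {a..b} t *\<^sub>R h t \<partial>lborel)"
    unfolding D_def
  proof (rule integral_dominated_convergence[where w="\<lambda>t. norm (H t)"])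
    show "AE t in lborel. (\<lambda>n. \<theta> n t *\<^sub>R H t) \<longlonglongrightarrow> indicator {a..b} t *\<^sub>R h t"
      using AE_lborel_singleton[of a] AE_lborel_singleton[of b]
    proof eventually_elim
      case (elim t)
      have lim1: "(\<lambda>n. R (real (Suc n) * s)) \<longlonglongrightarrow> 1" if s: "s > 0" for s
      proof (rule tendsto_eventually)
        obtain N where N: "real N * s > L" using reals_Archimedean3[OF s] by blast
        show "\<forall>\<^sub>F n in sequentially. R (real (Suc n) * s) = 1"
          using eventually_ge_at_top[of N]
        proof eventually_elim
          case (elim n)
          then have "real N * s \<le> real (Suc n) * s" using s by (intro mult_right_mono) auto
          then show ?case using N by (intro R1) simp
        qed
      qed
      have lim0: "(\<lambda>n. R (real (Suc n) * s)) \<longlonglongrightarrow> 0" if s: "s < 0" for s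
      proof (rule tendsto_eventually)
        obtain N where N: "real N * (-s) > L" using reals_Archimedean3[of "-s"] s by auto
        show "\<forall>\<^sub>F n in sequentially. R (real (Suc n) * s) = 0"
          using eventually_ge_at_top[of N]
        proof eventually_elim
          case (elim n)
          then have "real N * (-s) \<le> real (Suc n) * (-s)" using s by (intro mult_right_mono) auto
          then have "real (Suc n) * s < -L" using N by (simp only: mult_minus_right)
          then show ?case by (intro R0) simp
        qed
      qed
      have "(\<lambda>n. \<theta> n t) \<longlonglongrightarrow> (if t > a then 1 else 0) - (if t > b then 1 else 0)"
        unfolding \<theta>_def using elim lim1[of "t - a"] lim0[of "t - a"] lim1[of "t - b"] lim0[of
            "t - b"]
        by (intro tendsto_diff) (auto simp del: of_nat_Suc)
      then have "(\<lambda>n. \<theta> n t *\<^sub>R H t) \<longlonglongrightarrow> ((if t > a then 1 else 0)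
          - (if t > b then 1 else 0)) *\<^sub>R H t"
        by (intro tendsto_scaleR tendsto_const)
      moreover have "((if t > a then 1 else 0) - (if t > b then 1 else 0)) *\<^sub>R H t
          = indicator {a..b} t *\<^sub>R h t"
        using elim ab by (auto simp: H_def indicator_def)
      ultimately show ?case by simp
    qed
    show "AE t in lborel. norm (\<theta> n t *\<^sub>R H t) \<le> norm (H t)" for n
      using \<theta>b[of n] by (intro AE_I2) (simp add: mult_left_le_one_le)
    show "(\<lambda>t. indicator {a..b} t *\<^sub>R h t) \<in> borel_measurable lborel"
    proof -
      have "continuous_on {a..b} h" using ab by (intro continuous_on_subset[OF h]) auto
      then show ?thesis using borel_measurable_continuous_on_indicator[of "{a..b}" h] by simp
    qed
  qed (use Hint in auto)
  have eq: "\<forall>\<^sub>F n in sequentially. A a n - A b n + D n = 0"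
  proof -
    obtain N where N: "real N * m > L" using reals_Archimedean3[OF m] by blast
    show ?thesis
      using eventually_ge_at_top[of N]
    proof eventually_elim
      case (elim n)
      have "real N * m \<le> real (Suc n) * m" using elim m by (intro mult_right_mono) auto
      then have tn: "test_function {0<..<T} (\<theta> n)" using N by (intro test) simp
      obtain Br where Br: "\<And>x. \<bar>r x\<bar> \<le> Br"
      proof -
        have "bounded (r ` cball 0 L)"
            by (intro compact_imp_bounded compact_continuous_image rc) simp
        then obtain B where "B > 0" "\<And>t. t \<in> cball 0 L \<Longrightarrow> norm (r t) \<le> B" by (auto simp: bounded_pos)
        then have "\<bar>r x\<bar> \<le> B" for x using L(2)[of x] by (cases "\<bar>x\<bar> \<le> L") (auto simp: dist_norm)
        then show ?thesis by (rule that)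
      qed
      have i: "integrable lborel (\<lambda>t. (real (Suc n) * r (real (Suc n) * (t - c))) *\<^sub>R G t)" for c
      proof (rule Bochner_Integration.integrable_bound[where f="\<lambda>t. (real (Suc n) * Br) *\<^sub>R G t"])
        show "AE t in lborel. norm ((real (Suc n) * r (real (Suc n) * (t - c))) *\<^sub>R G t)
            \<le> norm ((real (Suc n) * Br) *\<^sub>R G t)"
        proof (rule AE_I2)
          fix t
          have "\<bar>r (real (Suc n) * (t - c))\<bar> \<le> \<bar>Br\<bar>" using Br[of "real (Suc n) * (t - c)"]
              by linarith
          then show "norm ((real (Suc n) * r (real (Suc n) * (t - c))) *\<^sub>R G t)
              \<le> norm ((real (Suc n) * Br) *\<^sub>R G t)"
            by (simp add: abs_mult mult_left_mono mult_right_mono del: of_nat_Suc)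
        qed
      qed (use Gint in auto)
      have j: "integrable lborel (\<lambda>t. \<theta> n t *\<^sub>R H t)"
      proof (rule Bochner_Integration.integrable_bound[OF Hint])
        show "AE t in lborel. norm (\<theta> n t *\<^sub>R H t) \<le> norm (H t)"
          using \<theta>b[of n] by (intro AE_I2) (simp add: mult_left_le_one_le)
      qed auto
      have "0 = (LINT t:{0<..<T}|lborel. complex_of_real (dir_deriv 1 (\<theta> n) t) * g t
          + complex_of_real (\<theta> n t) * h t)"
        using weak[OF tn] by simp
      also have "\<dots> = (\<integral>t. (real (Suc n) * r (real (Suc n) * (t - a))) *\<^sub>R G t
          - (real (Suc n) * r (real (Suc n) * (t - b))) *\<^sub>R G t + \<theta> n t *\<^sub>R H t \<partial>lborel)"
        unfolding set_lebesgue_integral_def \<theta>D G_def H_def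
        by (rule Bochner_Integration.integral_cong[OF refl]) (simp add: scaleR_conv_of_real
            algebra_simps del: of_nat_Suc)
      also have "\<dots> = A a n - A b n + D n"
        unfolding A_def D_def using i[of a] i[of b] j by simp
      finally show ?case by simp
    qed
  qed
  have "(\<lambda>n. A a n - A b n + D n) \<longlonglongrightarrow> g a - g b + (\<integral>t. indicator {a..b} t *\<^sub>R h t \<partial>lborel)"
    using ab by (intro tendsto_intros lA lD) auto
  moreover have "(\<lambda>n. A a n - A b n + D n) \<longlonglongrightarrow> 0"
    using eq by (rule tendsto_eventually)
  ultimately have "g a - g b + (\<integral>t. indicator {a..b} t *\<^sub>R h t \<partial>lborel) = 0"
    using LIMSEQ_unique by blast
  moreover have "(\<integral>t. indicator {a..b} t *\<^sub>R h t \<partial>lborel) = integral {a..b} h"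
  proof -
    have "continuous_on {a..b} h" using ab by (intro continuous_on_subset[OF h]) auto
    from set_borel_integral_eq_integral(2)[OF borel_integrable_atLeastAtMost'[OF this]]
    show ?thesis by (simp add: set_lebesgue_integral_def)
  qed
  ultimately show ?thesis by (simp add: algebra_simps)
qed

text \<open>The interior version says that \<open>g\<close> minus the integral of \<open>h\<close>
  is constant on the open interval. Continuity carries this to the closed one, which brings in the
  initial value.\<close>

lemma du_bois_reymond:
  fixes r :: "real \<Rightarrow> real" and g h :: "real \<Rightarrow> complex"
  assumes r: "friedrichs_mollifier r"
    and g: "continuous_on {0..T} g" and h: "continuous_on {0..T} h"
    and weak: "\<And>\<theta>::real\<Rightarrow>real. test_function {0<..<T} \<theta> \<Longrightarrow>
      (LINT t:{0<..<T}|lborel. complex_of_real (dir_deriv 1 \<theta> t) * g t + complex_of_real (\<theta> t) * h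
          t) = 0"
    and t: "t \<in> {0..T}" and T: "T > 0"
  shows "g t = g 0 + integral {0..t} h"
proof -
  define k where "k t = g t - integral {0..t} h" for t
  have hi: "h integrable_on {0..T}" by (rule integrable_continuous_real[OF h])
  have kc: "continuous_on {0..T} k"
    unfolding k_def by (intro continuous_intros g indefinite_integral_continuous_1 hi)
  have "k b = k a" if ab: "0 < a" "a < b" "b < T" for a b
  proof -
    have "integral {0..a} h + integral {a..b} h = integral {0..b} h"
      by (rule Henstock_Kurzweil_Integration.integral_combine) (use ab in \<open>auto intro:
          integrable_on_subinterval[OF hi]\<close>)
    then show ?thesis using du_bois_reymond_interior[OF r g h weak ab]
        by (simp add: k_def algebra_simps)
  qed
  then have c: "k s = k (T / 2)" if "s \<in> {0<..<T}" for s
    using that T by (cases s "T/2" rule: linorder_cases) auto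
  have cl: "closure {0<..<T} = {0..T}" using T by (simp add: closure_greaterThanLessThan)
  have "k s = k (T / 2)" if "s \<in> {0..T}" for s
    by (rule continuous_constant_on_closure[of "{0<..<T}" k]) (use kc that cl c in \<open>simp_all only:
        cl\<close>)
  from this[OF t] this[of 0] T have "k t = k 0" by simp
  then show ?thesis by (simp add: k_def algebra_simps)
qed

section \<open>Convolution with continuous functions of compact support\<close>

lemma lborel_distr_reflect:
  fixes x :: "'a::euclidean_space"
  shows "distr lborel borel (\<lambda>y. x - y) = (lborel :: 'a measure)"
  using lborel_affine[of "-1" x] by (simp add: density_1)

lemma lborel_integral_reflect:
  fixes f :: "'a::euclidean_space \<Rightarrow> 'b::{banach,second_countable_topology}"
  assumes "f \<in> borel_measurable borel"
  shows "(\<integral>y. f (x - y) \<partial>lborel) = (\<integral>y. f y \<partial>lborel)"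
  using integral_distr[of "\<lambda>y. x - y" lborel borel f] assms by (simp add: lborel_distr_reflect)

lemma lborel_integral_translate:
  fixes f :: "'a::euclidean_space \<Rightarrow> 'b::{banach,second_countable_topology}"
  assumes "f \<in> borel_measurable borel"
  shows "(\<integral>y. f (x + y) \<partial>lborel) = (\<integral>y. f y \<partial>lborel)"
  using integral_distr[of "\<lambda>y. x + y" lborel borel f] assms by (simp add: lborel_distr_plus)

lemma lborel_nn_integral_translate:
  fixes f :: "'a::euclidean_space \<Rightarrow> ennreal"
  assumes "f \<in> borel_measurable borel"
  shows "(\<integral>\<^sup>+y. f (x + y) \<partial>lborel) = (\<integral>\<^sup>+y. f y \<partial>lborel)"
  using nn_integral_distr[of "\<lambda>y. x + y" lborel borel f] assms by (simp add: lborel_distr_plus)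

lemma lborel_nn_integral_reflect:
  fixes f :: "'a::euclidean_space \<Rightarrow> ennreal"
  assumes "f \<in> borel_measurable borel"
  shows "(\<integral>\<^sup>+y. f (x - y) \<partial>lborel) = (\<integral>\<^sup>+y. f y \<partial>lborel)"
  using nn_integral_distr[of "\<lambda>y. x - y" lborel borel f] assms by (simp add: lborel_distr_reflect)

lemma lborel_integrable_translate:
  fixes f :: "'a::euclidean_space \<Rightarrow> 'b::{banach,second_countable_topology}"
  assumes "integrable lborel f"
  shows "integrable lborel (\<lambda>y. f (x + y))"
  using integrable_distr[of "\<lambda>y. x + y" lborel borel f] assms by (simp add: lborel_distr_plus)

text \<open>Smoothness is not demanded, so that the class also contains the absolute values of
  kernels used for Fubini and the truncated functions used in the duality argument. Both real
  kernels and complex test functions occur.\<close>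

definition Cc :: "('a::euclidean_space \<Rightarrow> 'b::real_normed_vector) \<Rightarrow> bool" where
  "Cc \<rho> \<longleftrightarrow> continuous_on UNIV \<rho> \<and> (\<exists>L. \<forall>x. norm x > L \<longrightarrow> \<rho> x = 0)"

lemma Cc_test_function: "test_function U \<rho> \<Longrightarrow> Cc \<rho>"
  unfolding Cc_def by (meson smooth_continuous test_function_smooth test_function_bounded_support)

lemma Cc_measurable: "Cc \<rho> \<Longrightarrow> \<rho> \<in> borel_measurable borel"
  unfolding Cc_def by (auto intro: borel_measurable_continuous_onI)

lemma Cc_bounded:
  fixes \<rho> :: "'a::euclidean_space \<Rightarrow> 'b::real_normed_vector"
  assumes "Cc \<rho>" obtains B where "B > 0" "\<And>x. norm (\<rho> x) \<le> B"
proof -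
  obtain L where L: "\<And>x. norm x > L \<Longrightarrow> \<rho> x = 0" and c: "continuous_on UNIV \<rho>" using assms
      by (auto simp: Cc_def)
  have "bounded (\<rho> ` cball 0 L)"
    by (intro compact_imp_bounded compact_continuous_image continuous_on_subset[OF c]) auto
  then obtain B where B: "B > 0" "\<And>t. t \<in> cball 0 L \<Longrightarrow> norm (\<rho> t) \<le> B" by (auto simp: bounded_pos)
  have "norm (\<rho> x) \<le> B" for x using L[of x] B by (cases "norm x \<le> L") auto
  then show ?thesis using B that by blast
qed

lemma Cc_compose_scaleR:
  assumes "Cc \<rho>" "r \<noteq> 0" shows "Cc (\<lambda>y. \<rho> (x + r *\<^sub>R y))"
proof -
  obtain L where L: "\<And>x. norm x > L \<Longrightarrow> \<rho> x = 0" and c: "continuous_on UNIV \<rho>" using assms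
      by (auto simp: Cc_def)
  have "\<rho> (x + r *\<^sub>R y) = 0" if "norm y > (L + norm x) / \<bar>r\<bar>" for y
  proof -
    have "norm (r *\<^sub>R y) > L + norm x" using that assms(2) by (simp add: field_simps)
    then have "norm (x + r *\<^sub>R y) > L" using norm_triangle_ineq4[of "x + r *\<^sub>R y" x] by simp
    then show ?thesis by (rule L)
  qed
  moreover have "continuous_on UNIV (\<lambda>y. \<rho> (x + r *\<^sub>R y))"
    by (intro continuous_on_compose2[OF c] continuous_intros) auto
  ultimately show ?thesis unfolding Cc_def by blast
qed

lemma Cc_reflect: "Cc \<rho> \<Longrightarrow> Cc (\<lambda>y. \<rho> (x - y))"
  using Cc_compose_scaleR[of \<rho> "-1" x] by simp

lemma Cc_translate: "Cc \<rho> \<Longrightarrow> Cc (\<lambda>y. \<rho> (y + x))"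
  using Cc_compose_scaleR[of \<rho> "1" x] by (simp add: add.commute)

lemma Cc_add:
  assumes "Cc f" "Cc g" shows "Cc (\<lambda>x. f x + g x)"
proof -
  obtain L where L: "\<And>x. norm x > L \<Longrightarrow> f x = 0" and c: "continuous_on UNIV f" using assms
      by (auto simp: Cc_def)
  obtain M where M: "\<And>x. norm x > M \<Longrightarrow> g x = 0" and d: "continuous_on UNIV g" using assms
      by (auto simp: Cc_def)
  have "f x + g x = 0" if "norm x > max L M" for x using that L M by simp
  then show ?thesis unfolding Cc_def using continuous_on_add[OF c d] by blast
qed

lemma Cc_scaleR: "Cc f \<Longrightarrow> Cc (\<lambda>x. c *\<^sub>R f x)"
  unfolding Cc_def by (auto intro!: continuous_intros)

lemma Cc_mult: "Cc f \<Longrightarrow> Cc (\<lambda>x. c * f x :: real)"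
  using Cc_scaleR[of f c] by simp

lemma Cc_diff: "Cc f \<Longrightarrow> Cc g \<Longrightarrow> Cc (\<lambda>x. f x - g x :: real)"
  using Cc_add[of f "\<lambda>x. (-1) *\<^sub>R g x"] Cc_scaleR[of g "-1"] by simp

lemma Cc_sum:
  assumes "finite I" "\<And>i. i \<in> I \<Longrightarrow> Cc (f i)" shows "Cc (\<lambda>x. \<Sum>i\<in>I. f i x)"
  using assms
proof (induction I rule: finite_induct)
  case empty
  then show ?case by (simp add: Cc_def)
next
  case (insert i I)
  then show ?case using Cc_add[of "f i" "\<lambda>x. \<Sum>i\<in>I. f i x"] by simp
qed

lemma Cc_integrable:
  fixes \<rho> :: "'a::euclidean_space \<Rightarrow> 'b::{banach,second_countable_topology}"
  assumes "Cc \<rho>" shows "integrable lborel \<rho>"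
proof -
  obtain L where L: "\<And>x. norm x > L \<Longrightarrow> \<rho> x = 0" and c: "continuous_on UNIV \<rho>" using assms
      by (auto simp: Cc_def)
  have "integrable lborel (\<lambda>x. indicator (cball 0 L) x *\<^sub>R \<rho> x)"
    by (intro borel_integrable_compact continuous_on_subset[OF c]) auto
  also have "(\<lambda>x. indicator (cball 0 L) x *\<^sub>R \<rho> x) = \<rho>"
  proof
    fix x show "indicator (cball 0 L) x *\<^sub>R \<rho> x = \<rho> x" using L[of x]
        by (cases "norm x > L") (auto simp: indicator_def)
  qed
  finally show ?thesis .
qed

lemma Cc_L2_complex:
  fixes f :: "'a::euclidean_space \<Rightarrow> complex"
  assumes "Cc f" shows "f \<in> L2"
proof -
  have "Cc (\<lambda>x. (norm (f x))\<^sup>2)" using assms unfolding Cc_def by (auto intro!: continuous_intros)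
  then show ?thesis using Cc_integrable Cc_measurable[OF assms] by (auto simp: L2_def)
qed

lemma Cc_of_real: "Cc \<rho> \<Longrightarrow> Cc (\<lambda>y. complex_of_real (\<rho> y))"
  unfolding Cc_def by (auto intro!: continuous_intros)

lemma Cc_L2: "Cc \<rho> \<Longrightarrow> (\<lambda>y. complex_of_real (\<rho> y)) \<in> L2"
  by (rule Cc_L2_complex[OF Cc_of_real])

text \<open>The counterpart of \<open>convolve\<close> for functions. For \<open>w\<close> in L2 and
  a kernel in \<open>Cc\<close> the integral exists at every \<open>x\<close> and does not depend on
  the representative of \<open>w\<close>, so values at a fixed point can be followed in
  time.\<close>

definition conv :: "('a::euclidean_space \<Rightarrow> complex) \<Rightarrow> ('a \<Rightarrow> real) \<Rightarrow> 'a \<Rightarrow> complex" where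
  "conv w \<rho> x = (\<integral>y. w y * complex_of_real (\<rho> (x - y)) \<partial>lborel)"

lemma conv_integrable:
  "w \<in> L2 \<Longrightarrow> Cc \<rho> \<Longrightarrow> integrable lborel (\<lambda>y. w y * complex_of_real (\<rho> (x - y)))"
  by (intro L2_mult_integrable Cc_L2 Cc_reflect)

text \<open>The bound is uniform in \<open>x\<close>, since reflecting and translating the kernel
  does not change its L2 norm. This uniformity yields joint continuity below.\<close>

lemma conv_bound:
  assumes "w \<in> L2" "Cc \<rho>"
  shows "norm (conv w \<rho> x) \<le> L2_norm w * L2_norm (\<lambda>y. complex_of_real (\<rho> y))"
proof -
  have "norm (conv w \<rho> x) \<le> L2_norm w * L2_norm (\<lambda>y. complex_of_real (\<rho> (x - y)))"
    unfolding conv_def by (rule L2_cauchy_schwarz[OF assms(1) Cc_L2[OF Cc_reflect[OF assms(2)]]])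
  also have "L2_norm (\<lambda>y. complex_of_real (\<rho> (x - y))) = L2_norm (\<lambda>y. complex_of_real (\<rho> y))"
    unfolding L2_norm_def using Cc_measurable[OF assms(2)]
    by (subst lborel_integral_reflect[of "\<lambda>y. (norm (complex_of_real (\<rho> y)))\<^sup>2" x]) auto
  finally show ?thesis .
qed

lemma conv_diff_left:
  "w \<in> L2 \<Longrightarrow> v \<in> L2 \<Longrightarrow> Cc \<rho> \<Longrightarrow> conv (\<lambda>y. w y - v y) \<rho> x = conv w \<rho> x - conv v \<rho> x"
  unfolding conv_def by (simp add: left_diff_distrib conv_integrable)

lemma conv_add_right:
  "w \<in> L2 \<Longrightarrow> Cc \<rho> \<Longrightarrow> Cc \<sigma> \<Longrightarrow> conv w (\<lambda>y. \<rho> y + \<sigma> y) x = conv w \<rho> x + conv w \<sigma> x"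
  unfolding conv_def by (simp add: distrib_left conv_integrable)

lemma conv_diff_right:
  "w \<in> L2 \<Longrightarrow> Cc \<rho> \<Longrightarrow> Cc \<sigma> \<Longrightarrow> conv w (\<lambda>y. \<rho> y - \<sigma> y) x = conv w \<rho> x - conv w \<sigma> x"
  unfolding conv_def by (simp add: right_diff_distrib conv_integrable)

lemma conv_cmult_right: "conv w (\<lambda>y. c * \<rho> y) x = complex_of_real c * conv w \<rho> x"
  unfolding conv_def by (subst integral_mult_right_zero[symmetric]) (simp add: mult.left_commute)

lemma conv_sum_right:
  assumes "finite I" "\<And>i. i \<in> I \<Longrightarrow> Cc (f i)" "w \<in> L2"
  shows "conv w (\<lambda>y. \<Sum>i\<in>I. f i y) x = (\<Sum>i\<in>I. conv w (f i) x)"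
  using assms unfolding conv_def
      by (simp add: sum_distrib_left conv_integrable Bochner_Integration.integral_sum)

lemma conv_translate: "conv w (\<lambda>y. \<rho> (y + h)) x = conv w \<rho> (x + h)"
  unfolding conv_def by (simp add: algebra_simps)

lemma conv_continuous:
  assumes w: "w \<in> L2" and \<rho>: "Cc \<rho>" shows "isCont (conv w \<rho>) x"
  unfolding continuous_at_sequentially o_def
proof (intro allI impI)
  fix X assume X: "X \<longlonglongrightarrow> x"
  obtain L where L: "\<And>x. norm x > L \<Longrightarrow> \<rho> x = 0" and c: "continuous_on UNIV \<rho>" using \<rho>
      by (auto simp: Cc_def)
  obtain B where B: "B > 0" "\<And>x. norm (\<rho> x) \<le> B" using Cc_bounded[OF \<rho>] by blast
  \<comment> \<open>A convergent sequence is bounded, so all shifted kernels vanish outside one ball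
    of radius \<open>K + L\<close>, where \<open>w\<close> is integrable.\<close>
  obtain K where K: "\<And>n. norm (X n) \<le> K"
    using convergent_imp_bounded[OF X] by (auto simp: bounded_iff)
  note [measurable] = Cc_measurable[OF \<rho>] L2_D[OF w]
  show "(\<lambda>n. conv w \<rho> (X n)) \<longlonglongrightarrow> conv w \<rho> x"
    unfolding conv_def
  proof (rule integral_dominated_convergence[where w="\<lambda>y. norm (w y * complex_of_real (indicator
      (cball 0 (K + L)) y)) * B"])
    show "integrable lborel (\<lambda>y. norm (w y * complex_of_real (indicator (cball 0 (K + L)) y)) * B)"
      using L2_mult_integrable[OF w indicator_cball_L2]
          by (intro integrable_mult_left integrable_norm)
    show "AE y in lborel. (\<lambda>n. w y * complex_of_real (\<rho> (X n - y))) \<longlonglongrightarrow> w y * complex_of_real (\<rho> (x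
        - y))"
    proof (intro AE_I2 tendsto_intros X)
      fix y
      have "isCont \<rho> (x - y)" using c by (simp add: continuous_on_eq_continuous_at)
      then show "(\<lambda>n. \<rho> (X n - y)) \<longlonglongrightarrow> \<rho> (x - y)"
        by (rule isCont_tendsto_compose) (intro tendsto_intros X)
    qed
    show "AE y in lborel. norm (w y * complex_of_real (\<rho> (X n - y)))
        \<le> norm (w y * complex_of_real (indicator (cball 0 (K + L)) y)) * B" for n
    proof (rule AE_I2)
      fix y
      show "norm (w y * complex_of_real (\<rho> (X n - y)))
          \<le> norm (w y * complex_of_real (indicator (cball 0 (K + L)) y)) * B"
      proof (cases "norm y \<le> K + L")
        case True
        then show ?thesis using B(2)[of "X n - y"] by (simp add: norm_mult mult_left_mono)
      next
        case False
        have "norm (X n - y) \<ge> norm y - norm (X n)" using norm_triangle_ineq2[of y "X n"]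
            by (simp add: norm_minus_commute)
        then have "norm (X n - y) > L" using K[of n] False by simp
        then show ?thesis using L B(1) by simp
      qed
    qed
  qed measurable
qed

lemma conv_measurable: "w \<in> L2 \<Longrightarrow> Cc \<rho> \<Longrightarrow> conv w \<rho> \<in> borel_measurable borel"
  by (intro borel_measurable_continuous_onI continuous_at_imp_continuous_on ballI conv_continuous)

text \<open>The increment splits into a change of time, small uniformly in space by
  \<open>conv_bound\<close>, and a change of place at a fixed time. Joint continuity is the source
  of all joint measurability used later.\<close>

lemma conv_jointly_continuous:
  assumes u: "cont_L2 T u" and \<rho>: "Cc \<rho>"
  shows "continuous_on ({0..T} \<times> UNIV) (\<lambda>z. conv (u (fst z)) \<rho> (snd z))"
proof (unfold continuous_on_def, intro ballI)
  fix z :: "real \<times> 'a" assume z: "z \<in> {0..T} \<times> UNIV"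
  then have t: "fst z \<in> {0..T}" by auto
  let ?F = "at z within {0..T} \<times> UNIV"
  let ?C = "L2_norm (\<lambda>y. complex_of_real (\<rho> y))"
  have lim1: "((\<lambda>p. L2_norm (\<lambda>x. u (fst p) x - u (fst z) x)) \<longlongrightarrow> 0) ?F"
  proof -
    define m where "m s = L2_norm (\<lambda>x. u s x - u (fst z) x)" for s
    have "continuous (at (fst z) within {0..T}) m"
      using cont_L2_lim[OF u t] by (simp add: continuous_within m_def[abs_def] L2_norm_def)
    moreover have "(fst \<longlongrightarrow> fst z) ?F" by (intro tendsto_intros)
    moreover have "\<forall>\<^sub>F p in ?F. fst p \<in> {0..T}" unfolding eventually_at_filter
        by (rule always_eventually) auto
    ultimately have "((\<lambda>p. m (fst p)) \<longlongrightarrow> m (fst z)) ?F"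
      by (intro continuous_within_tendsto_compose[where f=m])
    then show ?thesis by (simp add: m_def L2_norm_def)
  qed
  have lim2: "((\<lambda>p. conv (u (fst z)) \<rho> (snd p)) \<longlongrightarrow> conv (u (fst z)) \<rho> (snd z)) ?F"
    by (rule isCont_tendsto_compose[OF conv_continuous[OF cont_L2_L2[OF u t] \<rho>]]) (intro
        tendsto_intros)
  have "((\<lambda>p. conv (u (fst p)) \<rho> (snd p) - conv (u (fst z)) \<rho> (snd p)) \<longlongrightarrow> 0) ?F"
  proof (rule Lim_null_comparison[OF _ tendsto_mult_left_zero[OF lim1, of ?C]])
    show "\<forall>\<^sub>F p in ?F. norm (conv (u (fst p)) \<rho> (snd p) - conv (u (fst z)) \<rho> (snd p))
      \<le> L2_norm (\<lambda>x. u (fst p) x - u (fst z) x) * ?C"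
      unfolding eventually_at_filter
    proof (rule always_eventually, intro allI impI)
      fix p :: "real \<times> 'a" assume "p \<in> {0..T} \<times> UNIV"
      then have up: "u (fst p) \<in> L2" and uz: "u (fst z) \<in> L2" using u t by (auto intro: cont_L2_L2)
      show "norm (conv (u (fst p)) \<rho> (snd p) - conv (u (fst z)) \<rho> (snd p))
          \<le> L2_norm (\<lambda>x. u (fst p) x - u (fst z) x) * ?C"
        using conv_bound[OF L2_diff[OF up uz] \<rho>, of "snd p"] conv_diff_left[OF up uz \<rho>, of "snd p"]
            by simp
    qed
  qed
  from tendsto_add[OF this lim2]
  show "((\<lambda>p. conv (u (fst p)) \<rho> (snd p)) \<longlongrightarrow> conv (u (fst z)) \<rho> (snd z)) ?F" by simp
qed

text \<open>Convolution with an L1 kernel on L2: Cauchy-Schwarz with respect to the weight |\<rho>(x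
  - y)|, then Tonelli. Only the L1 norm of the kernel enters, so mollifiers do not increase the L2
  norm and kernels small in L1 give small convolutions.\<close>

lemma young:
  assumes w: "w \<in> L2" and \<rho>: "Cc \<rho>"
  shows "conv w \<rho> \<in> L2" "L2_norm (conv w \<rho>) \<le> (\<integral>y. \<bar>\<rho> y\<bar> \<partial>lborel) * L2_norm w"
proof -
  note [measurable] = Cc_measurable[OF \<rho>] L2_D[OF w, simplified] conv_measurable[OF w \<rho>]
  have i\<rho>: "integrable lborel (\<lambda>y. \<bar>\<rho> y\<bar>)" using Cc_integrable[OF \<rho>] by simp
  define A where "A = (\<integral>y. \<bar>\<rho> y\<bar> \<partial>lborel)"
  have A0: "A \<ge> 0" by (simp add: A_def)
  have nA: "(\<integral>\<^sup>+y. ennreal \<bar>\<rho> y\<bar> \<partial>lborel) = ennreal A" unfolding A_def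
      by (rule nn_integral_eq_integral[OF i\<rho>]) simp
  have nW: "(\<integral>\<^sup>+y. ennreal ((norm (w y))\<^sup>2) \<partial>lborel) = ennreal ((L2_norm w)\<^sup>2)"
    unfolding L2_norm_sq by (rule nn_integral_eq_integral[OF L2_integrable[OF w]]) simp
  have pt: "ennreal ((norm (conv w \<rho> x))\<^sup>2) \<le> ennreal A * (\<integral>\<^sup>+y. ennreal ((norm (w y))\<^sup>2) * ennreal
      \<bar>\<rho> (x - y)\<bar> \<partial>lborel)" for x
  proof -
    have "ennreal (norm (conv w \<rho> x)) \<le> (\<integral>\<^sup>+y. ennreal (norm (w y * complex_of_real (\<rho> (x
        - y)))) \<partial>lborel)"
      unfolding conv_def by (rule integral_norm_bound_ennreal[OF conv_integrable[OF w \<rho>]])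
    \<comment> \<open>One square root of the weight stays alone and integrates to \<open>A\<close>;
      the other is kept with \<open>w\<close> and is integrated in \<open>x\<close>
      afterwards.\<close>
    also have "\<dots> = (\<integral>\<^sup>+y. ennreal (sqrt \<bar>\<rho> (x - y)\<bar>) * ennreal (norm (w y) * sqrt \<bar>\<rho> (x
        - y)\<bar>) \<partial>lborel)"
      by (intro nn_integral_cong) (simp add: norm_mult mult.left_commute flip: ennreal_mult)
    finally have "(ennreal (norm (conv w \<rho> x)))\<^sup>2 \<le> \<dots>\<^sup>2" by (rule power_mono) simp
    also have "\<dots> \<le> (\<integral>\<^sup>+y. (ennreal (sqrt \<bar>\<rho> (x - y)\<bar>))\<^sup>2 \<partial>lborel) * (\<integral>\<^sup>+y. (ennreal (norm (w y) *
        sqrt \<bar>\<rho> (x - y)\<bar>))\<^sup>2 \<partial>lborel)"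
      by (rule Cauchy_Schwarz_nn_integral) measurable
    also have "(\<integral>\<^sup>+y. (ennreal (sqrt \<bar>\<rho> (x - y)\<bar>))\<^sup>2 \<partial>lborel) = (\<integral>\<^sup>+y. ennreal \<bar>\<rho> (x - y)\<bar> \<partial>lborel)"
      by (intro nn_integral_cong) (simp add: ennreal_power)
    also have "\<dots> = ennreal A" using lborel_nn_integral_reflect[of "\<lambda>y. ennreal \<bar>\<rho> y\<bar>" x] nA by simp
    also have "(\<integral>\<^sup>+y. (ennreal (norm (w y) * sqrt \<bar>\<rho> (x - y)\<bar>))\<^sup>2 \<partial>lborel)
        = (\<integral>\<^sup>+y. ennreal ((norm (w y))\<^sup>2) * ennreal \<bar>\<rho> (x - y)\<bar> \<partial>lborel)"
      by (intro nn_integral_cong) (simp add: ennreal_power power_mult_distrib flip: ennreal_mult)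
    finally show ?thesis by (simp add: ennreal_power)
  qed
  have "(\<integral>\<^sup>+x. ennreal ((norm (conv w \<rho> x))\<^sup>2) \<partial>lborel)
      \<le> (\<integral>\<^sup>+x. ennreal A * (\<integral>\<^sup>+y. ennreal ((norm (w y))\<^sup>2) * ennreal \<bar>\<rho> (x - y)\<bar> \<partial>lborel) \<partial>lborel)"
    by (rule nn_integral_mono) (rule pt)
  also have "\<dots> = ennreal A * (\<integral>\<^sup>+x. (\<integral>\<^sup>+y. ennreal ((norm (w y))\<^sup>2) * ennreal \<bar>\<rho> (x
      - y)\<bar> \<partial>lborel) \<partial>lborel)"
    by (rule nn_integral_cmult) measurable
  also have "(\<integral>\<^sup>+x. (\<integral>\<^sup>+y. ennreal ((norm (w y))\<^sup>2) * ennreal \<bar>\<rho> (x - y)\<bar> \<partial>lborel) \<partial>lborel)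
      = (\<integral>\<^sup>+y. (\<integral>\<^sup>+x. ennreal ((norm (w y))\<^sup>2) * ennreal \<bar>\<rho> (x - y)\<bar> \<partial>lborel) \<partial>lborel)"
    by (rule lborel_pair.Fubini') measurable
  also have "\<dots> = (\<integral>\<^sup>+y. ennreal ((norm (w y))\<^sup>2) * ennreal A \<partial>lborel)"
  proof (rule nn_integral_cong)
    fix y
    have "(\<integral>\<^sup>+x. ennreal \<bar>\<rho> (x - y)\<bar> \<partial>lborel) = ennreal A"
      using lborel_nn_integral_translate[of "\<lambda>x. ennreal \<bar>\<rho> x\<bar>" "-y"] nA
          by (simp add: algebra_simps)
    then show "(\<integral>\<^sup>+x. ennreal ((norm (w y))\<^sup>2) * ennreal \<bar>\<rho> (x - y)\<bar> \<partial>lborel)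
        = ennreal ((norm (w y))\<^sup>2) * ennreal A"
      by (subst nn_integral_cmult) auto
  qed
  also have "\<dots> = ennreal ((L2_norm w)\<^sup>2) * ennreal A"
    by (subst nn_integral_multc) (auto simp: nW)
  finally have le: "(\<integral>\<^sup>+x. ennreal ((norm (conv w \<rho> x))\<^sup>2) \<partial>lborel) \<le> ennreal ((A * L2_norm w)\<^sup>2)"
    using A0 by (simp add: power_mult_distrib power2_eq_square mult_ac flip: ennreal_mult)
  have int: "integrable lborel (\<lambda>x. (norm (conv w \<rho> x))\<^sup>2)"
    by (rule integrableI_bounded) (use le in \<open>auto simp: order.strict_trans1\<close>)
  then show "conv w \<rho> \<in> L2" by (simp add: L2_def)
  have "ennreal ((L2_norm (conv w \<rho>))\<^sup>2) \<le> ennreal ((A * L2_norm w)\<^sup>2)"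
    using le nn_integral_eq_integral[OF int] by (simp add: L2_norm_sq)
  then have "(L2_norm (conv w \<rho>))\<^sup>2 \<le> (A * L2_norm w)\<^sup>2" by simp
  then show "L2_norm (conv w \<rho>) \<le> (\<integral>y. \<bar>\<rho> y\<bar> \<partial>lborel) * L2_norm w"
    unfolding A_def[symmetric] by (rule power2_le_imp_le) (use A0 in simp)
qed

section \<open>Second difference quotients and the sign of the Laplacian\<close>

lemma dir_deriv_line:
  fixes f :: "'a::euclidean_space \<Rightarrow> real"
  assumes "smooth f"
  shows "((\<lambda>s. f (x + s *\<^sub>R v)) has_real_derivative dir_deriv v f (x + s *\<^sub>R v)) (at s)"
proof -
  note d = has_derivative_dir_deriv[OF smooth_differentiable[OF assms]]
  have "((\<lambda>s. x + s *\<^sub>R v) has_derivative (\<lambda>s. s *\<^sub>R v)) (at s)"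
    by (auto intro!: derivative_eq_intros)
  from has_derivative_compose[OF this d]
  have "((\<lambda>s. f (x + s *\<^sub>R v)) has_derivative (\<lambda>t. dir_deriv (t *\<^sub>R v) f (x + s *\<^sub>R v))) (at s)"
      by simp
  moreover have "(\<lambda>t. dir_deriv (t *\<^sub>R v) f (x + s *\<^sub>R v)) = (*) (dir_deriv v f (x + s *\<^sub>R v))"
    using linear_cmul[OF has_derivative_linear[OF d[of "x + s *\<^sub>R v"]], of _ v]
        by (auto simp: mult.commute)
  ultimately show ?thesis by (simp add: has_field_derivative_def)
qed

text \<open>Second-order Taylor expansion, with Lagrange remainder, of the even function s -> f(x +
  s b) + f(x - s b). Its linear term vanishes, and a single intermediate point serves both
  sides.\<close>

lemma second_difference_taylor:
  fixes f :: "'a::euclidean_space \<Rightarrow> real"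
  assumes f: "smooth f" and b: "b \<in> Basis" and h: "h > 0"
  obtains \<xi> where "0 < \<xi>" "\<xi> < h"
    "f (x + h *\<^sub>R b) + f (x + h *\<^sub>R (- b)) - 2 * f x =
      h\<^sup>2 * (dir_deriv b (dir_deriv b f) (x + \<xi> *\<^sub>R b) + dir_deriv b (dir_deriv b f) (x + \<xi> *\<^sub>R (-
          b))) / 2"
proof -
  have neg: "dir_deriv (- b) g y = - dir_deriv b g y" if "smooth g" for g :: "'a \<Rightarrow> real" and y
    using linear_neg[OF has_derivative_linear[OF has_derivative_dir_deriv[OF
        smooth_differentiable[OF that]]]] by blast
  let ?f1 = "dir_deriv b f" and ?f2 = "dir_deriv b (dir_deriv b f)"
  have s1: "smooth ?f1" by (rule smooth_dir_deriv[OF f b])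
  \<comment> \<open>\<open>D m\<close> is the m-th derivative of this even function. The odd order
    carries a minus sign because the derivative in direction \<open>- b\<close> is the negative of
    that in direction \<open>b\<close>.\<close>
  define D where "D m s = (if m = 0 then f (x + s *\<^sub>R b) + f (x + s *\<^sub>R (- b))
     else if m = 1 then ?f1 (x + s *\<^sub>R b) - ?f1 (x + s *\<^sub>R (- b))
     else ?f2 (x + s *\<^sub>R b) + ?f2 (x + s *\<^sub>R (- b)))" for m :: nat and s :: real
  have D0: "(D 0 has_real_derivative D 1 s) (at s)" for s
    using DERIV_add[OF dir_deriv_line[OF f, of x b s] dir_deriv_line[OF f, of x "-b" s]]
    by (simp add: D_def[abs_def] neg[OF f])
  have D1: "(D 1 has_real_derivative D 2 s) (at s)" for s
    using DERIV_diff[OF dir_deriv_line[OF s1, of x b s] dir_deriv_line[OF s1, of x "-b" s]]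
    by (simp add: D_def[abs_def] neg[OF s1])
  have "\<exists>t>0. t < h \<and> D 0 h = (\<Sum>m<2. D m 0 / fact m * h ^ m) + D 2 t / fact 2 * h ^ 2"
  proof (rule Maclaurin[OF h])
    show "\<forall>m t. m < 2 \<and> 0 \<le> t \<and> t \<le> h \<longrightarrow> (D m has_real_derivative D (Suc m) t) (at t)"
      using D0 D1 by (auto simp: less_Suc_eq numeral_2_eq_2)
  qed auto
  then obtain t where t: "0 < t" "t < h" "D 0 h = (\<Sum>m<2. D m 0 / fact m * h ^ m)
      + D 2 t / fact 2 * h ^ 2" by blast
  show ?thesis
    by (rule that[OF t(1,2)]) (use t(3) in \<open>simp add: D_def numeral_2_eq_2 field_simps\<close>)
qed

lemma L2_translate:
  assumes "g \<in> L2" shows "(\<lambda>x. g (x + a)) \<in> L2" "L2_norm (\<lambda>x. g (x + a)) = L2_norm g"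
proof -
  note [measurable] = L2_D[OF assms, simplified]
  show "(\<lambda>x. g (x + a)) \<in> L2"
    using lborel_integrable_translate[OF L2_integrable[OF assms], of a]
        by (simp add: L2_def add.commute)
  show "L2_norm (\<lambda>x. g (x + a)) = L2_norm g"
    using lborel_integral_translate[of "\<lambda>x. (norm (g x))\<^sup>2" a]
        by (simp add: L2_norm_def add.commute)
qed

text \<open>The difference quotients are formed on the kernel. There they converge in L1 to the
  second derivative, and \<open>young\<close> turns this into L2 convergence of the convolutions,
  without any regularity of \<open>w\<close>.\<close>

lemma dissipation:
  fixes \<rho> :: "'a::euclidean_space \<Rightarrow> real"
  assumes w: "w \<in> L2" and \<rho>: "test_function UNIV \<rho>" and b: "b \<in> Basis"
  shows "Re (\<integral>x. cnj (conv w \<rho> x) * conv w (dir_deriv b (dir_deriv b \<rho>)) x \<partial>lborel) \<le> 0"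
proof -
  define g where "g = conv w \<rho>"
  define \<rho>2 where "\<rho>2 = dir_deriv b (dir_deriv b \<rho>)"
  have cc0: "Cc \<rho>" by (rule Cc_test_function[OF \<rho>])
  have cc2: "Cc \<rho>2" unfolding \<rho>2_def
      by (rule Cc_test_function[OF test_function_dir_deriv[OF test_function_dir_deriv[OF \<rho> b] b]])
  have gL2: "g \<in> L2" unfolding g_def by (rule young(1)[OF w cc0])
  note cg = L2_cnj[OF gL2]
  define I where "I f = (\<integral>x. cnj (g x) * f x \<partial>lborel)" for f
  define N where "N n = real (Suc n)" for n
  have N: "N n > 0" for n by (simp add: N_def)
  define D where "D n y = (N n)\<^sup>2 * (\<rho> (y + (1 / N n) *\<^sub>R b) + \<rho> (y + (1 / N n) *\<^sub>R (- b))
      - 2 * \<rho> y)" for n y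
  define E where "E n y = D n y - \<rho>2 y" for n y
  have ccD: "Cc (D n)" for n
    unfolding D_def[abs_def] by (intro Cc_mult Cc_add Cc_diff Cc_translate cc0)
  have ccE: "Cc (E n)" for n
    unfolding E_def[abs_def] by (intro Cc_diff ccD cc2)
  have Ibd: "norm (I f) \<le> L2_norm g * L2_norm f" if "f \<in> L2" for f
    unfolding I_def using L2_cauchy_schwarz[OF cg that] by simp
  have ReI: "Re (I (\<lambda>x. g (x + a))) \<le> (L2_norm g)\<^sup>2" for a
    using Ibd[OF L2_translate(1)[OF gL2, of a]] L2_translate(2)[OF gL2, of a] complex_Re_le_cmod[of
        "I (\<lambda>x. g (x + a))"]
    by (simp add: power2_eq_square)
  have Ig: "I g = complex_of_real ((L2_norm g)\<^sup>2)"
  proof -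
    have "I g = (\<integral>x. complex_of_real ((norm (g x))\<^sup>2) \<partial>lborel)"
      unfolding I_def by (intro Bochner_Integration.integral_cong[OF refl]) (simp add:
          complex_norm_square mult.commute flip: of_real_power)
    then show ?thesis by (simp add: L2_norm_sq del: of_real_power)
  qed
  have DI: "Re (I (conv w (D n))) \<le> 0" for n
  proof -
    have convD: "conv w (D n) x = complex_of_real ((N n)\<^sup>2) * (g (x + (1 / N n) *\<^sub>R b) + g (x
        + (1 / N n) *\<^sub>R (- b)) - 2 * g x)" for x
      unfolding D_def[abs_def] conv_cmult_right g_def
        conv_diff_right[OF w Cc_add[OF Cc_translate[OF cc0] Cc_translate[OF cc0]] Cc_mult[OF cc0]]
        conv_add_right[OF w Cc_translate[OF cc0] Cc_translate[OF cc0]] conv_translate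
      by simp
    have i: "integrable lborel (\<lambda>x. cnj (g x) * g (x + a))" for a
      by (rule L2_mult_integrable[OF cg L2_translate(1)[OF gL2]])
    have i0: "integrable lborel (\<lambda>x. cnj (g x) * g x)" by (rule L2_mult_integrable[OF cg gL2])
    have "I (conv w (D n)) = (\<integral>x. complex_of_real ((N n)\<^sup>2) * ((cnj (g x) * g (x + (1 / N n) *\<^sub>R b)
        + cnj (g x) * g (x + (1 / N n) *\<^sub>R (- b))) - 2 * (cnj (g x) * g x)) \<partial>lborel)"
      unfolding I_def convD by (intro Bochner_Integration.integral_cong[OF refl]) (simp add:
          algebra_simps)
    also have "\<dots> = complex_of_real ((N n)\<^sup>2) * (I (\<lambda>x. g (x + (1 / N n) *\<^sub>R b)) + I (\<lambda>x. g (x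
        + (1 / N n) *\<^sub>R (- b))) - 2 * I g)"
      unfolding I_def using i[of "(1 / N n) *\<^sub>R b"] i[of "(1 / N n) *\<^sub>R (- b)"] i0 by simp
    finally have "Re (I (conv w (D n))) = (N n)\<^sup>2 * (Re (I (\<lambda>x. g (x + (1 / N n) *\<^sub>R b)))
        + Re (I (\<lambda>x. g (x + (1 / N n) *\<^sub>R (- b)))) - 2 * (L2_norm g)\<^sup>2)"
      by (simp add: Ig flip: of_real_power)
    also have "\<dots> \<le> 0"
      using ReI[of "(1 / N n) *\<^sub>R b"] ReI[of "(1 / N n) *\<^sub>R (- b)"]
          by (intro mult_nonneg_nonpos) auto
    finally show ?thesis .
  qed
  \<comment> \<open>The left side does not involve \<open>n\<close>: the quotient contributes a
    non-positive term, and the error kernel \<open>E n\<close> is paid for in L1 and disappears in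
    the limit.\<close>
  have main: "Re (I (conv w \<rho>2)) \<le> L2_norm g * L2_norm w * (\<integral>y. \<bar>E n y\<bar> \<partial>lborel)" for n
  proof -
    have EL2: "conv w (E n) \<in> L2" and En: "L2_norm (conv w (E n))
        \<le> (\<integral>y. \<bar>E n y\<bar> \<partial>lborel) * L2_norm w"
      using young[OF w ccE] by auto
    have "conv w (E n) x = conv w (D n) x - conv w \<rho>2 x" for x
      unfolding E_def[abs_def] by (rule conv_diff_right[OF w ccD cc2])
    then have "I (conv w (E n)) = I (conv w (D n)) - I (conv w \<rho>2)"
      unfolding I_def using L2_mult_integrable[OF cg young(1)[OF w ccD]] L2_mult_integrable[OF cg
          young(1)[OF w cc2]]
      by (simp add: right_diff_distrib)
    then have "Re (I (conv w \<rho>2)) = Re (I (conv w (D n))) - Re (I (conv w (E n)))" by simp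
    also have "\<dots> \<le> norm (I (conv w (E n)))"
      using DI[of n] abs_Re_le_cmod[of "I (conv w (E n))"] by linarith
    also have "\<dots> \<le> L2_norm g * L2_norm (conv w (E n))" by (rule Ibd[OF EL2])
    also have "\<dots> \<le> L2_norm g * ((\<integral>y. \<bar>E n y\<bar> \<partial>lborel) * L2_norm w)"
      by (intro mult_left_mono En) simp
    finally show ?thesis by (simp add: mult_ac)
  qed
  obtain L where L: "\<And>x. norm x > L \<Longrightarrow> \<rho>2 x = 0" and c2: "continuous_on UNIV \<rho>2" using cc2
      by (auto simp: Cc_def)
  obtain B where B: "B > 0" "\<And>x. norm (\<rho>2 x) \<le> B" using Cc_bounded[OF cc2] by blast
  \<comment> \<open>The quotient is an average of two values of \<open>\<rho>2\<close> at distance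
    less than \<open>1 / N n\<close>, hence at most 1, from \<open>y\<close>. This gives both the
    pointwise limit and a bound with bounded support.\<close>
  have Drep: "\<exists>\<xi>. 0 < \<xi> \<and> \<xi> < 1 / N n \<and> D n y = (\<rho>2 (y + \<xi> *\<^sub>R b) + \<rho>2 (y + \<xi> *\<^sub>R (- b))) / 2"
      for n y
  proof -
    have "1 / N n > 0" using N[of n] by simp
    then obtain \<xi> where x: "0 < \<xi>" "\<xi> < 1 / N n"
      "\<rho> (y + (1 / N n) *\<^sub>R b) + \<rho> (y + (1 / N n) *\<^sub>R (- b)) - 2 * \<rho> y =
        (1 / N n)\<^sup>2 * (\<rho>2 (y + \<xi> *\<^sub>R b) + \<rho>2 (y + \<xi> *\<^sub>R (- b))) / 2"
      using second_difference_taylor[OF test_function_smooth[OF \<rho>] b, of "1 / N n" y]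
          unfolding \<rho>2_def by metis
    show ?thesis
      by (rule exI[of _ \<xi>]) (use x N[of n] in \<open>simp add: D_def power2_eq_square\<close>)
  qed
  have lim: "(\<lambda>n. \<integral>y. \<bar>E n y\<bar> \<partial>lborel) \<longlonglongrightarrow> (\<integral>y. 0 \<partial>(lborel :: 'a measure))"
  \<comment> \<open>The average and \<open>\<rho>2\<close> are each at most \<open>B\<close> in
    modulus, and the shift of the arguments enlarges the radius of the support from \<open>L\<close>
    to at most \<open>L + 1\<close>.\<close>
  proof (rule integral_dominated_convergence[where w="\<lambda>y. 2 * B * indicator (cball 0 (L + 1)) y"])
    show "integrable lborel (\<lambda>y::'a. 2 * B * indicator (cball 0 (L + 1)) y)"
      by (intro integrable_mult_right indicator_cball_integrable)
    show "(\<lambda>y. \<bar>E n y\<bar>) \<in> borel_measurable lborel" for n using Cc_measurable[OF ccE[of n]] by simp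
    show "AE y in lborel. norm \<bar>E n y\<bar> \<le> 2 * B * indicator (cball 0 (L + 1)) y" for n
    proof (rule AE_I2)
      fix y
      obtain \<xi> where x: "0 < \<xi>" "\<xi> < 1 / N n" "D n y = (\<rho>2 (y + \<xi> *\<^sub>R b) + \<rho>2 (y
          + \<xi> *\<^sub>R (- b))) / 2" using Drep by blast
      have x1: "\<xi> < 1" using x(2) by (rule order.strict_trans2) (simp add: N_def)
      show "norm \<bar>E n y\<bar> \<le> 2 * B * indicator (cball 0 (L + 1)) y"
      proof (cases "norm y \<le> L + 1")
        case True
        have avg: "\<bar>(p + q) / 2 - r\<bar> \<le> 2 * B" if "\<bar>p\<bar> \<le> B" "\<bar>q\<bar> \<le> B" "\<bar>r\<bar> \<le> B" for p q r :: real
          using that by (simp add: abs_le_iff) argo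
        have "\<bar>E n y\<bar> \<le> 2 * B"
          unfolding E_def x(3) by (intro avg) (use B(2) in \<open>simp_all only: real_norm_def\<close>)
        then show ?thesis using True by simp
      next
        case False
        have nx: "norm (\<xi> *\<^sub>R b) < 1" using x x1 b by simp
        have "norm (y + \<xi> *\<^sub>R b) > L" using False nx norm_triangle_ineq4[of "y + \<xi> *\<^sub>R b" "\<xi> *\<^sub>R b"]
            by simp
        moreover have "norm (y + \<xi> *\<^sub>R (- b)) > L"
            using False nx norm_triangle_ineq[of "y + \<xi> *\<^sub>R (- b)" "\<xi> *\<^sub>R b"] by simp
        moreover have "norm y > L" using False by simp
        ultimately show ?thesis using L B(1) by (simp add: E_def x(3))
      qed
    qed
    show "AE y in lborel. (\<lambda>n. \<bar>E n y\<bar>) \<longlonglongrightarrow> 0"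
    proof (rule AE_I2)
      fix y
      obtain \<xi> where x: "\<And>n. 0 < \<xi> n" "\<And>n. \<xi> n < 1 / N n"
        "\<And>n. D n y = (\<rho>2 (y + \<xi> n *\<^sub>R b) + \<rho>2 (y + \<xi> n *\<^sub>R (- b))) / 2" using Drep[of _ y] by metis
      have N0: "(\<lambda>n. 1 / N n) \<longlonglongrightarrow> 0" unfolding N_def using LIMSEQ_Suc[OF lim_1_over_n] by simp
      have \<xi>0: "\<xi> \<longlonglongrightarrow> 0"
        by (rule tendsto_sandwich[OF _ _ tendsto_const N0]) (use x in \<open>auto intro!:
            always_eventually less_imp_le\<close>)
      have cont: "(\<lambda>n. \<rho>2 (y + \<xi> n *\<^sub>R v)) \<longlonglongrightarrow> \<rho>2 y" for v
      proof -
        have "(\<lambda>n. y + \<xi> n *\<^sub>R v) \<longlonglongrightarrow> y + 0 *\<^sub>R v" by (intro tendsto_intros \<xi>0)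
        then have "(\<lambda>n. y + \<xi> n *\<^sub>R v) \<longlonglongrightarrow> y" by simp
        moreover have "isCont \<rho>2 y" using c2 by (simp add: continuous_on_eq_continuous_at)
        ultimately show ?thesis by (rule isCont_tendsto_compose[rotated])
      qed
      have "(\<lambda>n. \<bar>(\<rho>2 (y + \<xi> n *\<^sub>R b) + \<rho>2 (y + \<xi> n *\<^sub>R (- b))) / 2 - \<rho>2 y\<bar>) \<longlonglongrightarrow> \<bar>(\<rho>2 y + \<rho>2 y) / 2
          - \<rho>2 y\<bar>"
        by (intro tendsto_intros cont) simp
      then show "(\<lambda>n. \<bar>E n y\<bar>) \<longlonglongrightarrow> 0" by (simp add: E_def x(3))
    qed
  qed simp
  have "(\<lambda>n. L2_norm g * L2_norm w * (\<integral>y. \<bar>E n y\<bar> \<partial>lborel)) \<longlonglongrightarrow> L2_norm g * L2_norm w * 0"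
    by (intro tendsto_intros) (use lim in simp)
  then have "Re (I (conv w \<rho>2)) \<le> L2_norm g * L2_norm w * 0"
    by (rule LIMSEQ_le_const) (use main in blast)
  then show ?thesis by (simp add: I_def g_def \<rho>2_def)
qed

text \<open>The extremal choice would be the conjugate of \<open>w\<close>, which need not be in
  \<open>Cc\<close>. It is reached in two limits: truncate it in space and in size, then approximate
  each truncation by functions in \<open>Cc\<close>.\<close>

lemma L2_norm_le_dual:
  fixes w :: "'a::euclidean_space \<Rightarrow> complex"
  assumes w: "w \<in> L2" and c: "c \<ge> 0"
    and dual: "\<And>\<phi>. Cc \<phi> \<Longrightarrow> norm (\<integral>x. w x * \<phi> x \<partial>lborel) \<le> c * L2_norm \<phi>"
  shows "L2_norm w \<le> c"
proof -
  note [measurable] = L2_D[OF w, simplified]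
  have [measurable]: "cnj \<in> borel_measurable borel"
    by (intro borel_measurable_continuous_onI continuous_intros)
  define v where "v n x = (if norm x \<le> real n \<and> norm (w x) \<le> real n then cnj (w x) else 0)"
      for n :: nat and x
  have vmeas [measurable]: "v n \<in> borel_measurable borel" for n unfolding v_def[abs_def]
      by measurable
  have vL2: "v n \<in> L2" for n
    by (rule L2_I_bound[OF w, where C=1]) (auto simp: v_def)
  have vb: "L2_norm (v n) \<le> c" for n
  proof -
    have "v n \<in> borel_measurable lebesgue" using vmeas by (simp add: measurable_completion)
    then have "v n measurable_on UNIV" by (rule lebesgue_measurable_imp_measurable_on) simp
    \<comment> \<open>Lebesgue measurability gives continuous functions that converge almost
      everywhere, but with neither a common bound nor bounded support. The next two definitions
      enforce both.\<close>
    then obtain Z g where Z: "negligible Z" and gc: "\<And>k. continuous_on UNIV (g k)"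
      and gl: "\<And>x. x \<notin> Z \<Longrightarrow> (\<lambda>k. g k x) \<longlonglongrightarrow> v n x"
      unfolding measurable_on_def by auto
    have AEZ: "AE x in lborel. x \<notin> Z"
    proof -
      have "AE x in lebesgue. x \<notin> Z" using Z
          by (intro AE_not_in) (simp add: negligible_iff_null_sets)
      then show ?thesis by (simp add: AE_completion_iff)
    qed
    \<comment> \<open>\<open>cutoff\<close> is 1 on the ball of radius \<open>n\<close>, and
      \<open>clip\<close> projects onto the disc of radius \<open>n\<close>. Both leave the limit
      \<open>v n\<close> unchanged while bounding the approximants uniformly.\<close>
    define cutoff where "cutoff x = max 0 (min 1 (real n + 1 - norm x))" for x :: 'a
    define clip where "clip = closest_point (cball (0::complex) (real n))"
    have clipc: "continuous_on UNIV clip" unfolding clip_def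
      by (intro continuous_on_closest_point) auto
    have clipb: "norm (clip z) \<le> real n" for z
      using closest_point_in_set[of "cball (0::complex) (real n)" z] by (simp add: clip_def)
    have clipid: "clip z = z" if "norm z \<le> real n" for z
      using closest_point_self[of z "cball (0::complex) (real n)"] that by (simp add: clip_def)
    define \<phi> where "\<phi> k x = cutoff x *\<^sub>R clip (g k x)" for k x
    have cc\<phi>: "Cc (\<phi> k)" for k
      unfolding Cc_def
    proof
      show "continuous_on UNIV (\<phi> k)" unfolding \<phi>_def[abs_def] cutoff_def
        by (intro continuous_intros continuous_on_compose2[OF clipc gc]) auto
      show "\<exists>L. \<forall>x. L < norm x \<longrightarrow> \<phi> k x = 0"
        by (intro exI[of _ "real n + 1"]) (auto simp: \<phi>_def cutoff_def)
    qed
    have \<phi>b: "norm (\<phi> k x) \<le> real n * indicator (cball 0 (real n + 1)) x" for k x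
    proof (cases "norm x \<le> real n + 1")
      case True
      have "\<bar>cutoff x\<bar> * norm (clip (g k x)) \<le> 1 * real n"
          by (intro mult_mono clipb) (auto simp: cutoff_def)
      then show ?thesis using True by (simp add: \<phi>_def)
    qed (simp add: \<phi>_def cutoff_def)
    have \<phi>l: "AE x in lborel. (\<lambda>k. \<phi> k x) \<longlonglongrightarrow> v n x"
      using AEZ
    proof eventually_elim
      case (elim x)
      have vn: "norm (v n x) \<le> real n" by (auto simp: v_def)
      have "isCont clip (v n x)" using clipc by (simp add: continuous_on_eq_continuous_at)
      then have "(\<lambda>k. clip (g k x)) \<longlonglongrightarrow> clip (v n x)" using gl[OF elim]
          by (rule isCont_tendsto_compose)
      then have "(\<lambda>k. \<phi> k x) \<longlonglongrightarrow> cutoff x *\<^sub>R clip (v n x)" unfolding \<phi>_def by (intro tendsto_intros)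
      moreover have "cutoff x *\<^sub>R clip (v n x) = v n x"
        unfolding clipid[OF vn] by (auto simp: cutoff_def v_def)
      ultimately show ?case by simp
    qed
    note [measurable] = Cc_measurable[OF cc\<phi>]
    have "(\<lambda>k. \<integral>x. w x * \<phi> k x \<partial>lborel) \<longlonglongrightarrow> (\<integral>x. w x * v n x \<partial>lborel)"
    proof (rule integral_dominated_convergence[where
        w="\<lambda>x. real n * norm (w x * complex_of_real (indicator (cball 0 (real n + 1)) x))"])
      show "integrable lborel (\<lambda>x. real n * norm (w x * complex_of_real (indicator (cball 0 (real n
          + 1)) x)))"
        using L2_mult_integrable[OF w indicator_cball_L2]
            by (intro integrable_mult_right integrable_norm)
      show "AE x in lborel. (\<lambda>k. w x * \<phi> k x) \<longlonglongrightarrow> w x * v n x"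
        using \<phi>l by eventually_elim (intro tendsto_intros)
      show "AE x in lborel. norm (w x * \<phi> k x) \<le> real n * norm (w x * complex_of_real (indicator
          (cball 0 (real n + 1)) x))" for k
      proof (rule AE_I2)
        fix x
        show "norm (w x * \<phi> k x) \<le> real n * norm (w x * complex_of_real (indicator (cball 0 (real n
            + 1)) x))"
          using mult_left_mono[OF \<phi>b[of k x], of "norm (w x)"] by (simp add: norm_mult mult_ac)
      qed
    qed measurable
    then have l1: "(\<lambda>k. norm (\<integral>x. w x * \<phi> k x \<partial>lborel)) \<longlonglongrightarrow> norm (\<integral>x. w x * v n x \<partial>lborel)"
        by (rule tendsto_norm)
    have "(\<lambda>k. \<integral>x. (norm (\<phi> k x))\<^sup>2 \<partial>lborel) \<longlonglongrightarrow> (\<integral>x. (norm (v n x))\<^sup>2 \<partial>lborel)"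
    proof (rule integral_dominated_convergence[where
        w="\<lambda>x. (real n)\<^sup>2 * indicator (cball 0 (real n + 1)) x"])
      show "integrable lborel (\<lambda>x::'a. (real n)\<^sup>2 * indicator (cball 0 (real n + 1)) x)"
        by (intro integrable_mult_right indicator_cball_integrable)
      show "AE x in lborel. (\<lambda>k. (norm (\<phi> k x))\<^sup>2) \<longlonglongrightarrow> (norm (v n x))\<^sup>2"
        using \<phi>l by eventually_elim (intro tendsto_intros)
      show "AE x in lborel. norm ((norm (\<phi> k x))\<^sup>2) \<le> (real n)\<^sup>2 * indicator (cball 0 (real n
          + 1)) x" for k
      proof (rule AE_I2)
        fix x
        show "norm ((norm (\<phi> k x))\<^sup>2) \<le> (real n)\<^sup>2 * indicator (cball 0 (real n + 1)) x"
          using power_mono[OF \<phi>b[of k x], of 2]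
              by (cases "norm x \<le> real n + 1") (auto simp: power_mult_distrib)
      qed
    qed measurable
    then have l2: "(\<lambda>k. c * L2_norm (\<phi> k)) \<longlonglongrightarrow> c * L2_norm (v n)"
      unfolding L2_norm_def by (intro tendsto_intros)
    have "norm (\<integral>x. w x * v n x \<partial>lborel) \<le> c * L2_norm (v n)"
      by (rule LIMSEQ_le[OF l1 l2]) (use dual[OF cc\<phi>] in auto)
    \<comment> \<open>At each point \<open>v n\<close> is either zero or the conjugate of
      \<open>w\<close>, so the product is the squared modulus of \<open>v n\<close> in both
      cases.\<close>
    moreover have "(\<integral>x. w x * v n x \<partial>lborel) = complex_of_real ((L2_norm (v n))\<^sup>2)"
    proof -
      have "(\<integral>x. w x * v n x \<partial>lborel) = (\<integral>x. complex_of_real ((norm (v n x))\<^sup>2) \<partial>lborel)"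
        by (intro Bochner_Integration.integral_cong[OF refl]) (simp add: v_def complex_norm_square
            flip: of_real_power)
      then show ?thesis by (simp add: L2_norm_sq del: of_real_power)
    qed
    ultimately have "L2_norm (v n) * L2_norm (v n) \<le> c * L2_norm (v n)"
      by (simp add: power2_eq_square norm_mult)
    then show ?thesis using c by (cases "L2_norm (v n) = 0") (auto simp: mult_le_cancel_right
        order.strict_iff_order)
  qed
  have "(\<lambda>n. \<integral>x. (norm (v n x))\<^sup>2 \<partial>lborel) \<longlonglongrightarrow> (\<integral>x. (norm (w x))\<^sup>2 \<partial>lborel)"
  proof (rule integral_dominated_convergence[OF _ _ L2_integrable[OF w]])
    show "AE x in lborel. (\<lambda>n. (norm (v n x))\<^sup>2) \<longlonglongrightarrow> (norm (w x))\<^sup>2"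
    proof (rule AE_I2, rule tendsto_eventually)
      fix x
      obtain M :: nat where M: "real M \<ge> max (norm x) (norm (w x))" using real_arch_simple by blast
      show "\<forall>\<^sub>F n in sequentially. (norm (v n x))\<^sup>2 = (norm (w x))\<^sup>2"
        using eventually_ge_at_top[of M] by eventually_elim (use M in \<open>auto simp: v_def\<close>)
    qed
    show "AE x in lborel. norm ((norm (v n x))\<^sup>2) \<le> (norm (w x))\<^sup>2" for n by (auto simp: v_def)
  qed measurable
  then have "(\<lambda>n. L2_norm (v n)) \<longlonglongrightarrow> L2_norm w" unfolding L2_norm_def by (intro tendsto_intros)
  then show ?thesis by (rule LIMSEQ_le_const2) (use vb in blast)
qed

section \<open>Mollification and weak solutions\<close>

lemma rescale_outside:
  assumes "\<And>x. norm x > L \<Longrightarrow> \<psi> x = 0" "r > 0" "norm x > r * L"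
  shows "rescale r \<psi> x = 0"
proof -
  have "norm (x /\<^sub>R r) > L" using assms(2,3) by (simp add: field_simps)
  then show ?thesis using assms(1) by (simp add: rescale_def)
qed

lemma rescale_mollifier:
  fixes \<psi> :: "'a::euclidean_space \<Rightarrow> real"
  assumes \<psi>: "friedrichs_mollifier \<psi>" and r: "r > 0"
  shows "friedrichs_mollifier (rescale r \<psi>)"
proof -
  have tf: "test_function UNIV \<psi>" and nn: "\<And>x. \<psi> x \<ge> 0" and i1: "(\<integral>x. \<psi> x \<partial>lborel) = 1"
    using \<psi> by (auto simp: friedrichs_mollifier_def)
  have [measurable]: "\<psi> \<in> borel_measurable borel"
      by (rule Cc_measurable[OF Cc_test_function[OF tf]])
  have [measurable]: "rescale r \<psi> \<in> borel_measurable borel" unfolding rescale_def[abs_def]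
      by measurable
  have "rescale r \<psi> = (\<lambda>y. inverse (r ^ DIM('a)) *\<^sub>R \<psi> (0 + inverse r *\<^sub>R y))"
    by (simp add: rescale_def[abs_def])
  then have "test_function UNIV (rescale r \<psi>)"
      using test_function_affine[OF tf, of "inverse r" "inverse (r ^ DIM('a))" 0] r by simp
  moreover have "(\<integral>x. rescale r \<psi> x \<partial>lborel) = 1"
  proof -
    have "(\<integral>x. rescale r \<psi> x \<partial>lborel) = (\<integral>x. rescale r \<psi> x \<partial>(density (distr lborel borel (\<lambda>x::'a. 0
        + r *\<^sub>R x)) (\<lambda>_. \<bar>r\<bar> ^ DIM('a))))"
      using lborel_affine[of r "0::'a"] r by simp
    also have "\<dots> = (\<integral>x. \<bar>r\<bar> ^ DIM('a) * rescale r \<psi> (r *\<^sub>R x) \<partial>lborel)"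
      by (subst integral_density) (auto simp: integral_distr)
    also have "\<dots> = (\<integral>x. \<psi> x \<partial>lborel)"
      using r by (intro Bochner_Integration.integral_cong[OF refl]) (simp add: rescale_def)
    finally show ?thesis using i1 by simp
  qed
  ultimately show ?thesis using nn r by (simp add: friedrichs_mollifier_def rescale_def)
qed

text \<open>Moves the mollification from \<open>w\<close>, where no pointwise limit is available, to
  the continuous function \<open>\<phi>\<close>.\<close>

lemma conv_pairing_swap:
  fixes w :: "'a::euclidean_space \<Rightarrow> complex"
  assumes w: "w \<in> L2" and \<rho>: "Cc \<rho>" and \<phi>: "Cc \<phi>"
  shows "(\<integral>x. conv w \<rho> x * \<phi> x \<partial>lborel) = (\<integral>y. w y * (\<integral>x. complex_of_real (\<rho> (x
      - y)) * \<phi> x \<partial>lborel) \<partial>lborel)"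
proof -
  note [measurable] = L2_D[OF w, simplified] Cc_measurable[OF \<rho>] Cc_measurable[OF \<phi>]
  define f where "f x y = w y * complex_of_real (\<rho> (x - y)) * \<phi> x" for x y
  have int: "integrable (lborel \<Otimes>\<^sub>M lborel) (case_prod f)"
  proof (rule lborel_pair.Fubini_integrable)
    show "case_prod f \<in> borel_measurable (lborel \<Otimes>\<^sub>M lborel)" unfolding f_def by measurable
    have nw: "(\<lambda>y. complex_of_real (norm (w y))) \<in> L2"
      by (rule L2_I_bound[OF w, where C=1]) auto
    have n\<rho>: "Cc (\<lambda>y. \<bar>\<rho> y\<bar>)" using \<rho> unfolding Cc_def by (auto intro!: continuous_intros)
    \<comment> \<open>Integrating the modulus of \<open>f\<close> in \<open>y\<close> gives the
      convolution of |w| with |\<rho>| times |\<phi>|, which is integrable by \<open>young\<close>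
      and Cauchy-Schwarz. This is the hypothesis of Fubini.\<close>
    have "integrable lborel (\<lambda>x. conv (\<lambda>y. complex_of_real (norm (w y))) (\<lambda>y. \<bar>\<rho> y\<bar>) x * \<phi> x)"
      by (rule L2_mult_integrable[OF young(1)[OF nw n\<rho>] Cc_L2_complex[OF \<phi>]])
    then have "integrable lborel (\<lambda>x. norm (conv (\<lambda>y. complex_of_real (norm (w y))) (\<lambda>y. \<bar>\<rho> y\<bar>) x *
        \<phi> x))"
      by (rule integrable_norm)
    moreover have "norm (conv (\<lambda>y. complex_of_real (norm (w y))) (\<lambda>y. \<bar>\<rho> y\<bar>) x * \<phi> x)
        = (\<integral>y. norm (case_prod f (x, y)) \<partial>lborel)" for x
    proof -
      have "conv (\<lambda>y. complex_of_real (norm (w y))) (\<lambda>y. \<bar>\<rho> y\<bar>) x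
          = complex_of_real (\<integral>y. norm (w y) * \<bar>\<rho> (x - y)\<bar> \<partial>lborel)"
        unfolding conv_def by (simp flip: of_real_mult)
      moreover have "(\<integral>y. norm (w y) * \<bar>\<rho> (x - y)\<bar> \<partial>lborel) \<ge> 0"
          by (intro Bochner_Integration.integral_nonneg) simp
      ultimately have "norm (conv (\<lambda>y. complex_of_real (norm (w y))) (\<lambda>y. \<bar>\<rho> y\<bar>) x * \<phi> x)
          = (\<integral>y. norm (w y) * \<bar>\<rho> (x - y)\<bar> \<partial>lborel) * norm (\<phi> x)"
        by (simp add: norm_mult)
      also have "\<dots> = (\<integral>y. norm (case_prod f (x, y)) \<partial>lborel)"
        by (simp add: f_def norm_mult)
      finally show ?thesis .
    qed
    ultimately show "integrable lborel (\<lambda>x. \<integral>y. norm (case_prod f (x, y)) \<partial>lborel)" by simp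
    show "AE x in lborel. integrable lborel (\<lambda>y. case_prod f (x, y))"
      using conv_integrable[OF w \<rho>] by (simp add: f_def)
  qed
  have "(\<integral>x. conv w \<rho> x * \<phi> x \<partial>lborel) = (\<integral>x. (\<integral>y. f x y \<partial>lborel) \<partial>lborel)"
    by (simp add: conv_def f_def)
  also have "\<dots> = (\<integral>y. (\<integral>x. f x y \<partial>lborel) \<partial>lborel)"
    using lborel_pair.Fubini_integral[OF int] by simp
  also have "\<dots> = (\<integral>y. w y * (\<integral>x. complex_of_real (\<rho> (x - y)) * \<phi> x \<partial>lborel) \<partial>lborel)"
    by (simp add: f_def mult.assoc)
  finally show ?thesis .
qed

text \<open>Lower semicontinuity of the norm. After \<open>conv_pairing_swap\<close> the averages of
  \<open>\<phi>\<close> converge pointwise, bounded and supported in one ball, so every pairing with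
  \<open>w\<close> inherits the bound \<open>c\<close>.\<close>

lemma mollified_norm_limit:
  fixes w :: "'a::euclidean_space \<Rightarrow> complex" and \<psi> :: "'a \<Rightarrow> real"
  assumes w: "w \<in> L2" and \<psi>: "friedrichs_mollifier \<psi>" and c: "c \<ge> 0"
    and le: "\<And>r. r > 0 \<Longrightarrow> L2_norm (conv w (rescale r \<psi>)) \<le> c"
  shows "L2_norm w \<le> c"
proof (rule L2_norm_le_dual[OF w c])
  fix \<phi> :: "'a \<Rightarrow> complex" assume \<phi>: "Cc \<phi>"
  have tf: "test_function UNIV \<psi>" and nn: "\<And>x. \<psi> x \<ge> 0" using \<psi>
      by (auto simp: friedrichs_mollifier_def)
  obtain L where L: "L > 0" "\<And>x. norm x > L \<Longrightarrow> \<psi> x = 0" using test_function_bounded_support[OF tf]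
      by metis
  define r where "r n = 1 / real (Suc n)" for n
  have r: "r n > 0" "r n \<le> 1" for n by (auto simp: r_def)
  have r0: "r \<longlonglongrightarrow> 0" unfolding r_def using LIMSEQ_Suc[OF lim_1_over_n] by simp
  define \<rho> where "\<rho> n = rescale (r n) \<psi>" for n
  have F: "friedrichs_mollifier (\<rho> n)" for n unfolding \<rho>_def by (rule rescale_mollifier[OF \<psi> r(1)])
  then have tf\<rho>: "test_function UNIV (\<rho> n)" and nn\<rho>: "\<rho> n x \<ge> 0" and i\<rho>: "(\<integral>x. \<rho> n x \<partial>lborel) = 1"
      for n x
    by (auto simp: friedrichs_mollifier_def)
  note cc\<rho> = Cc_test_function[OF tf\<rho>]
  note [measurable] = Cc_measurable[OF \<phi>] Cc_measurable[OF cc\<rho>] L2_D[OF w, simplified]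
  have out: "\<rho> n x = 0" if "norm x > r n * L" for n x
    unfolding \<rho>_def by (rule rescale_outside[OF L(2) r(1) that])
  define \<Phi> where "\<Phi> n y = (\<integral>x. complex_of_real (\<rho> n (x - y)) * \<phi> x \<partial>lborel)" for n y
  obtain K where K: "\<And>x. norm x > K \<Longrightarrow> \<phi> x = 0" and c\<phi>: "continuous_on UNIV \<phi>" using \<phi>
      by (auto simp: Cc_def)
  obtain B where B: "B > 0" "\<And>x. norm (\<phi> x) \<le> B" using Cc_bounded[OF \<phi>] by blast
  have ii: "integrable lborel (\<lambda>x. \<rho> n (x - y))" for n y
    using Cc_integrable[OF Cc_translate[OF cc\<rho>[of n], of "-y"]] by simp
  have i1: "(\<integral>x. \<rho> n (x - y) \<partial>lborel) = 1" for n y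
    using lborel_integral_translate[of "\<rho> n" "-y"] i\<rho>[of n] by simp
  have iL: "integrable lborel (\<lambda>x. complex_of_real (\<rho> n (x - y)) * \<phi> x)" for n y
    using L2_mult_integrable[OF Cc_L2[OF Cc_translate[OF cc\<rho>[of n], of "-y"]] Cc_L2_complex[OF \<phi>]]
        by simp
  \<comment> \<open>\<open>\<Phi> n y\<close> is an average of \<open>\<phi>\<close> over the ball
    of radius \<open>r n * L\<close> about \<open>y\<close>. The three uses are \<open>z = 0\<close>
    with \<open>e = B\<close> for boundedness, \<open>z = 0\<close> with \<open>e = 0\<close> for
    the support, and \<open>z = \<phi> y\<close> for convergence.\<close>
  have est: "norm (\<Phi> n y - z) \<le> e" if z: "\<And>x. norm (x - y) \<le> r n * L \<Longrightarrow> norm (\<phi> x - z) \<le> e"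
      for n y z e
  proof -
    have "\<Phi> n y - z = (\<integral>x. complex_of_real (\<rho> n (x - y)) * \<phi> x \<partial>lborel)
        - (\<integral>x. complex_of_real (\<rho> n (x - y)) * z \<partial>lborel)"
      using i1[of n y] ii[of n y] by (simp add: \<Phi>_def)
    also have "\<dots> = (\<integral>x. complex_of_real (\<rho> n (x - y)) * (\<phi> x - z) \<partial>lborel)"
      using iL[of n y] ii[of n y] by (simp add: right_diff_distrib)
    also have "norm \<dots> \<le> (\<integral>x. \<rho> n (x - y) * e \<partial>lborel)"
    proof (rule Bochner_Integration.integral_norm_bound_integral)
      show "integrable lborel (\<lambda>x. complex_of_real (\<rho> n (x - y)) * (\<phi> x - z))"
        using iL[of n y] ii[of n y] by (simp add: right_diff_distrib)
      show "integrable lborel (\<lambda>x. \<rho> n (x - y) * e)" using ii[of n y] by simp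
      fix x
      show "norm (complex_of_real (\<rho> n (x - y)) * (\<phi> x - z)) \<le> \<rho> n (x - y) * e"
        using z[of x] out[of n "x - y"] nn\<rho>[of n "x - y"]
        by (cases "norm (x - y) \<le> r n * L") (auto simp: norm_mult intro!: mult_left_mono)
    qed
    also have "\<dots> = e" using i1[of n y] by simp
    finally show ?thesis .
  qed
  have \<Phi>b: "norm (\<Phi> n y) \<le> B" for n y using est[of y n 0 B] B(2) by simp
  have rL: "r n * L \<le> L" for n using r[of n] L(1) by (simp add: mult_left_le_one_le)
  have \<Phi>0: "\<Phi> n y = 0" if "norm y > K + L" for n y
  proof -
    have "norm (\<Phi> n y - 0) \<le> 0"
    proof (rule est)
      fix x assume "norm (x - y) \<le> r n * L"
      then have "norm (y - x) \<le> L" using rL[of n] by (simp add: norm_minus_commute)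
      then have "norm x > K" using that norm_triangle_ineq2[of y x] by linarith
      then show "norm (\<phi> x - 0) \<le> 0" using K by simp
    qed
    then show ?thesis by simp
  qed
  have \<Phi>l: "(\<lambda>n. \<Phi> n y) \<longlonglongrightarrow> \<phi> y" for y
  proof (rule LIMSEQ_I)
    fix e :: real assume e: "e > 0"
    have "isCont \<phi> y" using c\<phi> by (simp add: continuous_on_eq_continuous_at)
    then obtain d where d: "d > 0" "\<And>x. norm (x - y) < d \<Longrightarrow> norm (\<phi> x - \<phi> y) < e / 2"
      using e unfolding continuous_at_eps_delta dist_norm by (metis half_gt_zero)
    have "(\<lambda>n. r n * L) \<longlonglongrightarrow> 0 * L" by (intro tendsto_intros r0)
    then have "\<forall>\<^sub>F n in sequentially. r n * L < d" using d(1) by (intro order_tendstoD) auto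
    then obtain N where N: "\<And>n. n \<ge> N \<Longrightarrow> r n * L < d" by (auto simp: eventually_sequentially)
    have "norm (\<Phi> n y - \<phi> y) < e" if "n \<ge> N" for n
    proof -
      have "norm (\<Phi> n y - \<phi> y) \<le> e / 2"
        by (rule est) (use N[OF that] d(2) in \<open>force intro: less_imp_le\<close>)
      then show ?thesis using e by simp
    qed
    then show "\<exists>N. \<forall>n\<ge>N. norm (\<Phi> n y - \<phi> y) < e" by blast
  qed
  have [measurable]: "\<Phi> n \<in> borel_measurable borel" for n unfolding \<Phi>_def[abs_def] by measurable
  have "(\<lambda>n. \<integral>y. w y * \<Phi> n y \<partial>lborel) \<longlonglongrightarrow> (\<integral>y. w y * \<phi> y \<partial>lborel)"
  proof (rule integral_dominated_convergence[where w="\<lambda>y. B * norm (w y * complex_of_real (indicator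
      (cball 0 (K + L)) y))"])
    show "integrable lborel (\<lambda>y. B * norm (w y * complex_of_real (indicator (cball 0 (K + L)) y)))"
      using L2_mult_integrable[OF w indicator_cball_L2]
          by (intro integrable_mult_right integrable_norm)
    show "AE y in lborel. (\<lambda>n. w y * \<Phi> n y) \<longlonglongrightarrow> w y * \<phi> y"
      by (intro AE_I2 tendsto_intros \<Phi>l)
    show "AE y in lborel. norm (w y * \<Phi> n y) \<le> B * norm (w y * complex_of_real (indicator (cball 0
        (K + L)) y))" for n
    proof (rule AE_I2)
      fix y
      show "norm (w y * \<Phi> n y) \<le> B * norm (w y * complex_of_real (indicator (cball 0 (K + L)) y))"
      proof (cases "norm y \<le> K + L")
        case True
        then show ?thesis using mult_left_mono[OF \<Phi>b[of n y], of "norm (w y)"]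
            by (simp add: norm_mult mult.commute)
      next
        case False
        then show ?thesis using \<Phi>0[of y n] B(1) by simp
      qed
    qed
  qed measurable
  then have "(\<lambda>n. norm (\<integral>x. conv w (\<rho> n) x * \<phi> x \<partial>lborel)) \<longlonglongrightarrow> norm (\<integral>y. w y * \<phi> y \<partial>lborel)"
    unfolding conv_pairing_swap[OF w cc\<rho> \<phi>] \<Phi>_def by (rule tendsto_norm)
  then show "norm (\<integral>y. w y * \<phi> y \<partial>lborel) \<le> c * L2_norm \<phi>"
  proof (rule LIMSEQ_le_const2, intro exI allI impI)
    fix n
    have "norm (\<integral>x. conv w (\<rho> n) x * \<phi> x \<partial>lborel) \<le> L2_norm (conv w (\<rho> n)) * L2_norm \<phi>"
      by (rule L2_cauchy_schwarz[OF young(1)[OF w cc\<rho>] Cc_L2_complex[OF \<phi>]])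
    also have "\<dots> \<le> c * L2_norm \<phi>" using le[OF r(1)] by (intro mult_right_mono) (auto simp: \<rho>_def)
    finally show "norm (\<integral>x. conv w (\<rho> n) x * \<phi> x \<partial>lborel) \<le> c * L2_norm \<phi>" .
  qed
qed

text \<open>\<open>\<partial>\<^sub>t w - \<Delta> w = F\<close>, tested in space only and integrated in time.\<close>

definition weak_heat ::
    "real \<Rightarrow> (real \<Rightarrow> 'a::euclidean_space \<Rightarrow> complex) \<Rightarrow> (real \<Rightarrow> 'a \<Rightarrow> complex) \<Rightarrow> bool" where
  "weak_heat T w F \<longleftrightarrow> cont_L2 T w \<and> cont_L2 T F \<and>
     (\<forall>\<eta>. test_function UNIV \<eta> \<longrightarrow> (\<forall>t\<in>{0..T}.
        (\<integral>x. w t x * complex_of_real (\<eta> x) \<partial>lborel) = (\<integral>x. w 0 x * complex_of_real (\<eta> x) \<partial>lborel) +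
        integral {0..t} (\<lambda>s. (\<integral>x. w s x * complex_of_real (laplacian \<eta> x) \<partial>lborel) + (\<integral>x. F s x *
            complex_of_real (\<eta> x) \<partial>lborel))))"

lemma Cc_laplacian: "test_function U \<eta> \<Longrightarrow> Cc (laplacian \<eta>)"
  unfolding laplacian_def[abs_def]
  by (intro Cc_sum) (auto intro!: Cc_test_function[OF test_function_dir_deriv[OF
      test_function_dir_deriv]])

text \<open>Test functions that are products of a function of time and one of space suffice: for a
  fixed spatial factor the equation is a weak ordinary differential equation in time, which
  \<open>du_bois_reymond\<close> integrates.\<close>

lemma heat_solution_weak_heat:
  fixes p :: "'a::euclidean_space \<Rightarrow> complex" and r :: "real \<Rightarrow> real"
  assumes sol: "heat_solution T p v u" and p: "p \<in> borel_measurable lborel"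
      "AE x in lborel. norm (p x) \<le> M" "M \<ge> 0"
    and T: "T > 0" and r: "friedrichs_mollifier r"
  shows "weak_heat T u (\<lambda>t x. p x * u t x)"
  unfolding weak_heat_def
proof (intro conjI allI impI ballI)
  show u: "cont_L2 T u" using sol by (simp add: heat_solution_def)
  show F: "cont_L2 T (\<lambda>t x. p x * u t x)" by (rule cont_L2_bounded_mult[OF u p])
  fix \<eta> :: "'a \<Rightarrow> real" and t assume \<eta>: "test_function UNIV \<eta>" and t: "t \<in> {0..T}"
  note L1 = Cc_L2[OF Cc_test_function[OF \<eta>]] and L2 = Cc_L2[OF Cc_laplacian[OF \<eta>]]
  show "(\<integral>x. u t x * complex_of_real (\<eta> x) \<partial>lborel) = (\<integral>x. u 0 x * complex_of_real (\<eta> x) \<partial>lborel) +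
        integral {0..t} (\<lambda>s. (\<integral>x. u s x * complex_of_real (laplacian \<eta> x) \<partial>lborel) + (\<integral>x. p x * u s
            x * complex_of_real (\<eta> x) \<partial>lborel))"
  proof (rule du_bois_reymond[OF r _ _ _ t T])
    show "continuous_on {0..T} (\<lambda>t. \<integral>x. u t x * complex_of_real (\<eta> x) \<partial>lborel)"
        by (rule cont_L2_pairing[OF u L1])
    show "continuous_on {0..T} (\<lambda>s. (\<integral>x. u s x * complex_of_real (laplacian \<eta> x) \<partial>lborel)
        + (\<integral>x. p x * u s x * complex_of_real (\<eta> x) \<partial>lborel))"
      by (intro continuous_on_add cont_L2_pairing[OF u L2] cont_L2_pairing[OF F L1])
    fix \<theta> :: "real \<Rightarrow> real" assume \<theta>: "test_function {0<..<T} \<theta>"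
    define \<phi> where "\<phi> z = complex_of_real (\<theta> (fst z) * \<eta> (snd z))" for z :: "real \<times> 'a"
    note sm = test_function_smooth[OF \<theta>] test_function_smooth[OF \<eta>]
    have "(LINT s:{0<..<T}|lborel. (\<integral>x. u s x * (- time_deriv \<phi> (s, x) - space_laplacian \<phi> (s, x)
        - p x * \<phi> (s, x)) \<partial>lborel)) = 0"
      using sol tensor_test_function[OF \<theta> \<eta>] unfolding heat_solution_def \<phi>_def[abs_def] by blast
    moreover have "(\<integral>x. u s x * (- time_deriv \<phi> (s, x) - space_laplacian \<phi> (s, x)
        - p x * \<phi> (s, x)) \<partial>lborel) =
       - (complex_of_real (dir_deriv 1 \<theta> s) * (\<integral>x. u s x * complex_of_real (\<eta> x) \<partial>lborel) +
           complex_of_real (\<theta> s) *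
        ((\<integral>x. u s x * complex_of_real (laplacian \<eta> x) \<partial>lborel) + (\<integral>x. p x * u s x * complex_of_real
            (\<eta> x) \<partial>lborel)))" if "s \<in> {0<..<T}" for s
    proof -
      have s: "s \<in> {0..T}" using that by auto
      note I1 = L2_mult_integrable[OF cont_L2_L2[OF u s] L1] and I2 = L2_mult_integrable[OF
          cont_L2_L2[OF u s] L2]
        and I3 = L2_mult_integrable[OF cont_L2_L2[OF F s] L1]
      have "(\<integral>x. u s x * (- time_deriv \<phi> (s, x) - space_laplacian \<phi> (s, x)
          - p x * \<phi> (s, x)) \<partial>lborel) =
        (\<integral>x. - (complex_of_real (dir_deriv 1 \<theta> s) * (u s x * complex_of_real (\<eta> x))) -
            complex_of_real (\<theta> s) * (u s x * complex_of_real (laplacian \<eta> x))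
          - complex_of_real (\<theta> s) * (p x * u s x * complex_of_real (\<eta> x)) \<partial>lborel)"
        unfolding \<phi>_def time_deriv_tensor[OF sm] space_laplacian_tensor[OF sm]
        by (intro Bochner_Integration.integral_cong[OF refl]) (simp add: algebra_simps)
      also have "\<dots> = - (complex_of_real (dir_deriv 1 \<theta> s) * (\<integral>x. u s x * complex_of_real (\<eta> x)
          \<partial>lborel)) - complex_of_real (\<theta> s) * (\<integral>x. u s x * complex_of_real (laplacian \<eta> x) \<partial>lborel)
          - complex_of_real (\<theta> s) * (\<integral>x. p x * u s x * complex_of_real (\<eta> x) \<partial>lborel)"
        using I1 I2 I3 by simp
      finally show ?thesis by (simp only: distrib_left minus_add_distrib add.assoc
          diff_conv_add_uminus)
    qed
    ultimately have "(LINT s:{0<..<T}|lborel. - (complex_of_real (dir_deriv 1 \<theta> s) * (\<integral>x. u s x *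
        complex_of_real (\<eta> x) \<partial>lborel) + complex_of_real (\<theta> s) *
        ((\<integral>x. u s x * complex_of_real (laplacian \<eta> x) \<partial>lborel) + (\<integral>x. p x * u s x * complex_of_real
            (\<eta> x) \<partial>lborel)))) = 0"
      by (subst (asm) set_lebesgue_integral_cong) auto
    then show "(LINT s:{0<..<T}|lborel. complex_of_real (dir_deriv 1 \<theta> s) * (\<integral>x. u s x *
        complex_of_real (\<eta> x) \<partial>lborel) + complex_of_real (\<theta> s) *
        ((\<integral>x. u s x * complex_of_real (laplacian \<eta> x) \<partial>lborel) + (\<integral>x. p x * u s x * complex_of_real
            (\<eta> x) \<partial>lborel))) = 0"
      by (simp only: set_lebesgue_integral_def scaleR_minus_right Bochner_Integration.integral_minus
          neg_equal_0_iff_equal)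
  qed
qed

text \<open>Linearity with the potential hidden in the right-hand side. Two solutions with different
  potentials can therefore be subtracted.\<close>

lemma weak_heat_diff:
  fixes w v F G :: "real \<Rightarrow> 'a::euclidean_space \<Rightarrow> complex"
  assumes w: "weak_heat T w F" and v: "weak_heat T v G"
  shows "weak_heat T (\<lambda>t x. w t x - v t x) (\<lambda>t x. F t x - G t x)"
  unfolding weak_heat_def
proof (intro conjI allI impI ballI)
  have cw: "cont_L2 T w" "cont_L2 T F" and cv: "cont_L2 T v" "cont_L2 T G" using w v
      by (auto simp: weak_heat_def)
  show "cont_L2 T (\<lambda>t x. w t x - v t x)" by (rule cont_L2_diff[OF cw(1) cv(1)])
  show "cont_L2 T (\<lambda>t x. F t x - G t x)" by (rule cont_L2_diff[OF cw(2) cv(2)])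
  fix \<eta> :: "'a \<Rightarrow> real" and t assume \<eta>: "test_function UNIV \<eta>" and t: "t \<in> {0..T}"
  note L1 = Cc_L2[OF Cc_test_function[OF \<eta>]] and L2 = Cc_L2[OF Cc_laplacian[OF \<eta>]]
  have lin: "(\<integral>x. (a s x - b s x) * complex_of_real (\<zeta> x) \<partial>lborel)
      = (\<integral>x. a s x * complex_of_real (\<zeta> x) \<partial>lborel) - (\<integral>x. b s x * complex_of_real (\<zeta> x) \<partial>lborel)"
    if "cont_L2 T a" "cont_L2 T b" "(\<lambda>x. complex_of_real (\<zeta> x)) \<in> L2" "s \<in> {0..T}"
        for a b s and \<zeta> :: "'a \<Rightarrow> real"
    using L2_mult_integrable[OF cont_L2_L2[OF that(1,4)] that(3)] L2_mult_integrable[OF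
        cont_L2_L2[OF that(2,4)] that(3)]
    by (simp add: left_diff_distrib)
  define k where "k a b s = (\<integral>x. a s x * complex_of_real (laplacian \<eta> x) \<partial>lborel)
      + (\<integral>x. b s x * complex_of_real (\<eta> x) \<partial>lborel)" for a b :: "real \<Rightarrow> 'a \<Rightarrow> complex" and s
  have kc: "k a b integrable_on {0..t}" if "cont_L2 T a" "cont_L2 T b" for a b
  proof (rule integrable_continuous_real)
    have "continuous_on {0..T} (k a b)"
      unfolding k_def by (intro continuous_on_add cont_L2_pairing[OF that(1) L2] cont_L2_pairing[OF
          that(2) L1])
    then show "continuous_on {0..t} (k a b)" by (rule continuous_on_subset) (use t in auto)
  qed
  have kd: "integral {0..t} (k (\<lambda>t x. w t x - v t x) (\<lambda>t x. F t x - G t x))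
      = integral {0..t} (\<lambda>s. k w F s - k v G s)"
  proof (rule integral_cong)
    fix s assume "s \<in> {0..t}"
    then have s: "s \<in> {0..T}" using t by auto
    show "k (\<lambda>t x. w t x - v t x) (\<lambda>t x. F t x - G t x) s = k w F s - k v G s"
      unfolding k_def using lin[OF cw(1) cv(1) L2 s] lin[OF cw(2) cv(2) L1 s] by simp
  qed
  also have "\<dots> = integral {0..t} (k w F) - integral {0..t} (k v G)"
    by (rule integral_diff[OF kc[OF cw] kc[OF cv]])
  finally have kk: "integral {0..t} (k (\<lambda>t x. w t x - v t x) (\<lambda>t x. F t x - G t x))
      = integral {0..t} (k w F) - integral {0..t} (k v G)" .
  have z: "0 \<in> {0..T}" using t by auto
  have ew: "(\<integral>x. w t x * complex_of_real (\<eta> x) \<partial>lborel)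
      = (\<integral>x. w 0 x * complex_of_real (\<eta> x) \<partial>lborel) + integral {0..t} (k w F)"
    using w \<eta> t unfolding weak_heat_def k_def[abs_def] by blast
  have ev: "(\<integral>x. v t x * complex_of_real (\<eta> x) \<partial>lborel)
      = (\<integral>x. v 0 x * complex_of_real (\<eta> x) \<partial>lborel) + integral {0..t} (k v G)"
    using v \<eta> t unfolding weak_heat_def k_def[abs_def] by blast
  show "(\<integral>x. (w t x - v t x) * complex_of_real (\<eta> x) \<partial>lborel) = (\<integral>x. (w 0 x
      - v 0 x) * complex_of_real (\<eta> x) \<partial>lborel) +
        integral {0..t} (\<lambda>s. (\<integral>x. (w s x - v s x) * complex_of_real (laplacian \<eta> x) \<partial>lborel) + (\<integral>x.
            (F s x - G s x) * complex_of_real (\<eta> x) \<partial>lborel))"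
    using lin[OF cw(1) cv(1) L1 t] lin[OF cw(1) cv(1) L1 z] ew ev kk by (simp add: k_def[abs_def])
qed

section \<open>The energy estimate\<close>

text \<open>The bound is free of \<open>\<rho>\<close> because a mollifier has L1 norm 1:
  \<open>young\<close> replaces the mollified \<open>F\<close> and \<open>w\<close> by the originals
  with constant 1.\<close>

lemma energy_mollified:
  fixes \<rho> :: "'a::euclidean_space \<Rightarrow> real"
  assumes wh: "weak_heat T w F" and \<rho>: "friedrichs_mollifier \<rho>" and t: "t \<in> {0..T}"
  shows "(L2_norm (conv (w t) \<rho>))\<^sup>2 \<le> (L2_norm (w 0))\<^sup>2
      + integral {0..t} (\<lambda>s. 2 * L2_norm (F s) * L2_norm (w s))"
proof -
  have cw: "cont_L2 T w" and cF: "cont_L2 T F" using wh by (auto simp: weak_heat_def)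
  have tf: "test_function UNIV \<rho>" and nn: "\<And>x. \<rho> x \<ge> 0" and i1: "(\<integral>x. \<rho> x \<partial>lborel) = 1"
    using \<rho> by (auto simp: friedrichs_mollifier_def)
  note cc0 = Cc_test_function[OF tf] and ccl = Cc_laplacian[OF tf]
  have wL2: "w s \<in> L2" and FL2: "F s \<in> L2" if "s \<in> {0..T}" for s using cw cF that
      by (auto intro: cont_L2_L2)
  define g where "g s x = conv (w s) \<rho> x" for s x
  define k where "k s x = conv (w s) (laplacian \<rho>) x + conv (F s) \<rho> x" for s x
  \<comment> \<open>The time derivative of |g|^2 at a fixed point, written with the real inner
    product on the complex plane; after integration in space it becomes twice the real part of a
    pairing.\<close>
  define m where "m s x = 2 * (g s x \<bullet> k s x)" for s x
  have gL2: "g s \<in> L2" and gn: "L2_norm (g s) \<le> L2_norm (w s)" if "s \<in> {0..T}" for s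
    using young[OF wL2[OF that] cc0] nn i1 by (auto simp: g_def[abs_def])
  have klL2: "conv (w s) (laplacian \<rho>) \<in> L2" and kln:
      "L2_norm (conv (w s) (laplacian \<rho>)) \<le> (\<integral>y. \<bar>laplacian \<rho> y\<bar> \<partial>lborel) * L2_norm (w s)"
    if "s \<in> {0..T}" for s using young[OF wL2[OF that] ccl] by auto
  have kFL2: "conv (F s) \<rho> \<in> L2" and kFn: "L2_norm (conv (F s) \<rho>) \<le> L2_norm (F s)"
    if "s \<in> {0..T}" for s using young[OF FL2[OF that] cc0] nn i1 by auto
  have kL2: "k s \<in> L2" if "s \<in> {0..T}" for s
    unfolding k_def[abs_def] by (rule L2_add[OF klL2[OF that] kFL2[OF that]])
  have inner: "g s x \<bullet> k s x = Re (cnj (g s x) * k s x)" for s x by (simp add: inner_complex_def)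

  have gk: "g s x = g 0 x + integral {0..s} (\<lambda>s. k s x)" if s: "s \<in> {0..T}" for s x
  proof -
    \<comment> \<open>The spatial test function is the kernel centred at \<open>x\<close>. Its
      reflection changes the sign of each first derivative and hence leaves the Laplacian alone. The
      scalar multiples match the form of \<open>test_function_affine\<close>.\<close>
    define \<eta> where "\<eta> y = 1 *\<^sub>R \<rho> (x + (-1) *\<^sub>R y)" for y
    have te: "test_function UNIV \<eta>" unfolding \<eta>_def[abs_def]
        by (rule test_function_affine[OF tf]) simp
    have e: "\<eta> y = \<rho> (x - y)" for y by (simp add: \<eta>_def)
    have l: "laplacian \<eta> y = laplacian \<rho> (x - y)" for y
      unfolding laplacian_def
    proof (rule sum.cong[OF refl])
      fix b :: 'a assume b: "b \<in> Basis"
      have "dir_deriv b \<eta> = (\<lambda>y. (1 * -1) *\<^sub>R dir_deriv b \<rho> (x + (-1) *\<^sub>R y))"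
        unfolding \<eta>_def[abs_def] by (rule dir_deriv_affine_eq[OF test_function_smooth[OF tf]])
      then have "dir_deriv b (dir_deriv b \<eta>) = (\<lambda>y. (1 * -1 * -1) *\<^sub>R dir_deriv b (dir_deriv b \<rho>) (x
          + (-1) *\<^sub>R y))"
        using dir_deriv_affine_eq[OF smooth_dir_deriv[OF test_function_smooth[OF tf] b], of b
            "1 * -1" x "-1"] by simp
      then show "dir_deriv b (dir_deriv b \<eta>) y = dir_deriv b (dir_deriv b \<rho>) (x - y)" by simp
    qed
    have "(\<integral>y. w s y * complex_of_real (\<eta> y) \<partial>lborel)
        = (\<integral>y. w 0 y * complex_of_real (\<eta> y) \<partial>lborel) +
        integral {0..s} (\<lambda>s. (\<integral>y. w s y * complex_of_real (laplacian \<eta> y) \<partial>lborel) + (\<integral>y. F s y *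
            complex_of_real (\<eta> y) \<partial>lborel))"
      using wh te s unfolding weak_heat_def by blast
    then show ?thesis unfolding e l g_def k_def conv_def .
  qed

  have gjc: "continuous_on ({0..T} \<times> UNIV) (\<lambda>z. g (fst z) (snd z))"
    unfolding g_def by (rule conv_jointly_continuous[OF cw cc0])
  have kjc: "continuous_on ({0..T} \<times> UNIV) (\<lambda>z. k (fst z) (snd z))"
    unfolding k_def by (intro continuous_on_add conv_jointly_continuous[OF cw ccl]
        conv_jointly_continuous[OF cF cc0])
  have mjc: "continuous_on ({0..T} \<times> UNIV) (\<lambda>z. m (fst z) (snd z))"
    unfolding m_def by (intro continuous_intros gjc kjc)
  have slice: "continuous_on {0..T} (\<lambda>s. f s x)"
      if "continuous_on ({0..T} \<times> UNIV) (\<lambda>z. f (fst z) (snd z))"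
    for f :: "real \<Rightarrow> 'a \<Rightarrow> 'b::real_normed_vector" and x
  proof -
    have "continuous_on {0..T} (\<lambda>s. (\<lambda>z. f (fst z) (snd z)) (s, x))"
      by (rule continuous_on_compose2[OF that]) (auto intro!: continuous_intros)
    then show ?thesis by simp
  qed
  have T0: "0 \<in> {0..T}" and tT: "{0..t} \<subseteq> {0..T}" using t by auto

  have pt: "(norm (g t x))\<^sup>2 - (norm (g 0 x))\<^sup>2 = (\<integral>s. indicator {0..t} s * m s x \<partial>lborel)" for x
  proof -
    have kc: "continuous_on {0..T} (\<lambda>s. k s x)" by (rule slice[OF kjc])
    have der: "((\<lambda>s. g s x) has_vector_derivative k s x) (at s within {0..t})" if "s \<in> {0..t}" for s
    proof -
      have s: "s \<in> {0..T}" using that t by auto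
      have "((\<lambda>s. integral {0..s} (\<lambda>s. k s x)) has_vector_derivative k s x) (at s within {0..T})"
        by (rule integral_has_vector_derivative[OF kc s])
      then have "((\<lambda>s. g 0 x + integral {0..s} (\<lambda>s. k s x)) has_vector_derivative k s x) (at s
          within {0..T})"
        by (auto intro!: derivative_eq_intros)
      then have "((\<lambda>s. g s x) has_vector_derivative k s x) (at s within {0..T})"
        by (rule has_vector_derivative_transform[OF s, rotated]) (rule gk)
      then show ?thesis by (rule has_vector_derivative_within_subset[OF _ tT])
    qed
    have "((\<lambda>s. g s x \<bullet> g s x) has_vector_derivative m s x) (at s within {0..t})" if "s \<in> {0..t}"
        for s
      using bounded_bilinear.has_vector_derivative[OF bounded_bilinear_inner der[OF that] der[OF
          that]]
      by (simp add: m_def inner_commute)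
    then have "((\<lambda>s. m s x) has_integral (g t x \<bullet> g t x - g 0 x \<bullet> g 0 x)) {0..t}"
      by (intro fundamental_theorem_of_calculus) (use t in auto)
    then have "integral {0..t} (\<lambda>s. m s x) = (norm (g t x))\<^sup>2 - (norm (g 0 x))\<^sup>2"
      by (simp add: integral_unique power2_norm_eq_inner)
    moreover have "continuous_on {0..t} (\<lambda>s. m s x)"
      using slice[OF mjc] tT by (rule continuous_on_subset)
    then have "(LINT s:{0..t}|lborel. m s x) = integral {0..t} (\<lambda>s. m s x)"
      by (intro set_borel_integral_eq_integral(2) borel_integrable_atLeastAtMost')
    ultimately show ?thesis by (simp add: set_lebesgue_integral_def)
  qed

  obtain W where W: "\<And>s. s \<in> {0..T} \<Longrightarrow> L2_norm (w s) \<le> W"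
    using compact_imp_bounded[OF compact_continuous_image[OF cont_L2_norm[OF cw] compact_Icc]]
        by (force simp: bounded_iff)
  obtain P where P: "\<And>s. s \<in> {0..T} \<Longrightarrow> L2_norm (F s) \<le> P"
    using compact_imp_bounded[OF compact_continuous_image[OF cont_L2_norm[OF cF] compact_Icc]]
        by (force simp: bounded_iff)
  have W0: "W \<ge> 0" using W[OF T0] L2_norm_nonneg[of "w 0"] by linarith
  \<comment> \<open>This constant depends on the kernel and may blow up as the mollification is
    removed. It only enters the domination for Fubini and is absent from the final estimate.\<close>
  define A where "A = (\<integral>y. \<bar>laplacian \<rho> y\<bar> \<partial>lborel)"
  have A0: "A \<ge> 0" by (simp add: A_def)
  have kn: "L2_norm (k s) \<le> A * W + P" if s: "s \<in> {0..T}" for s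
  proof -
    have "L2_norm (k s) \<le> L2_norm (conv (w s) (laplacian \<rho>)) + L2_norm (conv (F s) \<rho>)"
      unfolding k_def[abs_def] by (rule L2_norm_add[OF klL2[OF s] kFL2[OF s]])
    also have "\<dots> \<le> A * L2_norm (w s) + L2_norm (F s)" using kln[OF s] kFn[OF s] by (simp add: A_def)
    also have "\<dots> \<le> A * W + P" using W[OF s] P[OF s] A0 by (intro add_mono mult_left_mono) auto
    finally show ?thesis .
  qed
  have mi: "integrable lborel (m s)" if s: "s \<in> {0..T}" for s
    unfolding m_def[abs_def] inner using L2_mult_integrable[OF L2_cnj[OF gL2[OF s]] kL2[OF s]]
        by (intro integrable_mult_right integrable_Re)
  have mabs: "(\<integral>x. \<bar>m s x\<bar> \<partial>lborel) \<le> 2 * W * (A * W + P)" if s: "s \<in> {0..T}" for s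
  proof -
    have "(\<integral>x. \<bar>m s x\<bar> \<partial>lborel) \<le> (\<integral>x. 2 * norm (cnj (g s x) * k s x) \<partial>lborel)"
    proof (rule integral_mono)
      show "integrable lborel (\<lambda>x. \<bar>m s x\<bar>)" using mi[OF s] by simp
      show "integrable lborel (\<lambda>x. 2 * norm (cnj (g s x) * k s x))"
        using L2_mult_integrable[OF L2_cnj[OF gL2[OF s]] kL2[OF s]]
            by (intro integrable_mult_right integrable_norm)
      show "\<bar>m s x\<bar> \<le> 2 * norm (cnj (g s x) * k s x)" for x
        using abs_Re_le_cmod[of "cnj (g s x) * k s x"] by (simp only: m_def inner abs_mult)
    qed
    also have "\<dots> \<le> 2 * (L2_norm (g s) * L2_norm (k s))"
      using L2_cauchy_schwarz_norm[OF L2_cnj[OF gL2[OF s]] kL2[OF s]] by simp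
    also have "\<dots> \<le> 2 * (W * (A * W + P))"
      using gn[OF s] W[OF s] kn[OF s] L2_norm_nonneg[of "g s"] L2_norm_nonneg[of "k s"]
      by (intro mult_left_mono mult_mono) (auto simp: W0)
    finally show ?thesis by simp
  qed
  \<comment> \<open>The Laplacian is split into directions because \<open>dissipation\<close>
    handles one second derivative at a time; each contributes a non-positive amount. What remains is
    the pairing with \<open>F\<close>.\<close>
  have mneg: "(\<integral>x. m s x \<partial>lborel) \<le> 2 * L2_norm (F s) * L2_norm (w s)" if s: "s \<in> {0..T}" for s
  proof -
    let ?G = "\<lambda>f. (\<integral>x. cnj (g s x) * f x \<partial>lborel)"
    note cg = L2_cnj[OF gL2[OF s]]
    have ccb: "Cc (dir_deriv b (dir_deriv b \<rho>))" if "b \<in> Basis" for b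
      by (rule Cc_test_function[OF test_function_dir_deriv[OF test_function_dir_deriv[OF tf that]
          that]])
    have "conv (w s) (laplacian \<rho>) x = (\<Sum>b\<in>Basis. conv (w s) (dir_deriv b (dir_deriv b \<rho>)) x)" for x
      unfolding laplacian_def[abs_def] by (rule conv_sum_right[OF _ _ wL2[OF s]]) (auto intro: ccb)
    then have "?G (conv (w s) (laplacian \<rho>)) = (\<Sum>b\<in>Basis. ?G (conv (w s) (dir_deriv b (dir_deriv b
        \<rho>))))"
      using L2_mult_integrable[OF cg young(1)[OF wL2[OF s] ccb]]
          by (simp add: sum_distrib_left Bochner_Integration.integral_sum)
    then have neg: "Re (?G (conv (w s) (laplacian \<rho>))) \<le> 0"
      using dissipation[OF wL2[OF s] tf] by (simp add: g_def sum_nonpos)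
    have "Re (?G (conv (F s) \<rho>)) \<le> norm (?G (conv (F s) \<rho>))" by (rule complex_Re_le_cmod)
    also have "\<dots> \<le> L2_norm (g s) * L2_norm (conv (F s) \<rho>)" using L2_cauchy_schwarz[OF cg kFL2[OF s]]
        by simp
    also have "\<dots> \<le> L2_norm (w s) * L2_norm (F s)" by (intro mult_mono gn kFn s) auto
    finally have le: "Re (?G (conv (F s) \<rho>)) \<le> L2_norm (w s) * L2_norm (F s)" .
    have "(\<integral>x. m s x \<partial>lborel) = 2 * Re (?G (k s))"
      unfolding m_def inner using L2_mult_integrable[OF cg kL2[OF s]]
      by (simp only: integral_mult_right_zero integral_Re)
    also have "?G (k s) = ?G (conv (w s) (laplacian \<rho>)) + ?G (conv (F s) \<rho>)"
      unfolding k_def using L2_mult_integrable[OF cg klL2[OF s]] L2_mult_integrable[OF cg kFL2[OF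
          s]] by (simp add: distrib_left)
    finally show ?thesis using neg le by (simp add: mult_ac)
  qed

  define f where "f s x = indicator {0..t} s * m s x" for s x
  \<comment> \<open>Joint continuity on the closed slab [0,t] x R^d makes the truncated integrand
    Borel measurable in both variables together.\<close>
  have fmeas: "case_prod f \<in> borel_measurable (lborel \<Otimes>\<^sub>M lborel)"
  proof -
    have "(\<lambda>z. indicator ({0..t} \<times> (UNIV :: 'a set)) z *\<^sub>R m (fst z) (snd z)) \<in> borel_measurable
        borel"
    proof (rule borel_measurable_continuous_on_indicator)
      show "{0..t} \<times> (UNIV :: 'a set) \<in> sets borel" by (intro borel_closed closed_Times) auto
      show "continuous_on ({0..t} \<times> UNIV) (\<lambda>z. m (fst z) (snd z))"
        by (rule continuous_on_subset[OF mjc]) (use tT in auto)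
    qed
    moreover have "(\<lambda>z. indicator ({0..t} \<times> (UNIV :: 'a set)) z *\<^sub>R m (fst z) (snd z))
        = case_prod f"
      by (auto simp: f_def indicator_def)
    ultimately show ?thesis by (simp add: lborel_prod)
  qed
  have fint: "integrable (lborel \<Otimes>\<^sub>M lborel) (case_prod f)"
  proof (rule lborel_pair.Fubini_integrable[OF fmeas])
    have [measurable]: "case_prod f \<in> borel_measurable (lborel \<Otimes>\<^sub>M lborel)" by (rule fmeas)
    show "integrable lborel (\<lambda>s. \<integral>x. norm (case_prod f (s, x)) \<partial>lborel)"
    proof (rule Bochner_Integration.integrable_bound[where
        f="\<lambda>s. (2 * W * (A * W + P)) * indicator {0..t} s"])
      show "integrable lborel (\<lambda>s. (2 * W * (A * W + P)) * indicator {0..t} s)"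
        by (intro integrable_mult_right integrable_real_indicator) (auto simp:
            emeasure_lborel_Icc_eq)
      show "(\<lambda>s. \<integral>x. norm (case_prod f (s, x)) \<partial>lborel) \<in> borel_measurable lborel" by measurable
      show "AE s in lborel. norm (\<integral>x. norm (case_prod f (s, x)) \<partial>lborel) \<le> norm ((2 * W * (A * W
          + P)) * indicator {0..t} s)"
      proof (rule AE_I2)
        fix s
        show "norm (\<integral>x. norm (case_prod f (s, x)) \<partial>lborel) \<le> norm ((2 * W * (A * W
            + P)) * indicator {0..t} s)"
        proof (cases "s \<in> {0..t}")
          case True
          then have "s \<in> {0..T}" using tT by auto
          from mabs[OF this] show ?thesis using True by (simp add: f_def)
        qed (simp add: f_def)
      qed
    qed
    show "AE s in lborel. integrable lborel (\<lambda>x. case_prod f (s, x))"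
    proof (rule AE_I2)
      fix s
      show "integrable lborel (\<lambda>x. case_prod f (s, x))"
        using mi[of s] tT by (cases "s \<in> {0..t}") (auto simp: f_def)
    qed
  qed
  have "(L2_norm (g t))\<^sup>2 - (L2_norm (g 0))\<^sup>2 = (\<integral>x. (norm (g t x))\<^sup>2 - (norm (g 0 x))\<^sup>2 \<partial>lborel)"
    using L2_integrable[OF gL2[OF t]] L2_integrable[OF gL2[OF T0]] by (simp add: L2_norm_sq)
  also have "\<dots> = (\<integral>x. (\<integral>s. f s x \<partial>lborel) \<partial>lborel)" unfolding pt f_def ..
  also have "\<dots> = (\<integral>s. (\<integral>x. f s x \<partial>lborel) \<partial>lborel)" by (rule lborel_pair.Fubini_integral[OF fint])
  also have "\<dots> \<le> (\<integral>s. indicator {0..t} s *\<^sub>R (2 * L2_norm (F s) * L2_norm (w s)) \<partial>lborel)"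
  proof (rule integral_mono)
    show "integrable lborel (\<lambda>s. \<integral>x. f s x \<partial>lborel)" using lborel_pair.integrable_fst[OF fint] .
    show "integrable lborel (\<lambda>s. indicator {0..t} s *\<^sub>R (2 * L2_norm (F s) * L2_norm (w s)))"
      by (intro borel_integrable_compact continuous_intros continuous_on_subset[OF cont_L2_norm[OF
          cF] tT] continuous_on_subset[OF cont_L2_norm[OF cw] tT]) simp
    fix s
    show "(\<integral>x. f s x \<partial>lborel) \<le> indicator {0..t} s *\<^sub>R (2 * L2_norm (F s) * L2_norm (w s))"
      using mneg[of s] tT by (cases "s \<in> {0..t}") (auto simp: f_def)
  qed
  also have "\<dots> = integral {0..t} (\<lambda>s. 2 * L2_norm (F s) * L2_norm (w s))"
  proof -
    have "continuous_on {0..t} (\<lambda>s. 2 * L2_norm (F s) * L2_norm (w s))"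
      by (intro continuous_intros continuous_on_subset[OF cont_L2_norm[OF cF] tT]
          continuous_on_subset[OF cont_L2_norm[OF cw] tT])
    from set_borel_integral_eq_integral(2)[OF borel_integrable_atLeastAtMost'[OF this]]
    show ?thesis by (simp add: set_lebesgue_integral_def)
  qed
  finally have "(L2_norm (g t))\<^sup>2 \<le> (L2_norm (g 0))\<^sup>2
      + integral {0..t} (\<lambda>s. 2 * L2_norm (F s) * L2_norm (w s))" by simp
  moreover have "(L2_norm (g 0))\<^sup>2 \<le> (L2_norm (w 0))\<^sup>2" using gn[OF T0] by (intro power_mono) auto
  ultimately show ?thesis unfolding g_def[abs_def] by linarith
qed

text \<open>The bound of \<open>energy_mollified\<close> is the same for all scales of the
  mollifier, so \<open>mollified_norm_limit\<close> transfers it to \<open>w\<close> itself.\<close>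

lemma energy_inequality:
  fixes \<psi> :: "'a::euclidean_space \<Rightarrow> real" and w F :: "real \<Rightarrow> 'a \<Rightarrow> complex"
  assumes wh: "weak_heat T w F" and \<psi>: "friedrichs_mollifier \<psi>" and t: "t \<in> {0..T}"
  shows "(L2_norm (w t))\<^sup>2 \<le> (L2_norm (w 0))\<^sup>2 + integral {0..t} (\<lambda>s. 2 * L2_norm (F s) * L2_norm (w
      s))"
proof -
  let ?R = "(L2_norm (w 0))\<^sup>2 + integral {0..t} (\<lambda>s. 2 * L2_norm (F s) * L2_norm (w s))"
  have e: "(L2_norm (conv (w t) (rescale r \<psi>)))\<^sup>2 \<le> ?R" if "r > 0" for r
    by (rule energy_mollified[OF wh rescale_mollifier[OF \<psi> that] t])
  \<comment> \<open>Non-negativity, needed to take the square root, is read off from the estimate at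
    scale 1.\<close>
  have R0: "?R \<ge> 0" using e[of 1] zero_le_power2[of "L2_norm (conv (w t) (rescale 1 \<psi>))"]
      by linarith
  have wt: "w t \<in> L2" using wh t by (auto simp: weak_heat_def intro: cont_L2_L2)
  have "L2_norm (w t) \<le> sqrt ?R"
  proof (rule mollified_norm_limit[OF wt \<psi>])
    show "L2_norm (conv (w t) (rescale r \<psi>)) \<le> sqrt ?R" if "r > 0" for r
      using e[OF that] by (rule real_le_rsqrt)
  qed (use R0 in simp)
  then have "(L2_norm (w t))\<^sup>2 \<le> (sqrt ?R)\<^sup>2" by (intro power_mono) auto
  then show ?thesis using R0 by simp
qed

text \<open>The right-hand side \<open>Z\<close> satisfies Z' = B y \<le> B Z, so
  \<open>Z s * exp (- B * s)\<close> cannot increase; the mean value theorem compares its values at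
  0 and \<open>t\<close>.\<close>

lemma gronwall:
  fixes y :: "real \<Rightarrow> real"
  assumes y: "continuous_on {0..T} y" and le: "\<And>t. t \<in> {0..T} \<Longrightarrow> y t \<le> A + B * integral {0..t} y"
    and B: "B \<ge> 0" and t: "t \<in> {0..T}"
  shows "y t \<le> A * exp (B * t)"
proof -
  define Z where "Z s = A + B * integral {0..s} y" for s
  have Z: "(Z has_real_derivative B * y s) (at s within {0..T})" if "s \<in> {0..T}" for s
    unfolding Z_def by (auto intro!: derivative_eq_intros integral_has_real_derivative[OF y that])
  have D: "((\<lambda>s. Z s * exp (- B * s)) has_real_derivative (B * y s
      - B * Z s) * exp (- B * s)) (at s within {0..T})" if "s \<in> {0..T}" for s
    by (rule derivative_eq_intros Z[OF that] refl | simp add: algebra_simps)+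
  have "\<exists>x\<in>{0..t}. Z t * exp (- B * t) - Z 0 * exp (- B * 0) = ((B * y x
      - B * Z x) * exp (- B * x)) * (t - 0)"
  proof (rule mvt_very_simple)
    show "((\<lambda>s. Z s * exp (- B * s)) has_derivative (*) ((B * y x
        - B * Z x) * exp (- B * x))) (at x within {0..t})"
      if "0 \<le> x" "x \<le> t" for x
      using DERIV_subset[OF D[of x], of "{0..t}"] that t by (auto simp: has_field_derivative_def)
  qed (use t in auto)
  then obtain x where x: "x \<in> {0..t}"
    "Z t * exp (- B * t) - Z 0 * exp (- B * 0) = ((B * y x - B * Z x) * exp (- B * x)) * (t - 0)"
        by blast
  have "B * y x \<le> B * Z x" using le[of x] B x(1) t by (intro mult_left_mono) (auto simp: Z_def)
  then have "((B * y x - B * Z x) * exp (- B * x)) * (t - 0) \<le> 0"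
    using t by (intro mult_nonpos_nonneg) auto
  then have "Z t * exp (- B * t) \<le> Z 0 * exp (- B * 0)" using x(2) by linarith
  then have "Z t * exp (- B * t) \<le> A" by (simp add: Z_def)
  then have "Z t \<le> A * exp (B * t)" by (simp add: exp_minus field_simps)
  then show ?thesis using le[OF t] by (simp add: Z_def)
qed

text \<open>Gronwall's lemma is applied to the squared norm. The constant \<open>M\<close> absorbs a
  potential, while \<open>m\<close> is an external forcing.\<close>

lemma weak_heat_bound:
  fixes \<psi> :: "'a::euclidean_space \<Rightarrow> real" and w F :: "real \<Rightarrow> 'a \<Rightarrow> complex"
  assumes wh: "weak_heat T w F" and \<psi>: "friedrichs_mollifier \<psi>" and M: "M \<ge> 0" and m: "m \<ge> 0"
    and F: "\<And>s. s \<in> {0..T} \<Longrightarrow> L2_norm (F s) \<le> M * L2_norm (w s) + m" and t: "t \<in> {0..T}"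
  shows "L2_norm (w t) \<le> (L2_norm (w 0) + sqrt T * m) * exp ((M + 1) * T)"
proof -
  have cw: "cont_L2 T w" and cF: "cont_L2 T F" using wh by (auto simp: weak_heat_def)
  have T: "T \<ge> 0" using t by auto
  define y where "y s = (L2_norm (w s))\<^sup>2" for s
  have yc: "continuous_on {0..T} y" unfolding y_def by (intro continuous_intros cont_L2_norm[OF cw])
  have yle: "y s \<le> (y 0 + T * m\<^sup>2) + (2 * M + 1) * integral {0..s} y" if s: "s \<in> {0..T}" for s
  proof -
    have sub: "{0..s} \<subseteq> {0..T}" using s by auto
    have iy: "y integrable_on {0..s}"
        by (rule integrable_continuous_real[OF continuous_on_subset[OF yc sub]])
    have "y s \<le> y 0 + integral {0..s} (\<lambda>s. 2 * L2_norm (F s) * L2_norm (w s))"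
      unfolding y_def by (rule energy_inequality[OF wh \<psi> s])
    also have "integral {0..s} (\<lambda>s. 2 * L2_norm (F s) * L2_norm (w s)) \<le> integral {0..s} (\<lambda>r. (2 * M
        + 1) * y r + m\<^sup>2)"
    proof (rule integral_le)
      show "(\<lambda>s. 2 * L2_norm (F s) * L2_norm (w s)) integrable_on {0..s}"
        by (intro integrable_continuous_real continuous_intros continuous_on_subset[OF
            cont_L2_norm[OF cF] sub] continuous_on_subset[OF cont_L2_norm[OF cw] sub])
      show "(\<lambda>r. (2 * M + 1) * y r + m\<^sup>2) integrable_on {0..s}"
        by (intro integrable_continuous_real continuous_intros continuous_on_subset[OF yc sub])
      fix r assume "r \<in> {0..s}"
      then have r: "r \<in> {0..T}" using sub by auto
      have "2 * L2_norm (F r) * L2_norm (w r) \<le> 2 * (M * L2_norm (w r) + m) * L2_norm (w r)"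
        using F[OF r] by (intro mult_right_mono mult_left_mono) auto
      also have "\<dots> = 2 * M * (L2_norm (w r))\<^sup>2 + 2 * m * L2_norm (w r)"
          by (simp add: power2_eq_square algebra_simps)
      \<comment> \<open>The mixed term 2 m |w| is split into m^2 + |w|^2; this is the origin of the
        extra 1 next to 2 M.\<close>
      also have "\<dots> \<le> (2 * M + 1) * (L2_norm (w r))\<^sup>2 + m\<^sup>2"
        using sum_squares_bound[of m "L2_norm (w r)"] by (simp add: algebra_simps)
      finally show "2 * L2_norm (F r) * L2_norm (w r) \<le> (2 * M + 1) * y r + m\<^sup>2"
          by (simp add: y_def)
    qed
    also have "integral {0..s} (\<lambda>r. (2 * M + 1) * y r + m\<^sup>2) = (2 * M + 1) * integral {0..s} y
        + s * m\<^sup>2"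
    proof -
      have "integral {0..s} (\<lambda>r. (2 * M + 1) * y r + m\<^sup>2) = integral {0..s} (\<lambda>r. (2 * M + 1) * y r)
          + integral {0..s} (\<lambda>r. m\<^sup>2)"
        by (rule Henstock_Kurzweil_Integration.integral_add[OF integrable_on_mult_right[OF iy]
            integrable_const_ivl])
      then show ?thesis using s by simp
    qed
    also have "s * m\<^sup>2 \<le> T * m\<^sup>2" using s by (intro mult_right_mono) auto
    finally show ?thesis by simp
  qed
  have "y t \<le> (y 0 + T * m\<^sup>2) * exp ((2 * M + 1) * t)"
    by (rule gronwall[OF yc yle _ t]) (use M in auto)
  also have "\<dots> \<le> (L2_norm (w 0) + sqrt T * m)\<^sup>2 * exp (2 * ((M + 1) * T))"
  proof (rule mult_mono)
    show "y 0 + T * m\<^sup>2 \<le> (L2_norm (w 0) + sqrt T * m)\<^sup>2"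
      using T m by (simp add: y_def power2_sum power_mult_distrib)
    \<comment> \<open>Rounding 2 M + 1 up to 2 M + 2 makes the exponential a perfect square, so that
      the root can be taken.\<close>
    have "(2 * M + 1) * t \<le> (2 * M + 2) * T" using M t by (intro mult_mono) auto
    then show "exp ((2 * M + 1) * t) \<le> exp (2 * ((M + 1) * T))" by (simp add: algebra_simps)
  qed auto
  also have "\<dots> = ((L2_norm (w 0) + sqrt T * m) * exp ((M + 1) * T))\<^sup>2"
    by (simp only: power_mult_distrib exp_double)
  finally show ?thesis unfolding y_def
    by (rule power2_le_imp_le) (use T m in \<open>auto intro!: mult_nonneg_nonneg add_nonneg_nonneg\<close>)
qed

text \<open>\<open>weak_heat_bound\<close> is used twice: on \<open>u'\<close> alone, and on the
  difference, whose forcing is \<open>d\<close> times the bound just found. Hence two exponentials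
  multiply the difference of the potentials, but only one multiplies that of the initial
  data.\<close>

lemma heat_solution_difference:
  fixes \<psi> :: "'a::euclidean_space \<Rightarrow> real" and p p' v v' :: "'a \<Rightarrow> complex"
  assumes T: "T > 0" and \<psi>: "friedrichs_mollifier \<psi>" and M: "M \<ge> 0" and d: "d \<ge> 0"
    and p: "p \<in> borel_measurable lborel" "AE x in lborel. norm (p x) \<le> M"
    and p': "p' \<in> borel_measurable lborel" "AE x in lborel. norm (p' x) \<le> M"
    and pd: "AE x in lborel. norm (p x - p' x) \<le> d"
    and v: "v \<in> L2" "v' \<in> L2"
    and u: "heat_solution T p v u" and u': "heat_solution T p' v' u'" and t: "t \<in> {0..T}"
  shows "L2_norm (\<lambda>x. u t x - u' t x) \<le>
    (L2_norm (\<lambda>x. v x - v' x) + sqrt T * (d * (L2_norm v' * exp ((M + 1) * T)))) * exp ((M + 1) *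
        T)"
proof -
  obtain r :: "real \<Rightarrow> real" where r: "friedrichs_mollifier r" using mollifier_real_exists[OF \<psi>]
      by blast
  note wu = heat_solution_weak_heat[OF u p M T r] and wu' = heat_solution_weak_heat[OF u' p' M T r]
  have cu: "cont_L2 T u" and cu': "cont_L2 T u'" using u u' by (auto simp: heat_solution_def)
  have z: "0 \<in> {0..T}" using T by auto
  have ini: "L2_norm (u' 0) = L2_norm v'"
    using u' v(2) cont_L2_L2[OF cu' z]
        by (intro L2_norm_cong_AE L2_D) (auto simp: heat_solution_def)
  have inid: "L2_norm (\<lambda>x. u 0 x - u' 0 x) = L2_norm (\<lambda>x. v x - v' x)"
  proof (intro L2_norm_cong_AE L2_D)
    have "AE x in lborel. u 0 x = v x" "AE x in lborel. u' 0 x = v' x" using u u'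
        by (auto simp: heat_solution_def)
    then show "AE x in lborel. u 0 x - u' 0 x = v x - v' x" by eventually_elim simp
  qed (use v cont_L2_L2[OF cu' z] cont_L2_L2[OF cu z] in \<open>auto intro: L2_diff\<close>)
  have bu': "L2_norm (u' s) \<le> L2_norm v' * exp ((M + 1) * T)" if s: "s \<in> {0..T}" for s
  proof -
    have "L2_norm (u' s) \<le> (L2_norm (u' 0) + sqrt T * 0) * exp ((M + 1) * T)"
    proof (rule weak_heat_bound[OF wu' \<psi> M _ _ s])
      show "L2_norm (\<lambda>x. p' x * u' a x) \<le> M * L2_norm (u' a) + 0" if "a \<in> {0..T}" for a
        using bounded_mult_L2_norm[OF cont_L2_L2[OF cu' that] p' M] by simp
    qed simp
    then show ?thesis by (simp add: ini)
  qed
  have "L2_norm (\<lambda>x. u t x - u' t x) \<le> (L2_norm (\<lambda>x. u 0 x - u' 0 x)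
      + sqrt T * (d * (L2_norm v' * exp ((M + 1) * T)))) * exp ((M + 1) * T)"
  proof (rule weak_heat_bound[OF weak_heat_diff[OF wu wu'] \<psi> M _ _ t])
    fix s assume s: "s \<in> {0..T}"
    note us = cont_L2_L2[OF cu s] and us' = cont_L2_L2[OF cu' s]
    have pm: "(\<lambda>x. p x - p' x) \<in> borel_measurable lborel" using p p' by simp
    \<comment> \<open>The difference of the products is arranged so that the first potential acts on
      the difference of the solutions; that part is absorbed by \<open>M\<close>, and the rest is
      forcing.\<close>
    have "(\<lambda>x. p x * u s x - p' x * u' s x) = (\<lambda>x. p x * (u s x - u' s x) + (p x - p' x) * u' s x)"
      by (auto simp: algebra_simps)
    then have "L2_norm (\<lambda>x. p x * u s x - p' x * u' s x) = L2_norm (\<lambda>x. p x * (u s x - u' s x)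
        + (p x - p' x) * u' s x)" by simp
    also have "\<dots> \<le> L2_norm (\<lambda>x. p x * (u s x - u' s x)) + L2_norm (\<lambda>x. (p x - p' x) * u' s x)"
      by (rule L2_norm_add[OF bounded_mult_L2[OF L2_diff[OF us us'] p] bounded_mult_L2[OF us' pm
          pd]])
    also have "\<dots> \<le> M * L2_norm (\<lambda>x. u s x - u' s x) + d * L2_norm (u' s)"
      by (intro add_mono bounded_mult_L2_norm[OF L2_diff[OF us us'] p M] bounded_mult_L2_norm[OF us'
          pm pd d])
    also have "\<dots> \<le> M * L2_norm (\<lambda>x. u s x - u' s x) + d * (L2_norm v' * exp ((M + 1) * T))"
      by (intro add_left_mono mult_left_mono bu' s d)
    finally show "L2_norm (\<lambda>x. p x * u s x - p' x * u' s x) \<le> M * L2_norm (\<lambda>x. u s x - u' s x)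
        + d * (L2_norm v' * exp ((M + 1) * T))" .
  qed (use d in simp)
  then show ?thesis unfolding inid .
qed

text \<open>The essential supremum of a non-measurable function is infinite, so that a finite bound also
  yields measurability.\<close>

lemma Linf_norm_le_imp:
  assumes "Linf_norm f \<le> ereal C"
  shows "(\<lambda>x. norm (f x)) \<in> borel_measurable lborel" "AE x in lborel. norm (f x) \<le> C"
proof -
  have "(\<lambda>x. ereal (norm (f x))) \<in> borel_measurable lborel"
    using assms esssup_non_measurable[of "\<lambda>x. ereal (norm (f x))" lborel]
    by (fastforce simp: Linf_norm_def top_ereal_def)
  then show "(\<lambda>x. norm (f x)) \<in> borel_measurable lborel" by simp
  have "AE x in lborel. ereal (norm (f x)) \<le> Linf_norm f" unfolding Linf_norm_def
      by (rule esssup_AE)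
  then show "AE x in lborel. norm (f x) \<le> C"
    by eventually_elim (use assms in \<open>metis ereal_less_eq(3) order_trans\<close>)
qed

text \<open>A finite essential supremum gives measurability of the modulus only. A function with
  values in the non-negative reals coincides with its modulus.\<close>

lemma nonneg_measurable:
  assumes "\<And>x. f x \<in> \<real>\<^sub>\<ge>\<^sub>0" "(\<lambda>x. norm (f x)) \<in> borel_measurable lborel"
  shows "(f :: 'a::euclidean_space \<Rightarrow> complex) \<in> borel_measurable lborel"
proof -
  have "f x = complex_of_real (norm (f x))" for x
    using assms(1)[of x] by (auto simp: nonneg_Reals_def)
  then have "f = (\<lambda>x. complex_of_real (norm (f x)))" by blast
  moreover have "(\<lambda>x. complex_of_real (norm (f x))) \<in> borel_measurable lborel"
    using assms(2) by simp
  ultimately show ?thesis by metis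
qed

section \<open>Choice of the scale and absorption of the losses\<close>

theorem theorem3p4:
  fixes T :: real and N0 N1 :: nat
  assumes "T > 0"
  shows "\<exists>\<omega>::real \<Rightarrow> real.
    (\<forall>\<epsilon>\<in>{0<..1}. \<omega> \<epsilon> \<in> {0<..1}) \<and> (\<omega> \<longlongrightarrow> 0) (at_right 0) \<and>
    (\<forall>(q :: ('a::euclidean_space \<Rightarrow> complex) \<Rightarrow> complex) (u0 :: ('a \<Rightarrow> complex) \<Rightarrow> complex)
      (\<psi> :: 'a \<Rightarrow> real) (\<psi>' :: 'a \<Rightarrow> real) (C0::real) (C1::real)
      (u :: real \<Rightarrow> real \<Rightarrow> 'a \<Rightarrow> complex) (u' :: real \<Rightarrow> real \<Rightarrow> 'a \<Rightarrow> complex).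
      is_distribution q \<longrightarrow> is_distribution u0 \<longrightarrow>
      friedrichs_mollifier \<psi> \<longrightarrow> friedrichs_mollifier \<psi>' \<longrightarrow>
      (\<forall>\<epsilon>\<in>{0<..1}. \<forall>x. regularise \<omega> \<psi> q \<epsilon> x \<in> \<real>\<^sub>\<ge>\<^sub>0 \<and> regularise \<omega> \<psi>' q \<epsilon> x \<in> \<real>\<^sub>\<ge>\<^sub>0) \<longrightarrow>
      C0 > 0 \<longrightarrow> C1 > 0 \<longrightarrow>
      (\<forall>\<epsilon>\<in>{0<..1}.
         Linf_norm (regularise \<omega> \<psi> q \<epsilon>) \<le> ereal (C0 * \<omega> \<epsilon> powr (- real N0)) \<and>
         Linf_norm (regularise \<omega> \<psi>' q \<epsilon>) \<le> ereal (C0 * \<omega> \<epsilon> powr (- real N0))) \<longrightarrow>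
      (\<forall>\<epsilon>\<in>{0<..1}.
         regularise \<omega> \<psi> u0 \<epsilon> \<in> L2 \<and>
         L2_norm (regularise \<omega> \<psi> u0 \<epsilon>) \<le> C1 * \<omega> \<epsilon> powr (- real N1) \<and>
         regularise \<omega> \<psi>' u0 \<epsilon> \<in> L2 \<and>
         L2_norm (regularise \<omega> \<psi>' u0 \<epsilon>) \<le> C1 * \<omega> \<epsilon> powr (- real N1)) \<longrightarrow>
      (\<forall>k::real. k > 0 \<longrightarrow> (\<exists>C>0. \<forall>\<epsilon>\<in>{0<..1}.
         Linf_norm (\<lambda>x. regularise \<omega> \<psi> q \<epsilon> x - regularise \<omega> \<psi>' q \<epsilon> x)
           \<le> ereal (C * \<epsilon> powr k))) \<longrightarrow>
      (\<forall>l::real. l > 0 \<longrightarrow> (\<exists>C>0. \<forall>\<epsilon>\<in>{0<..1}.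
         L2_norm (\<lambda>x. regularise \<omega> \<psi> u0 \<epsilon> x - regularise \<omega> \<psi>' u0 \<epsilon> x)
           \<le> C * \<epsilon> powr l)) \<longrightarrow>
      (\<forall>\<epsilon>\<in>{0<..1}.
         heat_solution T (regularise \<omega> \<psi> q \<epsilon>) (regularise \<omega> \<psi> u0 \<epsilon>) (u \<epsilon>) \<and>
         heat_solution T (regularise \<omega> \<psi>' q \<epsilon>) (regularise \<omega> \<psi>' u0 \<epsilon>) (u' \<epsilon>)) \<longrightarrow>
      (\<forall>N::real. N > 0 \<longrightarrow> (\<exists>C>0. \<forall>t\<in>{0..T}. \<forall>\<epsilon>\<in>{0<..1}.
         L2_norm (\<lambda>x. u \<epsilon> t x - u' \<epsilon> t x) \<le> C * \<epsilon> powr N)))"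
proof -
  \<comment> \<open>The summand 1 keeps \<open>lg \<epsilon>\<close> at least 1 on the whole of
    (0,1], including \<epsilon> = 1, so its negative powers stay in (0,1].\<close>
  define lg where "lg \<epsilon> = 1 - ln \<epsilon>" for \<epsilon> :: real
  \<comment> \<open>One exponent handles both bounds, since \<open>N0\<close> and \<open>N1\<close>
    are each at most their sum. The extra 1 in the denominator keeps the exponent meaningful, and
    \<open>\<omega>\<close> tending to 0, when both are zero.\<close>
  define \<omega> where "\<omega> \<epsilon> = lg \<epsilon> powr (- (1 / real (N0 + N1 + 1)))" for \<epsilon> :: real
  have lg1: "lg \<epsilon> \<ge> 1" if "\<epsilon> \<in> {0<..1}" for \<epsilon> :: real using that by (simp add: lg_def)
  have \<omega>01: "\<omega> \<epsilon> \<in> {0<..1}" if e: "\<epsilon> \<in> {0<..1}" for \<epsilon> :: real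
  proof -
    have "lg \<epsilon> powr (- (1 / real (N0 + N1 + 1))) \<le> lg \<epsilon> powr 0"
      using lg1[OF e] by (intro powr_mono) auto
    then show ?thesis using lg1[OF e] by (simp add: \<omega>_def)
  qed
  have \<omega>lim: "(\<omega> \<longlongrightarrow> 0) (at_right 0)"
  proof -
    have "filterlim (\<lambda>\<epsilon>::real. - ln \<epsilon>) at_top (at_right 0)"
      using ln_at_0 by (simp add: filterlim_uminus_at_bot)
    then have "filterlim (\<lambda>\<epsilon>::real. 1 + (- ln \<epsilon>)) at_top (at_right 0)"
      by (rule filterlim_tendsto_add_at_top[OF tendsto_const])
    then have "filterlim lg at_top (at_right 0)" by (simp add: lg_def[abs_def])
    then show ?thesis unfolding \<omega>_def[abs_def] by (intro tendsto_neg_powr) auto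
  qed
  have \<omega>pow: "\<omega> \<epsilon> powr (- real n) \<le> lg \<epsilon>" if e: "\<epsilon> \<in> {0<..1}" and n: "n \<le> N0 + N1"
      for \<epsilon> :: real and n
  proof -
    have "\<omega> \<epsilon> powr (- real n) = lg \<epsilon> powr (real n / real (N0 + N1 + 1))"
      by (simp add: \<omega>_def powr_powr)
    also have "\<dots> \<le> lg \<epsilon> powr 1"
      using lg1[OF e] n by (intro powr_mono) auto
    finally show ?thesis using lg1[OF e] by simp
  qed
  have main: "\<exists>C>0. \<forall>t\<in>{0..T}. \<forall>\<epsilon>\<in>{0<..1}. L2_norm (\<lambda>x. u \<epsilon> t x - u' \<epsilon> t x) \<le> C * \<epsilon> powr N"
    if moll: "friedrichs_mollifier \<psi>"
      and nonneg: "\<forall>\<epsilon>\<in>{0<..1}. \<forall>x. regularise \<omega> \<psi> q \<epsilon> x \<in> \<real>\<^sub>\<ge>\<^sub>0 \<and> regularise \<omega> \<psi>' q \<epsilon> x \<in> \<real>\<^sub>\<ge>\<^sub>0"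
      and C0: "C0 > 0" and C1: "C1 > 0"
      and qb: "\<forall>\<epsilon>\<in>{0<..1}. Linf_norm (regularise \<omega> \<psi> q \<epsilon>) \<le> ereal (C0 * \<omega> \<epsilon> powr (- real N0)) \<and>
         Linf_norm (regularise \<omega> \<psi>' q \<epsilon>) \<le> ereal (C0 * \<omega> \<epsilon> powr (- real N0))"
      and ub: "\<forall>\<epsilon>\<in>{0<..1}. regularise \<omega> \<psi> u0 \<epsilon> \<in> L2 \<and>
         L2_norm (regularise \<omega> \<psi> u0 \<epsilon>) \<le> C1 * \<omega> \<epsilon> powr (- real N1) \<and>
         regularise \<omega> \<psi>' u0 \<epsilon> \<in> L2 \<and>
         L2_norm (regularise \<omega> \<psi>' u0 \<epsilon>) \<le> C1 * \<omega> \<epsilon> powr (- real N1)"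
      and qd: "\<forall>k::real. k > 0 \<longrightarrow> (\<exists>C>0. \<forall>\<epsilon>\<in>{0<..1}.
         Linf_norm (\<lambda>x. regularise \<omega> \<psi> q \<epsilon> x - regularise \<omega> \<psi>' q \<epsilon> x) \<le> ereal (C * \<epsilon> powr k))"
      and ud: "\<forall>l::real. l > 0 \<longrightarrow> (\<exists>C>0. \<forall>\<epsilon>\<in>{0<..1}.
         L2_norm (\<lambda>x. regularise \<omega> \<psi> u0 \<epsilon> x - regularise \<omega> \<psi>' u0 \<epsilon> x) \<le> C * \<epsilon> powr l)"
      and sol: "\<forall>\<epsilon>\<in>{0<..1}. heat_solution T (regularise \<omega> \<psi> q \<epsilon>) (regularise \<omega> \<psi> u0 \<epsilon>) (u \<epsilon>) \<and>
         heat_solution T (regularise \<omega> \<psi>' q \<epsilon>) (regularise \<omega> \<psi>' u0 \<epsilon>) (u' \<epsilon>)"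
      and N: "N > 0"
    for q u0 :: "('a \<Rightarrow> complex) \<Rightarrow> complex" and \<psi> \<psi>' :: "'a \<Rightarrow> real" and C0 C1 N :: real
      and u u' :: "real \<Rightarrow> real \<Rightarrow> 'a \<Rightarrow> complex"
  proof -
    \<comment> \<open>The exponent lost to one exponential: inserting
      \<open>M = C0 * lg \<epsilon>\<close> turns \<open>exp ((M + 1) * T)\<close> into
      \<open>K * \<epsilon> powr (- a)\<close>.\<close>
    define a where "a = C0 * T"
    have a: "a > 0" using C0 assms by (simp add: a_def)
    define K where "K = exp ((C0 + 1) * T)"
    have K: "K > 0" by (simp add: K_def)
    \<comment> \<open>The order exceeds \<open>N\<close> by \<open>2 * a\<close> for the two
      exponentials and by 1 for the size of the second initial datum, which is at most
      \<open>C1 * lg \<epsilon>\<close>.\<close>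
    obtain Cq where Cq: "Cq > 0" "\<And>\<epsilon>. \<epsilon> \<in> {0<..1} \<Longrightarrow>
         Linf_norm (\<lambda>x. regularise \<omega> \<psi> q \<epsilon> x - regularise \<omega> \<psi>' q \<epsilon> x) \<le> ereal (Cq * \<epsilon> powr (N + 2 *
             a + 1))"
      using qd[rule_format, of "N + 2 * a + 1"] N a by auto
    \<comment> \<open>The difference of the initial data meets only one exponential, so an excess of
      \<open>a\<close> is enough.\<close>
    obtain Cu where Cu: "Cu > 0" "\<And>\<epsilon>. \<epsilon> \<in> {0<..1} \<Longrightarrow>
         L2_norm (\<lambda>x. regularise \<omega> \<psi> u0 \<epsilon> x - regularise \<omega> \<psi>' u0 \<epsilon> x) \<le> Cu * \<epsilon> powr (N + a)"
      using ud[rule_format, of "N + a"] N a by auto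
    show ?thesis
    proof (intro exI[of _ "Cu * K + sqrt T * (Cq * (C1 * K)) * K"] conjI ballI)
      show "0 < Cu * K + sqrt T * (Cq * (C1 * K)) * K"
        using Cu(1) Cq(1) K C1 assms by (intro add_pos_nonneg) auto
      fix t \<epsilon> :: real assume t: "t \<in> {0..T}" and e: "\<epsilon> \<in> {0<..1}"
      have e0: "\<epsilon> > 0" using e by simp
      define M where "M = C0 * lg \<epsilon>"
      have M: "M \<ge> 0" using C0 lg1[OF e] by (simp add: M_def)
      let ?p = "regularise \<omega> \<psi> q \<epsilon>" and ?p' = "regularise \<omega> \<psi>' q \<epsilon>"
      let ?v = "regularise \<omega> \<psi> u0 \<epsilon>" and ?v' = "regularise \<omega> \<psi>' u0 \<epsilon>"
      have "C0 * \<omega> \<epsilon> powr (- real N0) \<le> M" unfolding M_def using \<omega>pow[OF e, of N0] C0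
          by (intro mult_left_mono) auto
      then have pl: "Linf_norm ?p \<le> ereal M" and pl': "Linf_norm ?p' \<le> ereal M"
        using qb e by (meson ereal_less_eq(3) order_trans)+
      have v': "L2_norm ?v' \<le> C1 * lg \<epsilon>"
        using ub e mult_left_mono[OF \<omega>pow[OF e, of N1], of C1] C1
            by (meson le_add2 less_imp_le order_trans)
      have exp: "exp ((M + 1) * T) = K * \<epsilon> powr (- a)"
      proof -
        have "(M + 1) * T = (C0 + 1) * T + (- a) * ln \<epsilon>"
            by (simp add: M_def lg_def a_def algebra_simps)
        then show ?thesis using e0 by (simp only: K_def powr_def exp_add) simp
      qed
      \<comment> \<open>From ln(1/\<epsilon>) \<le> 1/\<epsilon> - 1. This crude bound costs a
        single power of \<epsilon>, covered by the excess 1 chosen above.\<close>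
      have lge: "lg \<epsilon> \<le> \<epsilon> powr (-1)"
        using ln_le_minus_one[of "1 / \<epsilon>"] e0 by (simp add: lg_def ln_div powr_minus_divide)
      have "L2_norm (\<lambda>x. u \<epsilon> t x - u' \<epsilon> t x) \<le>
        (L2_norm (\<lambda>x. ?v x - ?v' x) + sqrt T * ((Cq * \<epsilon> powr (N + 2 * a + 1)) * (L2_norm ?v' * exp
            ((M + 1) * T)))) * exp ((M + 1) * T)"
      proof (rule heat_solution_difference[OF assms moll M _ _ _ _ _ _ _ _ _ _ t])
        show "0 \<le> Cq * \<epsilon> powr (N + 2 * a + 1)" using Cq(1) by simp
        show "?p \<in> borel_measurable lborel" "?p' \<in> borel_measurable lborel"
          using nonneg e Linf_norm_le_imp(1)[OF pl] Linf_norm_le_imp(1)[OF pl'] nonneg_measurable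
              by blast+
        show "AE x in lborel. norm (?p x) \<le> M" "AE x in lborel. norm (?p' x) \<le> M"
          by (rule Linf_norm_le_imp(2)[OF pl], rule Linf_norm_le_imp(2)[OF pl'])
        show "AE x in lborel. norm (?p x - ?p' x) \<le> Cq * \<epsilon> powr (N + 2 * a + 1)"
          by (rule Linf_norm_le_imp(2)[OF Cq(2)[OF e]])
      qed (use ub sol e in auto)
      also have "\<dots> \<le> (Cu * \<epsilon> powr (N + a) + sqrt T * ((Cq * \<epsilon> powr (N + 2 * a
          + 1)) * ((C1 * \<epsilon> powr (-1)) * (K * \<epsilon> powr (- a))))) * (K * \<epsilon> powr (- a))"
        unfolding exp
      proof (intro mult_right_mono add_mono mult_left_mono Cu(2)[OF e])
        show "L2_norm ?v' \<le> C1 * \<epsilon> powr (-1)"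
          using v' mult_left_mono[OF lge, of C1] C1 by linarith
      qed (use K Cq(1) assms in auto)
      also have "\<dots> = Cu * K * (\<epsilon> powr (N + a) * \<epsilon> powr (- a)) + sqrt T * (Cq * (C1 * K)) * K *
          (\<epsilon> powr (N + 2 * a + 1) * \<epsilon> powr (-1) * \<epsilon> powr (- a) * \<epsilon> powr (- a))"
        by (simp only: algebra_simps)
      also have "\<dots> = (Cu * K + sqrt T * (Cq * (C1 * K)) * K) * \<epsilon> powr N"
        by (simp only: powr_add[symmetric]) (simp add: algebra_simps)
      finally show "L2_norm (\<lambda>x. u \<epsilon> t x - u' \<epsilon> t x) \<le> (Cu * K
          + sqrt T * (Cq * (C1 * K)) * K) * \<epsilon> powr N" .
    qed
  qed
  show ?thesis
  proof (rule exI[of _ \<omega>], intro conjI allI impI)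
    show "\<forall>\<epsilon>\<in>{0<..1}. \<omega> \<epsilon> \<in> {0<..1}" using \<omega>01 by blast
    show "(\<omega> \<longlongrightarrow> 0) (at_right 0)" by (rule \<omega>lim)
  qed (rule main; assumption)
qed

end
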